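(* Let $G=A*_{\varphi}$ be an HNN extension, where $\varphi\colon C_1\to C_2$ is an isomorphism between two subgroups of $A$. Suppose that $A$ has the f.g.i.p. and that, for $i=1,2$, $A$ has the f.c.i.p. relative to $C_i$ and $(A,C_i)$ has the $C_i$-f.g.i.p. Then $G$ has the f.g.i.p. if and only if $G$ has the f.g.i.p. relative to $C_1$.
   Context: Conventions: $H^g=g^{-1}Hg$; $B\backslash G/C$ is the set of double cosets $BhC$. The HNN extension is $A*_\varphi=\langle A,t\mid t^{-1}ct=\varphi(c),\ c\in C_1\rangle$. A group $G$ has the f.g.i.p. if the intersection of any two finitely generated subgroups is finitely generated; $G$ has the f.g.i.p. relative to a subgroup $H$ if $K\cap H$ is finitely generated for every finitely generated $K\le G$. For a subgroup $A\le G$, the pair $(G,A)$ has the $A$-f.g.i.p. if $G$ has the f.g.i.p. and for all finitely generated $H,K\le G$ there are only finitely many double cosets $HgK$ with $g\in A$ and $H^g\cap K\not\le A$. f.c.i.p.: for finitely generated subgroups $A,B,C\le G$ and $f,g\in G$, let $q^A_{f,g}\colon (A\cap B^f)\backslash A/(A\cap C^g)\to B\backslash G/C$ be the (well-defined) map $(A\cap B^f)a(A\cap C^g)\mapsto B\,fag^{-1}\,C$. $G$ has the f.c.i.p. relative to a finitely generated subgroup $A$ if for every pair $B,C$ of finitely generated subgroups of $G$ and all finite sets $\mathcal F,\mathcal G\subset G$ whose elements lie in pairwise distinct $(B,A)$-double cosets, respectively $(C,A)$-double cosets, $$\sum_{BhC\in B\backslash G/C}\max\Big\{0,\Big(\sum_{f\in\mathcal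 F,\,g\in\mathcal G}\big|(q^A_{f,g})^{-1}(BhC)\big|\Big)-1\Big\}<\infty .$$ (The f.c.i.p. relative to a subgroup is only defined for finitely generated subgroups, so $C_1,C_2$ are finitely generated.) *)

theory Defs
  imports "HOL-Algebra.Generated_Groups" "HOL-Analysis.Infinite_Sum" "HOL-Library.Extended_Nat"
begin

section \<open>Finitely generated intersection properties\<close>

definition fg_subgroup :: "'a set \<Rightarrow> ('a, 'b) monoid_scheme \<Rightarrow> bool" where
  "fg_subgroup H G \<longleftrightarrow>
     subgroup H G \<and> (\<exists>S. finite S \<and> S \<subseteq> carrier G \<and> H = generate G S)"

definition fgip :: "('a, 'b) monoid_scheme \<Rightarrow> bool" where
  "fgip G \<longleftrightarrow> (\<forall>H K. fg_subgroup H G \<longrightarrow> fg_subgroup K G \<longrightarrow> fg_subgroup (H \<inter> K) G)"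

definition fgip_rel :: "('a, 'b) monoid_scheme \<Rightarrow> 'a set \<Rightarrow> bool" where
  "fgip_rel G H \<longleftrightarrow> (\<forall>K. fg_subgroup K G \<longrightarrow> fg_subgroup (K \<inter> H) G)"

definition conj_subgroup :: "('a, 'b) monoid_scheme \<Rightarrow> 'a set \<Rightarrow> 'a \<Rightarrow> 'a set" where
  "conj_subgroup G H g = (inv\<^bsub>G\<^esub> g <#\<^bsub>G\<^esub> H) #>\<^bsub>G\<^esub> g"

definition double_coset :: "('a, 'b) monoid_scheme \<Rightarrow> 'a set \<Rightarrow> 'a \<Rightarrow> 'a set \<Rightarrow> 'a set" where
  "double_coset G B h C = (B #>\<^bsub>G\<^esub> h) <#>\<^bsub>G\<^esub> C"

definition fgip_pair :: "('a, 'b) monoid_scheme \<Rightarrow> 'a set \<Rightarrow> bool" where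
  "fgip_pair G A \<longleftrightarrow> fgip G \<and>
     (\<forall>H K. fg_subgroup H G \<longrightarrow> fg_subgroup K G \<longrightarrow>
        finite {double_coset G H g K | g. g \<in> A \<and> \<not> conj_subgroup G H g \<inter> K \<subseteq> A})"


section \<open>The f.c.i.p. relative to a subgroup\<close>

text \<open>
  The set \<open>double_cosets G B S C\<close> is \<open>B \ S / C\<close>; the operations are those of \<open>G\<close>, and
  \<open>S\<close> is either the whole group or a subgroup containing \<open>B\<close> and \<open>C\<close>.
\<close>

definition double_cosets :: "('a, 'b) monoid_scheme \<Rightarrow> 'a set \<Rightarrow> 'a set \<Rightarrow> 'a set \<Rightarrow> 'a set set" where
  "double_cosets G B S C = (\<lambda>h. double_coset G B h C) ` S"

definition fcip_dom ::
    "('a, 'b) monoid_scheme \<Rightarrow> 'a set \<Rightarrow> 'a set \<Rightarrow> 'a set \<Rightarrow> 'a \<Rightarrow> 'a \<Rightarrow> 'a set set" where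
  "fcip_dom G A B C f g =
     double_cosets G (A \<inter> conj_subgroup G B f) A (A \<inter> conj_subgroup G C g)"

text \<open>
  The map \<open>q\<close> from \<open>fcip_dom G A B C f g\<close> to \<open>B \ G / C\<close>. The value on a double coset is
  computed from an arbitrary representative; \<open>fcip_map_eq\<close> below shows that the choice is
  irrelevant.
\<close>

definition fcip_map ::
    "('a, 'b) monoid_scheme \<Rightarrow> 'a set \<Rightarrow> 'a set \<Rightarrow> 'a \<Rightarrow> 'a \<Rightarrow> 'a set \<Rightarrow> 'a set" where
  "fcip_map G B C f g E =
     the_elem ((\<lambda>a. double_coset G B (f \<otimes>\<^bsub>G\<^esub> a \<otimes>\<^bsub>G\<^esub> inv\<^bsub>G\<^esub> g) C) ` E)"

definition ecard :: "'a set \<Rightarrow> enat" where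
  "ecard S = (if finite S then enat (card S) else \<infinity>)"

text \<open>
  Fibres of \<open>q\<close> may be infinite, so the sum is taken in \<open>enat\<close>, where every family is summable.
  Subtraction on \<open>enat\<close> is truncated, with \<open>\<infinity> - 1 = \<infinity>\<close>.
\<close>

definition fcip_rel :: "('a, 'b) monoid_scheme \<Rightarrow> 'a set \<Rightarrow> bool" where
  "fcip_rel G A \<longleftrightarrow> fg_subgroup A G \<and>
     (\<forall>B C \<F> \<G>.
        fg_subgroup B G \<longrightarrow> fg_subgroup C G \<longrightarrow>
        finite \<F> \<longrightarrow> \<F> \<subseteq> carrier G \<longrightarrow> inj_on (\<lambda>f. double_coset G B f A) \<F> \<longrightarrow>
        finite \<G> \<longrightarrow> \<G> \<subseteq> carrier G \<longrightarrow> inj_on (\<lambda>g. double_coset G C g A) \<G> \<longrightarrow>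
        (\<Sum>\<^sub>\<infinity> D \<in> double_cosets G B (carrier G) C.
           max 0 ((\<Sum>f\<in>\<F>. \<Sum>g\<in>\<G>. ecard {E \<in> fcip_dom G A B C f g. fcip_map G B C f g E = D}) - 1))
        < \<infinity>)"

context group
begin

lemma mem_double_coset:
  "x \<in> double_coset G B h C \<longleftrightarrow> (\<exists>b\<in>B. \<exists>c\<in>C. x = b \<otimes> h \<otimes> c)"
  by (auto simp: double_coset_def r_coset_def set_mult_def)

lemma mem_conj_subgroup:
  "x \<in> conj_subgroup G H g \<longleftrightarrow> (\<exists>h\<in>H. x = inv g \<otimes> h \<otimes> g)"
  by (auto simp: conj_subgroup_def r_coset_def l_coset_def)

lemma inv_cancel:
  "x \<in> carrier G \<Longrightarrow> y \<in> carrier G \<Longrightarrow> inv x \<otimes> (x \<otimes> y) = y"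
  "x \<in> carrier G \<Longrightarrow> y \<in> carrier G \<Longrightarrow> x \<otimes> (inv x \<otimes> y) = y"
  by (simp_all flip: m_assoc)

lemma double_coset_absorb:
  assumes B: "subgroup B G" and C: "subgroup C G"
    and h: "h \<in> carrier G" and b: "b \<in> B" and c: "c \<in> C"
  shows "double_coset G B (b \<otimes> h \<otimes> c) C = double_coset G B h C"
proof -
  note mem = subgroup.mem_carrier[OF B] subgroup.mem_carrier[OF C]
  note closed = subgroup.m_closed[OF B] subgroup.m_inv_closed[OF B]
    subgroup.m_closed[OF C] subgroup.m_inv_closed[OF C]
  have 1: "x \<otimes> (b \<otimes> h \<otimes> c) \<otimes> y = (x \<otimes> b) \<otimes> h \<otimes> (c \<otimes> y)" if "x \<in> B" "y \<in> C" for x y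
    using that h b c by (simp add: m_assoc mem)
  have 2: "x \<otimes> h \<otimes> y = (x \<otimes> inv b) \<otimes> (b \<otimes> h \<otimes> c) \<otimes> (inv c \<otimes> y)" if "x \<in> B" "y \<in> C" for x y
    using that h b c by (simp add: m_assoc inv_cancel mem)
  show ?thesis
  proof (intro subset_antisym subsetI)
    fix z assume "z \<in> double_coset G B (b \<otimes> h \<otimes> c) C"
    then obtain x y where "x \<in> B" "y \<in> C" "z = x \<otimes> (b \<otimes> h \<otimes> c) \<otimes> y"
      by (auto simp: mem_double_coset)
    then show "z \<in> double_coset G B h C"
      unfolding mem_double_coset
      by (intro bexI[of _ "x \<otimes> b"] bexI[of _ "c \<otimes> y"]) (simp_all only: 1 closed b c)
  next
    fix z assume "z \<in> double_coset G B h C"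
    then obtain x y where xy: "x \<in> B" "y \<in> C" and z: "z = x \<otimes> h \<otimes> y"
      by (auto simp: mem_double_coset)
    show "z \<in> double_coset G B (b \<otimes> h \<otimes> c) C"
      unfolding mem_double_coset
      using xy z 2[OF xy]
      by (intro bexI[of _ "x \<otimes> inv b"] bexI[of _ "inv c \<otimes> y"]) (assumption | simp only: closed b c)+
  qed
qed

lemma fcip_map_eq:
  assumes A: "subgroup A G" and B: "subgroup B G" and C: "subgroup C G"
    and f: "f \<in> carrier G" and g: "g \<in> carrier G" and a: "a \<in> A"
  shows "fcip_map G B C f g
           (double_coset G (A \<inter> conj_subgroup G B f) a (A \<inter> conj_subgroup G C g))
         = double_coset G B (f \<otimes> a \<otimes> inv g) C"
proof -
  let ?E = "double_coset G (A \<inter> conj_subgroup G B f) a (A \<inter> conj_subgroup G C g)"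
  let ?q = "\<lambda>a. double_coset G B (f \<otimes> a \<otimes> inv g) C"
  note carr = subgroup.mem_carrier[OF A] subgroup.mem_carrier[OF B] subgroup.mem_carrier[OF C]
  have one: "\<one> \<in> conj_subgroup G H x" if "subgroup H G" "x \<in> carrier G" for H x
    unfolding mem_conj_subgroup
    using that by (intro bexI[of _ \<one>] subgroup.one_closed) simp_all
  have "\<one> \<in> A \<inter> conj_subgroup G B f" "\<one> \<in> A \<inter> conj_subgroup G C g"
    using one[OF B f] one[OF C g] subgroup.one_closed[OF A] by simp_all
  moreover have "a = \<one> \<otimes> a \<otimes> \<one>" using carr(1)[OF a] by simp
  ultimately have "a \<in> ?E" unfolding mem_double_coset by (intro bexI)
  moreover have "?q x = ?q a" if "x \<in> ?E" for x
  proof -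
    obtain b c where bc: "b \<in> B" "c \<in> C" and x: "x = (inv f \<otimes> b \<otimes> f) \<otimes> a \<otimes> (inv g \<otimes> c \<otimes> g)"
      using \<open>x \<in> ?E\<close> by (auto simp: mem_double_coset mem_conj_subgroup)
    have "f \<otimes> x \<otimes> inv g = b \<otimes> (f \<otimes> a \<otimes> inv g) \<otimes> c"
      using f g a bc by (simp add: x m_assoc inv_cancel carr)
    moreover have "f \<otimes> a \<otimes> inv g \<in> carrier G" using f g carr(1)[OF a] by simp
    ultimately show ?thesis using double_coset_absorb[OF B C _ bc] by simp
  qed
  ultimately have "?q ` ?E = {?q a}" by blast
  then show ?thesis by (simp add: fcip_map_def)
qed

end


section \<open>HNN extensions\<close>

text \<open>
  The group presented by \<open>\<langle>A, t | t\<^sup>-\<^sup>1 c t = \<phi> c, c \<in> C\<rangle>\<close>: words in the elements of \<open>A\<close> and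
  the letters \<open>t\<close>, \<open>t\<^sup>-\<^sup>1\<close>, modulo the least congruence generated by the multiplication table
  of \<open>A\<close>, the cancellation of \<open>t\<close> against \<open>t\<^sup>-\<^sup>1\<close>, and the defining relations.
\<close>

datatype 'a hnn_letter = Base 'a | Stable | StableInv

definition hnn_words :: "('a, 'b) monoid_scheme \<Rightarrow> 'a hnn_letter list set" where
  "hnn_words A = lists (Base ` carrier A \<union> {Stable, StableInv})"

inductive_set hnn_rel ::
    "('a, 'b) monoid_scheme \<Rightarrow> 'a set \<Rightarrow> ('a \<Rightarrow> 'a) \<Rightarrow> ('a hnn_letter list \<times> 'a hnn_letter list) set"
  for A C \<phi> where
  refl: "w \<in> hnn_words A \<Longrightarrow> (w, w) \<in> hnn_rel A C \<phi>"
| sym: "(v, w) \<in> hnn_rel A C \<phi> \<Longrightarrow> (w, v) \<in> hnn_rel A C \<phi>"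
| trans: "(u, v) \<in> hnn_rel A C \<phi> \<Longrightarrow> (v, w) \<in> hnn_rel A C \<phi> \<Longrightarrow> (u, w) \<in> hnn_rel A C \<phi>"
| append: "(u, u') \<in> hnn_rel A C \<phi> \<Longrightarrow> (v, v') \<in> hnn_rel A C \<phi> \<Longrightarrow> (u @ v, u' @ v') \<in> hnn_rel A C \<phi>"
| base_one: "([Base \<one>\<^bsub>A\<^esub>], []) \<in> hnn_rel A C \<phi>"
| base_mult: "a \<in> carrier A \<Longrightarrow> b \<in> carrier A \<Longrightarrow> ([Base a, Base b], [Base (a \<otimes>\<^bsub>A\<^esub> b)]) \<in> hnn_rel A C \<phi>"
| stable_right: "([Stable, StableInv], []) \<in> hnn_rel A C \<phi>"
| stable_left: "([StableInv, Stable], []) \<in> hnn_rel A C \<phi>"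
| hnn: "c \<in> C \<Longrightarrow> ([StableInv, Base c, Stable], [Base (\<phi> c)]) \<in> hnn_rel A C \<phi>"

definition hnn_class ::
    "('a, 'b) monoid_scheme \<Rightarrow> 'a set \<Rightarrow> ('a \<Rightarrow> 'a) \<Rightarrow> 'a hnn_letter list \<Rightarrow> 'a hnn_letter list set" where
  "hnn_class A C \<phi> w = hnn_rel A C \<phi> `` {w}"

definition hnn_extension ::
    "('a, 'b) monoid_scheme \<Rightarrow> 'a set \<Rightarrow> ('a \<Rightarrow> 'a) \<Rightarrow> 'a hnn_letter list set monoid" where
  "hnn_extension A C \<phi> =
     \<lparr>carrier = hnn_words A // hnn_rel A C \<phi>,
      monoid.mult = (\<lambda>P Q. \<Union>u\<in>P. \<Union>v\<in>Q. hnn_class A C \<phi> (u @ v)),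
      one = hnn_class A C \<phi> []\<rparr>"

definition hnn_base :: "('a, 'b) monoid_scheme \<Rightarrow> 'a set \<Rightarrow> ('a \<Rightarrow> 'a) \<Rightarrow> 'a \<Rightarrow> 'a hnn_letter list set" where
  "hnn_base A C \<phi> a = hnn_class A C \<phi> [Base a]"

locale hnn_data = group A for A (structure) +
  fixes C1 C2 :: "'a set" and \<phi> :: "'a \<Rightarrow> 'a"
  assumes C1: "subgroup C1 A" and C2: "subgroup C2 A"
    and iso: "\<phi> \<in> iso (A\<lparr>carrier := C1\<rparr>) (A\<lparr>carrier := C2\<rparr>)"
begin

abbreviation "R \<equiv> hnn_rel A C1 \<phi>"
abbreviation "cls \<equiv> hnn_class A C1 \<phi>"
abbreviation "HNN \<equiv> hnn_extension A C1 \<phi>"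

lemma hnn_rel_words: "(v, w) \<in> R \<Longrightarrow> v \<in> hnn_words A \<and> w \<in> hnn_words A"
proof (induction rule: hnn_rel.induct)
  case (hnn c)
  have "\<phi> c \<in> C2" using iso hnn by (auto simp: iso_def hom_def)
  then show ?case
    using hnn subgroup.mem_carrier[OF C1] subgroup.mem_carrier[OF C2] by (auto simp: hnn_words_def)
qed (auto simp: hnn_words_def)

lemma equiv_hnn_rel: "equiv (hnn_words A) R"
proof (rule equivI)
  show "R \<subseteq> hnn_words A \<times> hnn_words A" by (auto dest: hnn_rel_words)
  show "refl_on (hnn_words A) R" by (rule refl_onI) (rule hnn_rel.refl)
  show "sym R" by (rule symI) (rule hnn_rel.sym)
  show "trans R" by (rule transI) (rule hnn_rel.trans)
qed

lemma hnn_class_eq_iff: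
  "v \<in> hnn_words A \<Longrightarrow> w \<in> hnn_words A \<Longrightarrow> cls v = cls w \<longleftrightarrow> (v, w) \<in> R"
  unfolding hnn_class_def by (rule eq_equiv_class_iff[OF equiv_hnn_rel])

lemma hnn_words_append [simp]: "u @ v \<in> hnn_words A \<longleftrightarrow> u \<in> hnn_words A \<and> v \<in> hnn_words A"
  by (auto simp: hnn_words_def)

lemma hnn_words_Nil [simp]: "[] \<in> hnn_words A"
  by (simp add: hnn_words_def)

lemma hnn_carrier: "carrier HNN = cls ` hnn_words A"
  by (auto simp: hnn_extension_def hnn_class_def quotient_def)

lemma hnn_one: "\<one>\<^bsub>HNN\<^esub> = cls []"
  by (simp add: hnn_extension_def)

lemma hnn_mult:
  assumes "u \<in> hnn_words A" "v \<in> hnn_words A"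
  shows "cls u \<otimes>\<^bsub>HNN\<^esub> cls v = cls (u @ v)"
proof -
  have *: "cls (u' @ v') = cls (u @ v)" if "u' \<in> cls u" "v' \<in> cls v" for u' v'
  proof -
    have "(u, u') \<in> R" "(v, v') \<in> R" using that by (simp_all add: hnn_class_def)
    then have "(u' @ v', u @ v) \<in> R" by (rule hnn_rel.append[OF hnn_rel.sym hnn_rel.sym])
    then show ?thesis unfolding hnn_class_def by (rule equiv_class_eq[OF equiv_hnn_rel])
  qed
  have uv: "u \<in> cls u" "v \<in> cls v"
    using assms by (simp_all add: hnn_class_def hnn_rel.refl)
  have "(\<Union>u'\<in>cls u. \<Union>v'\<in>cls v. cls (u' @ v')) = cls (u @ v)"
  proof (intro subset_antisym UN_least)
    show "cls (u @ v) \<subseteq> (\<Union>u'\<in>cls u. \<Union>v'\<in>cls v. cls (u' @ v'))"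
      using subset_trans[OF UN_upper[OF uv(2), of "\<lambda>v'. cls (u @ v')"]
          UN_upper[OF uv(1), of "\<lambda>u'. \<Union>v'\<in>cls v. cls (u' @ v')"]] .
    show "cls (u' @ v') \<subseteq> cls (u @ v)" if "u' \<in> cls u" "v' \<in> cls v" for u' v'
      using *[OF that] by simp
  qed
  then show ?thesis by (simp add: hnn_extension_def)
qed

lemma hnn_letter_inverse:
  assumes "[l] \<in> hnn_words A"
  shows "\<exists>l'. [l'] \<in> hnn_words A \<and> ([l', l], []) \<in> R"
proof (cases l)
  case (Base a)
  then have a: "a \<in> carrier A" using assms by (auto simp: hnn_words_def)
  then have "([Base (inv a), Base a], [Base \<one>]) \<in> R"
    using hnn_rel.base_mult[of "inv a" A a] by simp
  then have "([Base (inv a), Base a], []) \<in> R"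
    using hnn_rel.base_one by (rule hnn_rel.trans)
  then show ?thesis
    using a Base by (intro exI[of _ "Base (inv a)"]) (auto simp: hnn_words_def)
next
  case Stable
  then show ?thesis
    by (intro exI[of _ StableInv]) (auto simp: hnn_words_def intro: hnn_rel.stable_left)
next
  case StableInv
  then show ?thesis
    by (intro exI[of _ Stable]) (auto simp: hnn_words_def intro: hnn_rel.stable_right)
qed

lemma hnn_word_inverse:
  "w \<in> hnn_words A \<Longrightarrow> \<exists>v \<in> hnn_words A. (v @ w, []) \<in> R"
proof (induction w)
  case Nil
  then show ?case by (auto intro!: bexI[of _ "[]"] hnn_rel.refl)
next
  case (Cons l w)
  then have lw: "[l] \<in> hnn_words A" "w \<in> hnn_words A" by (auto simp: hnn_words_def)
  obtain v where v: "v \<in> hnn_words A" "(v @ w, []) \<in> R" using Cons lw by blast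
  obtain l' where l': "[l'] \<in> hnn_words A" "([l', l], []) \<in> R" using hnn_letter_inverse lw by blast
  have "(v @ [l', l] @ w, v @ [] @ w) \<in> R"
    using v l' lw by (intro hnn_rel.append) (auto intro: hnn_rel.refl)
  then have "((v @ [l']) @ l # w, v @ w) \<in> R" by simp
  then have "((v @ [l']) @ l # w, []) \<in> R" using v(2) by (rule hnn_rel.trans)
  then show ?case using v l' by (intro bexI[of _ "v @ [l']"]) auto
qed

lemma group_hnn_extension: "group HNN"
proof (rule groupI)
  fix x assume "x \<in> carrier HNN"
  then obtain w where w: "w \<in> hnn_words A" "x = cls w" by (auto simp: hnn_carrier)
  obtain v where v: "v \<in> hnn_words A" "(v @ w, []) \<in> R" using hnn_word_inverse w by blast
  then have "cls v \<otimes>\<^bsub>HNN\<^esub> x = \<one>\<^bsub>HNN\<^esub>"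
    using w by (simp add: hnn_mult hnn_one hnn_class_eq_iff)
  then show "\<exists>y\<in>carrier HNN. y \<otimes>\<^bsub>HNN\<^esub> x = \<one>\<^bsub>HNN\<^esub>" using v by (auto simp: hnn_carrier)
qed (auto simp: hnn_carrier hnn_one hnn_mult)

lemma hnn_base_hom: "hnn_base A C1 \<phi> \<in> hom A HNN"
proof (rule homI)
  fix a b assume ab: "a \<in> carrier A" "b \<in> carrier A"
  then have "[Base a] \<in> hnn_words A" "[Base b] \<in> hnn_words A" "[Base (a \<otimes> b)] \<in> hnn_words A"
    by (auto simp: hnn_words_def)
  then show "hnn_base A C1 \<phi> (a \<otimes> b) = hnn_base A C1 \<phi> a \<otimes>\<^bsub>HNN\<^esub> hnn_base A C1 \<phi> b"
    using hnn_rel_words[OF hnn_rel.base_mult[OF ab]] hnn_rel.base_mult[OF ab, of C1 \<phi>]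
    by (simp add: hnn_base_def hnn_mult hnn_class_eq_iff hnn_rel.sym)
qed (auto simp: hnn_base_def hnn_carrier hnn_words_def)

lemma hnn_relation:
  assumes "c \<in> C1"
  shows "inv\<^bsub>HNN\<^esub> (cls [Stable]) \<otimes>\<^bsub>HNN\<^esub> hnn_base A C1 \<phi> c \<otimes>\<^bsub>HNN\<^esub> cls [Stable]
         = hnn_base A C1 \<phi> (\<phi> c)"
proof -
  interpret H: group HNN by (rule group_hnn_extension)
  have w: "[Stable] \<in> hnn_words A" "[StableInv] \<in> hnn_words A" "[Base c] \<in> hnn_words A"
    using assms subgroup.mem_carrier[OF C1] by (auto simp: hnn_words_def)
  have rel: "([StableInv, Base c, Stable], [Base (\<phi> c)]) \<in> R" using assms by (rule hnn_rel.hnn)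
  have "cls [StableInv] \<otimes>\<^bsub>HNN\<^esub> cls [Stable] = \<one>\<^bsub>HNN\<^esub>"
    using w hnn_rel.stable_left hnn_rel_words[OF hnn_rel.stable_left]
    by (simp add: hnn_mult hnn_one hnn_class_eq_iff)
  then have "inv\<^bsub>HNN\<^esub> (cls [Stable]) = cls [StableInv]"
    using w by (intro H.inv_equality) (auto simp: hnn_carrier)
  moreover have "[StableInv, Base c] \<in> hnn_words A"
    using w by (auto simp: hnn_words_def)
  ultimately show ?thesis
    using w rel hnn_rel_words[OF rel] by (simp add: hnn_base_def hnn_mult hnn_class_eq_iff)
qed

end

end

theory Submission
  imports Defs
begin

text \<open>
  If \<open>G\<close> has the f.g.i.p., it has the f.g.i.p. relative to \<open>C1\<close> because \<open>C1\<close> is finitely generated. The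
  converse is proved with the action of \<open>G\<close> on its Bass-Serre tree, whose vertices are the cosets
  \<open>g A\<close> and whose edges join \<open>g A\<close> to \<open>g t A\<close>. Vertex stabilisers are conjugates of \<open>A\<close>, edge
  stabilisers are conjugates of \<open>C1\<close>.

  Let \<open>H\<close> and \<open>K\<close> be finitely generated. Each acts on a subtree containing the base vertex with finitely
  many orbits of edges. The edge stabilisers in \<open>H\<close> are finitely generated, since \<open>G\<close> has the f.g.i.p.
  relative to \<open>C1\<close>; as \<open>H\<close> itself is finitely generated, so are its vertex stabilisers
  (\<open>fg_vertex_stabilizer\<close>). The same holds for \<open>K\<close>.

  The intersection \<open>H \<inter> K\<close> acts on the intersection of the two subtrees, which is connected
  (\<open>forest_walks_meet\<close>). Its vertex stabilisers are finitely generated by the f.g.i.p. of \<open>A\<close>, but there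
  may be infinitely many orbits of vertices. They are parametrised by double cosets \<open>B a C\<close> in \<open>A\<close>, where
  \<open>B\<close> and \<open>C\<close> range over finitely many vertex stabilisers of \<open>H\<close> and of \<open>K\<close>, conjugated into \<open>A\<close>. The
  fibres in the f.c.i.p. count the edges at these vertices modulo stabilisers, and the pair condition says
  that the stabilisers almost always fix the edges. Hence all but finitely many orbits consist of
  vertices with at most one edge in each direction (\<open>fcip_pair_almost_all_unique\<close>), and at every vertex
  there are finitely many edges modulo the stabiliser (\<open>fcip_finite_orbits\<close>).

  So the intersection of the subtrees consists of finitely many orbits of branching vertices, joined by
  unbranched paths. Contracting these paths leaves a connected graph with finitely many orbits of vertices
  and edges and with finitely generated vertex stabilisers, and a group acting on such a graph is finitely
  generated (\<open>fg_of_finitely_many_branchings\<close>).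
\<close>

section \<open>Finitely generated subgroups\<close>

text \<open>
  This turns the finiteness of the sum in the definition of the f.c.i.p. into two usable facts: every
  term is finite, and almost every term vanishes, because infinitely many terms that are at least 1
  sum up to \<open>\<infinity>\<close>.
\<close>

lemma enat_infsum_finiteD:
  fixes f :: "'i \<Rightarrow> enat"
  assumes "infsum f X < \<infinity>"
  shows "finite {i \<in> X. f i \<noteq> 0}" and "i \<in> X \<Longrightarrow> f i < \<infinity>"
proof -
  show "finite {i \<in> X. f i \<noteq> 0}"
  proof (rule ccontr)
    assume inf: "infinite {i \<in> X. f i \<noteq> 0}"
    have "infsum f {i \<in> X. f i \<noteq> 0} = \<infinity>"
      by (rule infsum_superconst_infinite_enat[where b = 1]) (use inf in \<open>auto simp: ileI1 one_eSuc\<close>)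
    moreover have "infsum f {i \<in> X. f i \<noteq> 0} = infsum f X"
      by (rule infsum_cong_neutral) auto
    ultimately show False using assms by simp
  qed
  assume i: "i \<in> X"
  have "infsum f {i} \<le> infsum f X"
    by (rule infsum_mono_neutral) (use i in auto)
  from le_less_trans[OF this assms] show "f i < \<infinity>" by simp
qed

lemma fg_subgroup_subgroup: "fg_subgroup H G \<Longrightarrow> subgroup H G"
  by (simp add: fg_subgroup_def)

lemma (in group_hom) fg_subgroup_img:
  assumes "fg_subgroup K G"
  shows "fg_subgroup (h ` K) H"
proof -
  obtain S where S: "finite S" "S \<subseteq> carrier G" "K = generate G S"
    using assms by (auto simp: fg_subgroup_def)
  have "h ` K = generate H (h ` S)" using S generate_img by simp
  moreover have "subgroup (h ` K) H" using assms subgroup_img_is_subgroup by (auto simp: fg_subgroup_def)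
  moreover have "h ` S \<subseteq> carrier H" using S by auto
  ultimately show ?thesis using S(1) unfolding fg_subgroup_def by blast
qed

lemma (in group_hom) fg_subgroup_inj_img:
  assumes inj: "inj_on h (carrier G)" and K: "subgroup K G" and fg: "fg_subgroup (h ` K) H"
  shows "fg_subgroup K G"
proof -
  obtain S where S: "finite S" "h ` K = generate H S"
    using fg by (auto simp: fg_subgroup_def)
  have KG: "K \<subseteq> carrier G" by (rule subgroup.subset[OF K])
  have "S \<subseteq> h ` K" using S(2) by (auto intro: generate.incl)
  then obtain S' where S': "S' \<subseteq> K" "S = h ` S'" "finite S'"
    using S(1) by (meson finite_subset_image)
  have gen: "generate G S' \<subseteq> K" using S' K by (simp add: G.generate_subgroup_incl)
  have "h ` K = h ` generate G S'" using S S' KG generate_img[of S'] by auto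
  then have "K = generate G S'"
    using inj gen KG by (meson inj_on_image_eq_iff order.trans)
  then show ?thesis using S' K KG unfolding fg_subgroup_def by blast
qed

context group
begin

lemma conj_group_hom: "g \<in> carrier G \<Longrightarrow> group_hom G G (\<lambda>x. g \<otimes> x \<otimes> inv g)"
  by unfold_locales (auto intro!: homI simp: m_assoc inv_cancel)

lemma fg_subgroup_conj:
  assumes "fg_subgroup H G" "g \<in> carrier G"
  shows "fg_subgroup ((\<lambda>x. g \<otimes> x \<otimes> inv g) ` H) G"
  by (rule group_hom.fg_subgroup_img[OF conj_group_hom assms(1)]) fact

lemma conj_subgroup_eq: "conj_subgroup G H g = (\<lambda>x. inv g \<otimes> x \<otimes> g) ` H"
  by (auto simp: mem_conj_subgroup)

lemma fg_conj_subgroup: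
  assumes "fg_subgroup H G" "g \<in> carrier G"
  shows "fg_subgroup (conj_subgroup G H g) G"
  using fg_subgroup_conj[of H "inv g"] assms by (simp add: conj_subgroup_eq)

lemma fg_subgroup_of_generators:
  assumes "subgroup H G" "finite Z" "Z \<subseteq> H" "H \<subseteq> generate G Z"
  shows "fg_subgroup H G"
  using assms generate_subgroup_incl[of Z H] subgroup.subset[OF assms(1)]
  unfolding fg_subgroup_def by blast

end

text \<open>
  Finiteness modulo an equivalence is always obtained in this form: each element of \<open>S\<close> carries one of
  finitely many labels, and one chosen element per label represents all elements with that label.
\<close>

lemma finite_representatives:
  assumes "finite L" "\<And>x. x \<in> S \<Longrightarrow> \<exists>l\<in>L. Q l x"
  obtains N where "finite N" "N \<subseteq> S" "\<forall>x\<in>S. \<exists>n\<in>N. \<exists>l\<in>L. Q l n \<and> Q l x"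
proof -
  let ?L = "{l \<in> L. \<exists>x\<in>S. Q l x}"
  have "\<forall>l\<in>?L. \<exists>x. x \<in> S \<and> Q l x" by blast
  then obtain c where c: "\<forall>l\<in>?L. c l \<in> S \<and> Q l (c l)" by (rule bchoice[THEN exE])
  show thesis
  proof (rule that)
    show "finite (c ` ?L)" using assms(1) by simp
    show "c ` ?L \<subseteq> S" using c by blast
    show "\<forall>x\<in>S. \<exists>n\<in>c ` ?L. \<exists>l\<in>L. Q l n \<and> Q l x"
    proof
      fix x assume x: "x \<in> S"
      then obtain l where l: "l \<in> L" "Q l x" using assms(2)[OF x] by (elim bexE)
      with x have "l \<in> ?L" by (intro CollectI conjI bexI)
      then have "c l \<in> c ` ?L" "Q l (c l)" using c by (simp_all only: imageI)
      with l show "\<exists>n\<in>c ` ?L. \<exists>l\<in>L. Q l n \<and> Q l x" by (intro bexI[of _ "c l"] bexI[of _ l] conjI)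
    qed
  qed
qed

section \<open>What the f.c.i.p. and the pair condition say about double cosets\<close>

context group
begin

definition fcip_fibre ::
    "'a set \<Rightarrow> 'a set \<Rightarrow> 'a set \<Rightarrow> 'a set \<Rightarrow> 'a set \<Rightarrow> 'a set \<Rightarrow> ('a \<times> 'a \<times> 'a set) set" where
  "fcip_fibre A B C \<F> \<G> D =
     (SIGMA f:\<F>. SIGMA g:\<G>. {E \<in> fcip_dom G A B C f g. fcip_map G B C f g E = D})"

lemma enat_sum_ecard:
  assumes "finite F" "finite H" "\<And>f g. f \<in> F \<Longrightarrow> g \<in> H \<Longrightarrow> finite (X f g)"
  shows "(\<Sum>f\<in>F. \<Sum>g\<in>H. ecard (X f g)) = enat (card (SIGMA f:F. SIGMA g:H. X f g))"
proof -
  have "(\<Sum>f\<in>F. \<Sum>g\<in>H. ecard (X f g)) = (\<Sum>f\<in>F. \<Sum>g\<in>H. enat (card (X f g)))"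
    using assms by (intro sum.cong) (auto simp: ecard_def)
  also have "\<dots> = enat (\<Sum>f\<in>F. \<Sum>g\<in>H. card (X f g))"
    by (simp flip: of_nat_eq_enat)
  also have "(\<Sum>f\<in>F. \<Sum>g\<in>H. card (X f g)) = card (SIGMA f:F. SIGMA g:H. X f g)"
    using assms by (simp add: card_SigmaI)
  finally show ?thesis .
qed

text \<open>
  The summand of \<open>D\<close> is the size of the total fibre over \<open>D\<close>, lowered by one. Hence if it is
  finite, so is the fibre, and it vanishes exactly if the fibre has at most one element.
\<close>

lemma fcip_fibres:
  assumes "fcip_rel G A" "fg_subgroup B G" "fg_subgroup C G"
    and F: "finite \<F>" "\<F> \<subseteq> carrier G" "inj_on (\<lambda>f. double_coset G B f A) \<F>"
    and H: "finite \<G>" "\<G> \<subseteq> carrier G" "inj_on (\<lambda>g. double_coset G C g A) \<G>"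
  shows "D \<in> double_cosets G B (carrier G) C \<Longrightarrow> finite (fcip_fibre A B C \<F> \<G> D)"
    and "finite {D \<in> double_cosets G B (carrier G) C.
           \<exists>p \<in> fcip_fibre A B C \<F> \<G> D. \<exists>q \<in> fcip_fibre A B C \<F> \<G> D. p \<noteq> q}"
proof -
  let ?s = "\<lambda>D. \<Sum>f\<in>\<F>. \<Sum>g\<in>\<G>. ecard {E \<in> fcip_dom G A B C f g. fcip_map G B C f g E = D}"
  let ?DC = "double_cosets G B (carrier G) C"
  have lt: "(\<Sum>\<^sub>\<infinity> D \<in> ?DC. max 0 (?s D - 1)) < \<infinity>"
    using assms unfolding fcip_rel_def by blast
  have fin: "finite {E \<in> fcip_dom G A B C f g. fcip_map G B C f g E = D}"
    if D: "D \<in> ?DC" and fg: "f \<in> \<F>" "g \<in> \<G>" for D f g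
  proof (rule ccontr)
    assume "infinite {E \<in> fcip_dom G A B C f g. fcip_map G B C f g E = D}"
    then have "ecard {E \<in> fcip_dom G A B C f g. fcip_map G B C f g E = D} = \<infinity>"
      by (simp add: ecard_def)
    moreover have "ecard {E \<in> fcip_dom G A B C f g. fcip_map G B C f g E = D} \<le> ?s D"
    proof -
      have "ecard {E \<in> fcip_dom G A B C f g. fcip_map G B C f g E = D} \<le>
        (\<Sum>g\<in>\<G>. ecard {E \<in> fcip_dom G A B C f g. fcip_map G B C f g E = D})"
        using fg H(1) by (intro member_le_sum) auto
      also have "\<dots> \<le> ?s D"
        using fg F(1) by (intro member_le_sum[where f = "\<lambda>f. \<Sum>g\<in>\<G>. ecard {E \<in> fcip_dom G A B C f g. fcip_map G B C f g E = D}"]) auto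
      finally show ?thesis .
    qed
    ultimately have "?s D = \<infinity>" by simp
    then have "max 0 (?s D - 1) = \<infinity>" by simp
    with enat_infsum_finiteD(2)[OF lt D] show False by simp
  qed
  have s: "?s D = enat (card (fcip_fibre A B C \<F> \<G> D))" if "D \<in> ?DC" for D
    unfolding fcip_fibre_def using F(1) H(1) fin[OF that] by (intro enat_sum_ecard) auto
  show fin': "finite (fcip_fibre A B C \<F> \<G> D)" if "D \<in> ?DC" for D
    unfolding fcip_fibre_def using F(1) H(1) fin[OF that] by (intro finite_SigmaI) auto
  have "max 0 (?s D - 1) \<noteq> 0"
    if D: "D \<in> ?DC" and pq: "p \<in> fcip_fibre A B C \<F> \<G> D" "q \<in> fcip_fibre A B C \<F> \<G> D" "p \<noteq> q" for D p q
  proof -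
    have "card {p, q} \<le> card (fcip_fibre A B C \<F> \<G> D)"
      using pq fin'[OF D] by (intro card_mono) auto
    then have "2 \<le> card (fcip_fibre A B C \<F> \<G> D)" using pq(3) by simp
    then show ?thesis unfolding s[OF D] by (simp add: one_enat_def zero_enat_def max_def)
  qed
  then show "finite {D \<in> ?DC. \<exists>p \<in> fcip_fibre A B C \<F> \<G> D. \<exists>q \<in> fcip_fibre A B C \<F> \<G> D. p \<noteq> q}"
    by (intro finite_subset[OF _ enat_infsum_finiteD(1)[OF lt]]) blast
qed

text \<open>
  Let \<open>x\<close> lie both in \<open>B f A\<close> and in \<open>h C g A\<close>, say \<open>x = b f c = h c' g d\<close>. Then \<open>f (c d\<^sup>-\<^sup>1) g\<^sup>-\<^sup>1\<close> lies in
  \<open>B h C\<close>, so the double coset of \<open>c d\<^sup>-\<^sup>1\<close> is a point of the fibre of \<open>q\<close> over \<open>B h C\<close>. The triple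
  \<open>(f, g, E)\<close> records this point.
\<close>

definition fcip_label :: "'a set \<Rightarrow> 'a set \<Rightarrow> 'a set \<Rightarrow> 'a \<Rightarrow> 'a \<times> 'a \<times> 'a set \<Rightarrow> 'a \<Rightarrow> bool" where
  "fcip_label A B C h = (\<lambda>(f, g, E) x. \<exists>b\<in>B. \<exists>c\<in>A. \<exists>c'\<in>C. \<exists>d\<in>A. x = b \<otimes> f \<otimes> c \<and> x = h \<otimes> (c' \<otimes> g \<otimes> d)
     \<and> E = double_coset G (A \<inter> conj_subgroup G B f) (c \<otimes> inv d) (A \<inter> conj_subgroup G C g))"

text \<open>
  The label determines \<open>x\<close> up to the left action of \<open>B \<inter> h C h\<^sup>-\<^sup>1\<close> and the right action of \<open>A\<close>. This is
  the sense in which the fibre of \<open>q\<close> over \<open>B h C\<close> counts orbits of cosets \<open>x A\<close>.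
\<close>

lemma same_label_same_orbit:
  assumes A: "subgroup A G" and B: "subgroup B G" and C: "subgroup C G"
    and cr: "f \<in> carrier G" "g \<in> carrier G" "h \<in> carrier G"
    and x: "fcip_label A B C h (f, g, E) x" and y: "fcip_label A B C h (f, g, E) y"
  shows "\<exists>u\<in>B. inv h \<otimes> u \<otimes> h \<in> C \<and> (\<exists>e\<in>A. y = u \<otimes> x \<otimes> e)"
proof -
  note carr = subgroup.mem_carrier[OF A] subgroup.mem_carrier[OF B] subgroup.mem_carrier[OF C]
  note closed = subgroup.m_closed[OF A] subgroup.m_closed[OF B] subgroup.m_closed[OF C]
     subgroup.m_inv_closed[OF A] subgroup.m_inv_closed[OF B] subgroup.m_inv_closed[OF C]
  obtain b c c' d where bc: "b \<in> B" "c \<in> A" "c' \<in> C" "d \<in> A" "x = b \<otimes> f \<otimes> c" "x = h \<otimes> (c' \<otimes> g \<otimes> d)"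
    and E: "E = double_coset G (A \<inter> conj_subgroup G B f) (c \<otimes> inv d) (A \<inter> conj_subgroup G C g)"
    using x by (auto simp: fcip_label_def)
  obtain b1 c1 c1' d1 where bc1: "b1 \<in> B" "c1 \<in> A" "c1' \<in> C" "d1 \<in> A" "y = b1 \<otimes> f \<otimes> c1" "y = h \<otimes> (c1' \<otimes> g \<otimes> d1)"
    and E1: "E = double_coset G (A \<inter> conj_subgroup G B f) (c1 \<otimes> inv d1) (A \<inter> conj_subgroup G C g)"
    using y by (auto simp: fcip_label_def)
  have "c1 \<otimes> inv d1 \<in> E"
  proof -
    have "\<one> \<in> A \<inter> conj_subgroup G B f" "\<one> \<in> A \<inter> conj_subgroup G C g"
      using cr by (auto simp: mem_conj_subgroup subgroup.one_closed[OF A] intro: bexI[OF _ subgroup.one_closed[OF B]] bexI[OF _ subgroup.one_closed[OF C]])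
    then show ?thesis unfolding E1 mem_double_coset
      using bc1 carr by (intro bexI[of _ \<one>]) auto
  qed
  then obtain \<beta> \<gamma> b2 c2 where bg: "\<beta> \<in> A" "\<gamma> \<in> A" "b2 \<in> B" "c2 \<in> C" "\<beta> = inv f \<otimes> b2 \<otimes> f" "\<gamma> = inv g \<otimes> c2 \<otimes> g"
    and eq: "c1 \<otimes> inv d1 = \<beta> \<otimes> (c \<otimes> inv d) \<otimes> \<gamma>"
    unfolding E by (auto simp: mem_double_coset mem_conj_subgroup)
  have mem: "b \<in> carrier G" "c \<in> carrier G" "c' \<in> carrier G" "d \<in> carrier G"
    "b1 \<in> carrier G" "c1 \<in> carrier G" "c1' \<in> carrier G" "d1 \<in> carrier G"
    "b2 \<in> carrier G" "c2 \<in> carrier G" "\<gamma> \<in> carrier G"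
    using bc bc1 bg carr by auto
  have c1: "c1 = \<beta> \<otimes> (c \<otimes> inv d) \<otimes> \<gamma> \<otimes> d1"
    using eq mem by (metis inv_closed m_assoc m_closed l_inv r_one)
  let ?u = "b1 \<otimes> b2 \<otimes> inv b" and ?e = "inv d \<otimes> \<gamma> \<otimes> d1"
  have y1: "y = ?u \<otimes> x \<otimes> ?e"
    unfolding bc1(5) c1 bc(5) bg(5) using mem cr by (simp add: m_assoc inv_cancel)
  have xc: "x \<in> carrier G" unfolding bc(5) using mem cr by simp
  have "?u = y \<otimes> inv ?e \<otimes> inv x"
    unfolding y1 using mem xc by (simp add: m_assoc inv_mult_group inv_cancel)
  also have "\<dots> = h \<otimes> (c1' \<otimes> inv c2 \<otimes> inv c') \<otimes> inv h"
    unfolding bc1(6) bc(6) bg(6) using mem cr by (simp add: m_assoc inv_mult_group inv_cancel)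
  finally have "inv h \<otimes> ?u \<otimes> h = c1' \<otimes> inv c2 \<otimes> inv c'"
    using mem cr by (simp add: m_assoc inv_cancel)
  also have "\<dots> \<in> C" using bc1 bg bc closed by auto
  finally have 1: "inv h \<otimes> ?u \<otimes> h \<in> C" .
  show ?thesis
    using y1 1 bc bg bc1 closed by (intro bexI[of _ ?u] conjI bexI[of _ ?e]) auto
qed

lemma fcip_label_exists:
  assumes A: "subgroup A G" and B: "subgroup B G" and C: "subgroup C G"
    and F: "\<F> \<subseteq> carrier G" and H: "\<G> \<subseteq> carrier G" and h: "h \<in> carrier G"
    and x: "x \<in> (\<Union>f\<in>\<F>. double_coset G B f A) \<inter> (h <# (\<Union>g\<in>\<G>. double_coset G C g A))"
  shows "\<exists>p \<in> fcip_fibre A B C \<F> \<G> (double_coset G B h C). fcip_label A B C h p x"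
proof -
  note carr = subgroup.mem_carrier[OF A] subgroup.mem_carrier[OF B] subgroup.mem_carrier[OF C]
  obtain f b c g c' d where bc: "f \<in> \<F>" "b \<in> B" "c \<in> A" "c' \<in> C" "d \<in> A" "x = b \<otimes> f \<otimes> c" "x = h \<otimes> (c' \<otimes> g \<otimes> d)" "g \<in> \<G>"
    using x by (auto simp: mem_double_coset l_coset_def)
  have mem: "b \<in> carrier G" "c \<in> carrier G" "c' \<in> carrier G" "d \<in> carrier G" "f \<in> carrier G" "g \<in> carrier G"
    using bc carr F H by auto
  let ?a = "c \<otimes> inv d"
  let ?E = "double_coset G (A \<inter> conj_subgroup G B f) ?a (A \<inter> conj_subgroup G C g)"
  have a: "?a \<in> A" using bc by (simp add: subgroup.m_closed[OF A] subgroup.m_inv_closed[OF A])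
  have "c = inv f \<otimes> inv b \<otimes> (h \<otimes> (c' \<otimes> g \<otimes> d))"
    unfolding bc(7)[symmetric] bc(6) using mem h by (simp add: m_assoc inv_cancel)
  then have "f \<otimes> ?a \<otimes> inv g = inv b \<otimes> h \<otimes> c'" using mem h by (simp add: m_assoc inv_cancel)
  then have "double_coset G B (f \<otimes> ?a \<otimes> inv g) C = double_coset G B h C"
    using double_coset_absorb[OF B C h] bc subgroup.m_inv_closed[OF B] by auto
  then have "fcip_map G B C f g ?E = double_coset G B h C"
    using fcip_map_eq[OF A B C _ _ a] mem by simp
  then have "(f, g, ?E) \<in> fcip_fibre A B C \<F> \<G> (double_coset G B h C)"
    using bc a by (auto simp: fcip_fibre_def fcip_dom_def double_cosets_def)
  moreover have "fcip_label A B C h (f, g, ?E) x"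
    unfolding fcip_label_def prod.case using bc by blast
  ultimately show ?thesis by blast
qed

lemma inj_representatives:
  assumes "finite \<F>"
  obtains \<F>' where "\<F>' \<subseteq> \<F>" "finite \<F>'" "inj_on f \<F>'" "f ` \<F>' = f ` \<F>"
proof -
  have "f ` \<F> \<subseteq> f ` \<F>" by simp
  then obtain \<F>' where *: "\<F>' \<subseteq> \<F>" "inj_on f \<F>'" "f ` \<F> = f ` \<F>'"
    unfolding subset_image_inj by blast
  show thesis by (rule that[OF *(1) finite_subset[OF *(1) assms] *(2) *(3)[symmetric]])
qed

text \<open>
  With \<open>h = \<one>\<close>: finiteness of the single fibre over \<open>B C\<close> says that the cosets \<open>x A\<close> in \<open>U \<inter> V\<close> fall into
  finitely many orbits under \<open>B \<inter> C\<close>.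
\<close>

lemma fcip_finite_orbits:
  assumes fcip: "fcip_rel G A" and B: "fg_subgroup B G" and C: "fg_subgroup C G"
    and F: "finite \<F>" "\<F> \<subseteq> carrier G" and H: "finite \<G>" "\<G> \<subseteq> carrier G"
    and U: "U \<subseteq> (\<Union>f\<in>\<F>. double_coset G B f A)" and V: "V \<subseteq> (\<Union>g\<in>\<G>. double_coset G C g A)"
  shows "\<exists>N. finite N \<and> N \<subseteq> U \<inter> V \<and> (\<forall>x\<in>U \<inter> V. \<exists>n\<in>N. \<exists>u\<in>B \<inter> C. \<exists>e\<in>A. x = u \<otimes> n \<otimes> e)"
proof -
  note sub = fg_subgroup_subgroup[OF B] fg_subgroup_subgroup[OF C]
  have A: "subgroup A G" using fcip by (simp add: fcip_rel_def fg_subgroup_def)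
  \<comment> \<open>The f.c.i.p. asks for one representative per double coset, so repetitions are discarded.\<close>
  obtain \<F>' where F': "\<F>' \<subseteq> \<F>" "finite \<F>'" "inj_on (\<lambda>f. double_coset G B f A) \<F>'"
    "(\<lambda>f. double_coset G B f A) ` \<F>' = (\<lambda>f. double_coset G B f A) ` \<F>"
    using inj_representatives[OF F(1)] .
  obtain \<G>' where H': "\<G>' \<subseteq> \<G>" "finite \<G>'" "inj_on (\<lambda>f. double_coset G C f A) \<G>'"
    "(\<lambda>f. double_coset G C f A) ` \<G>' = (\<lambda>f. double_coset G C f A) ` \<G>"
    using inj_representatives[OF H(1)] .
  have cr: "\<F>' \<subseteq> carrier G" "\<G>' \<subseteq> carrier G" using F' H' F H by auto
  have eqs: "(\<Union>f\<in>\<F>'. double_coset G B f A) = (\<Union>f\<in>\<F>. double_coset G B f A)"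
    "(\<Union>g\<in>\<G>'. double_coset G C g A) = (\<Union>g\<in>\<G>. double_coset G C g A)"
    by (simp_all only: F'(4) H'(4))
  have "(\<Union>g\<in>\<G>'. double_coset G C g A) \<subseteq> carrier G"
    using cr subgroup.subset[OF A] subgroup.subset[OF sub(2)]
    by (auto simp: mem_double_coset subset_eq)
  then have one: "\<one> <# (\<Union>g\<in>\<G>'. double_coset G C g A) = (\<Union>g\<in>\<G>'. double_coset G C g A)"
    by (rule lcos_mult_one)
  have UV: "U \<inter> V \<subseteq> (\<Union>f\<in>\<F>'. double_coset G B f A) \<inter> (\<one> <# (\<Union>g\<in>\<G>'. double_coset G C g A))"
    unfolding one unfolding eqs using U V by (rule Int_mono)
  let ?L = "fcip_fibre A B C \<F>' \<G>' (double_coset G B \<one> C)"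
  have finL: "finite ?L"
    by (rule fcip_fibres(1)[OF fcip B C F'(2) cr(1) F'(3) H'(2) cr(2) H'(3)]) (simp add: double_cosets_def)
  have ex: "\<exists>l\<in>?L. fcip_label A B C \<one> l x" if "x \<in> U \<inter> V" for x
    by (rule fcip_label_exists[OF A sub cr one_closed subsetD[OF UV that]])
  obtain N where N: "finite N" "N \<subseteq> U \<inter> V"
    "\<forall>x\<in>U \<inter> V. \<exists>n\<in>N. \<exists>l\<in>?L. fcip_label A B C \<one> l n \<and> fcip_label A B C \<one> l x"
    using finite_representatives[of ?L "U \<inter> V" "fcip_label A B C \<one>", OF finL ex] .
  have orb: "\<exists>n\<in>N. \<exists>u\<in>B \<inter> C. \<exists>e\<in>A. x = u \<otimes> n \<otimes> e" if x: "x \<in> U \<inter> V" for x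
  proof -
    obtain n f g E where n: "n \<in> N" "(f, g, E) \<in> ?L" "fcip_label A B C \<one> (f, g, E) n" "fcip_label A B C \<one> (f, g, E) x"
      using bspec[OF N(3) x] by auto
    then have "f \<in> carrier G" "g \<in> carrier G" using cr by (auto simp: fcip_fibre_def)
    from same_label_same_orbit[OF A sub this one_closed n(3,4)]
    obtain u e where "u \<in> B" "inv \<one> \<otimes> u \<otimes> \<one> \<in> C" "e \<in> A" "x = u \<otimes> n \<otimes> e" by blast
    with n(1) show ?thesis using subgroup.mem_carrier[OF sub(1)]
      by (intro bexI[of _ n] bexI[of _ u] bexI[of _ e]) simp_all
  qed
  show ?thesis using N(1,2) orb by (intro exI[of _ N]) simp
qed

lemma double_coset_shift:
  assumes B: "subgroup B G" and C: "subgroup C G" and cr: "f \<in> carrier G" "g \<in> carrier G" "a \<in> carrier G"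
  shows "double_coset G B (f \<otimes> a \<otimes> inv g) C =
    (\<lambda>z. f \<otimes> z \<otimes> inv g) ` double_coset G (conj_subgroup G B f) a (conj_subgroup G C g)"
proof -
  note carr = subgroup.mem_carrier[OF B] subgroup.mem_carrier[OF C]
  have *: "f \<otimes> (inv f \<otimes> b \<otimes> f \<otimes> a \<otimes> (inv g \<otimes> c \<otimes> g)) \<otimes> inv g = b \<otimes> (f \<otimes> a \<otimes> inv g) \<otimes> c"
    if "b \<in> B" "c \<in> C" for b c using that cr carr by (simp add: m_assoc inv_cancel)
  show ?thesis
  proof (intro subset_antisym subsetI)
    fix z assume "z \<in> double_coset G B (f \<otimes> a \<otimes> inv g) C"
    then obtain b c where bc: "b \<in> B" "c \<in> C" "z = b \<otimes> (f \<otimes> a \<otimes> inv g) \<otimes> c"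
      unfolding mem_double_coset by blast
    have "(inv f \<otimes> b \<otimes> f) \<otimes> a \<otimes> (inv g \<otimes> c \<otimes> g) \<in> double_coset G (conj_subgroup G B f) a (conj_subgroup G C g)"
      unfolding mem_double_coset conj_subgroup_eq using bc by blast
    then show "z \<in> (\<lambda>z. f \<otimes> z \<otimes> inv g) ` double_coset G (conj_subgroup G B f) a (conj_subgroup G C g)"
      using *[OF bc(1,2)] bc(3) by (intro image_eqI) auto
  next
    fix z assume "z \<in> (\<lambda>z. f \<otimes> z \<otimes> inv g) ` double_coset G (conj_subgroup G B f) a (conj_subgroup G C g)"
    then obtain z' where z': "z' \<in> double_coset G (conj_subgroup G B f) a (conj_subgroup G C g)" "z = f \<otimes> z' \<otimes> inv g"
      by (rule imageE)
    obtain p q where "p \<in> conj_subgroup G B f" "q \<in> conj_subgroup G C g" "z' = p \<otimes> a \<otimes> q"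
      using z'(1) unfolding mem_double_coset by blast
    then obtain b c where bc: "b \<in> B" "c \<in> C" "z' = inv f \<otimes> b \<otimes> f \<otimes> a \<otimes> (inv g \<otimes> c \<otimes> g)"
      unfolding conj_subgroup_eq by auto
    then show "z \<in> double_coset G B (f \<otimes> a \<otimes> inv g) C"
      unfolding z'(2) bc(3) *[OF bc(1,2)] mem_double_coset using bc(1,2) by blast
  qed
qed

text \<open>
  For almost all double cosets \<open>B h C\<close> the total fibre has at most one point, so any two elements
  \<open>x\<close>, \<open>y\<close> of \<open>U \<inter> h V\<close> are related by \<open>y = u x e\<close> with \<open>u \<in> B \<inter> h C h\<^sup>-\<^sup>1\<close> and \<open>e \<in> A\<close>. The pair condition says
  that for almost all \<open>B h C\<close> such a \<open>u\<close> lies in \<open>x A x\<^sup>-\<^sup>1\<close>. Together, \<open>U \<inter> h V\<close> is contained in a single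
  coset \<open>x A\<close>.
\<close>

lemma fcip_pair_almost_all_unique:
  assumes fcip: "fcip_rel G A" and pair: "fgip_pair G A"
    and B: "fg_subgroup B G" and C: "fg_subgroup C G"
    and F: "finite \<F>" "\<F> \<subseteq> carrier G" and H: "finite \<G>" "\<G> \<subseteq> carrier G"
    and U: "U \<subseteq> (\<Union>f\<in>\<F>. double_coset G B f A)" and V: "V \<subseteq> (\<Union>g\<in>\<G>. double_coset G C g A)"
  shows "finite {double_coset G B h C | h. h \<in> carrier G \<and> (\<exists>x y. x \<in> U \<inter> (h <# V) \<and> y \<in> U \<inter> (h <# V) \<and> inv x \<otimes> y \<notin> A)}"
proof -
  note sub = fg_subgroup_subgroup[OF B] fg_subgroup_subgroup[OF C]
  have A: "subgroup A G" using fcip by (simp add: fcip_rel_def fg_subgroup_def)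
  note carr = subgroup.mem_carrier[OF A] subgroup.mem_carrier[OF sub(1)] subgroup.mem_carrier[OF sub(2)]
  obtain \<F>' where F': "\<F>' \<subseteq> \<F>" "finite \<F>'" "inj_on (\<lambda>f. double_coset G B f A) \<F>'"
    "(\<lambda>f. double_coset G B f A) ` \<F>' = (\<lambda>f. double_coset G B f A) ` \<F>"
    using inj_representatives[OF F(1)] .
  obtain \<G>' where H': "\<G>' \<subseteq> \<G>" "finite \<G>'" "inj_on (\<lambda>f. double_coset G C f A) \<G>'"
    "(\<lambda>f. double_coset G C f A) ` \<G>' = (\<lambda>f. double_coset G C f A) ` \<G>"
    using inj_representatives[OF H(1)] .
  have cr: "\<F>' \<subseteq> carrier G" "\<G>' \<subseteq> carrier G" using F' H' F H by auto
  let ?P = "fcip_fibre A B C \<F>' \<G>'"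
  let ?S1 = "{D \<in> double_cosets G B (carrier G) C. \<exists>p\<in>?P D. \<exists>q\<in>?P D. p \<noteq> q}"
  let ?S2 = "\<Union>f\<in>\<F>'. \<Union>g\<in>\<G>'. (\<lambda>E. (\<lambda>z. f \<otimes> z \<otimes> inv g) ` E) `
     {double_coset G (conj_subgroup G B f) a (conj_subgroup G C g) | a. a \<in> A \<and>
        \<not> conj_subgroup G (conj_subgroup G B f) a \<inter> conj_subgroup G C g \<subseteq> A}"
  have 1: "finite ?S1"
    by (rule fcip_fibres(2)[OF fcip B C F'(2) cr(1) F'(3) H'(2) cr(2) H'(3)])
  have 2: "finite ?S2"
  proof (intro finite_UN_I finite_imageI)
    fix f g assume "f \<in> \<F>'" "g \<in> \<G>'"
    then have "fg_subgroup (conj_subgroup G B f) G" "fg_subgroup (conj_subgroup G C g) G"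
      using cr by (auto intro!: fg_conj_subgroup B C)
    then show "finite {double_coset G (conj_subgroup G B f) a (conj_subgroup G C g) | a. a \<in> A \<and>
        \<not> conj_subgroup G (conj_subgroup G B f) a \<inter> conj_subgroup G C g \<subseteq> A}"
      using pair unfolding fgip_pair_def by blast
  qed (use F' H' in auto)
  have "double_coset G B h C \<in> ?S1 \<union> ?S2"
    if h: "h \<in> carrier G" and x: "x \<in> U \<inter> (h <# V)" and y: "y \<in> U \<inter> (h <# V)" and xy: "inv x \<otimes> y \<notin> A" for h x y
  proof (cases "double_coset G B h C \<in> ?S1")
    case False
    then have uniq: "p = q" if "p \<in> ?P (double_coset G B h C)" "q \<in> ?P (double_coset G B h C)" for p q
      using that h by (auto simp: double_cosets_def)
    have eqs: "(\<Union>f\<in>\<F>'. double_coset G B f A) = (\<Union>f\<in>\<F>. double_coset G B f A)"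
      "(\<Union>g\<in>\<G>'. double_coset G C g A) = (\<Union>g\<in>\<G>. double_coset G C g A)"
      by (simp_all only: F'(4) H'(4))
    have UV: "U \<inter> (h <# V) \<subseteq> (\<Union>f\<in>\<F>'. double_coset G B f A) \<inter> (h <# (\<Union>g\<in>\<G>'. double_coset G C g A))"
      unfolding eqs l_coset_def by (intro Int_mono U UN_mono[OF V] subset_refl)
    obtain p where p: "p \<in> ?P (double_coset G B h C)" "fcip_label A B C h p x"
      using fcip_label_exists[OF A sub cr h subsetD[OF UV x]] by blast
    obtain q where q: "q \<in> ?P (double_coset G B h C)" "fcip_label A B C h q y"
      using fcip_label_exists[OF A sub cr h subsetD[OF UV y]] by blast
    obtain f g E where fgE: "p = (f, g, E)" by (cases p)
    have fg: "f \<in> \<F>'" "g \<in> \<G>'" using p fgE by (auto simp: fcip_fibre_def)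
    then have fgc: "f \<in> carrier G" "g \<in> carrier G" using cr by auto
    have ql: "fcip_label A B C h (f, g, E) y" using uniq[OF p(1) q(1)] q fgE by simp
    obtain u e where u: "u \<in> B" "inv h \<otimes> u \<otimes> h \<in> C" "e \<in> A" "y = u \<otimes> x \<otimes> e"
      using same_label_same_orbit[OF A sub fgc h p(2)[unfolded fgE] ql] by blast
    obtain b c c' d where bc: "b \<in> B" "c \<in> A" "c' \<in> C" "d \<in> A" "x = b \<otimes> f \<otimes> c" "x = h \<otimes> (c' \<otimes> g \<otimes> d)"
      using p(2) by (auto simp: fcip_label_def fgE)
    have mem: "b \<in> carrier G" "c \<in> carrier G" "c' \<in> carrier G" "d \<in> carrier G" "u \<in> carrier G" "e \<in> carrier G"
      using bc u carr by auto
    have xc: "x \<in> carrier G" unfolding bc(5) using mem fgc by simp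
    define a where "a = c \<otimes> inv d"
    have a: "a \<in> A" unfolding a_def using bc by (simp add: subgroup.m_closed[OF A] subgroup.m_inv_closed[OF A])
    \<comment> \<open>Transported by \<open>x\<close>, the element \<open>u\<close> becomes a witness against the pair condition for the conjugates of \<open>B\<close> and \<open>C\<close>.\<close>
    define w where "w = inv a \<otimes> (inv f \<otimes> (inv b \<otimes> u \<otimes> b) \<otimes> f) \<otimes> a"
    have w1: "w = d \<otimes> (inv x \<otimes> u \<otimes> x) \<otimes> inv d"
      unfolding w_def a_def bc(5) using mem fgc by (simp add: m_assoc inv_cancel inv_mult_group)
    have w2: "w = inv g \<otimes> (inv c' \<otimes> (inv h \<otimes> u \<otimes> h) \<otimes> c') \<otimes> g"
      unfolding w1 bc(6) using mem fgc h by (simp add: m_assoc inv_cancel inv_mult_group)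
    have "w \<notin> A"
    proof
      assume "w \<in> A"
      then have "inv d \<otimes> w \<otimes> d \<otimes> e \<in> A"
        using bc u by (simp add: subgroup.m_closed[OF A] subgroup.m_inv_closed[OF A])
      also have "inv d \<otimes> w \<otimes> d \<otimes> e = inv x \<otimes> y"
        unfolding w1 u(4) using mem xc by (simp add: m_assoc inv_cancel)
      finally show False using xy by simp
    qed
    moreover have "w \<in> conj_subgroup G (conj_subgroup G B f) a"
      unfolding w_def conj_subgroup_eq using bc u
      by (intro imageI) (simp add: subgroup.m_closed[OF sub(1)] subgroup.m_inv_closed[OF sub(1)])
    moreover have "w \<in> conj_subgroup G C g"
      unfolding w2 conj_subgroup_eq using bc u
      by (intro imageI) (simp add: subgroup.m_closed[OF sub(2)] subgroup.m_inv_closed[OF sub(2)])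
    moreover have "double_coset G B h C = (\<lambda>z. f \<otimes> z \<otimes> inv g) ` double_coset G (conj_subgroup G B f) a (conj_subgroup G C g)"
    proof -
      have "c = inv f \<otimes> inv b \<otimes> (h \<otimes> (c' \<otimes> g \<otimes> d))"
        unfolding bc(6)[symmetric] bc(5) using mem fgc by (simp add: m_assoc inv_cancel)
      then have "f \<otimes> a \<otimes> inv g = inv b \<otimes> h \<otimes> c'"
        unfolding a_def using mem h fgc by (simp add: m_assoc inv_cancel)
      then have "double_coset G B (f \<otimes> a \<otimes> inv g) C = double_coset G B h C"
        using double_coset_absorb[OF sub h] bc subgroup.m_inv_closed[OF sub(1)] by auto
      then show ?thesis using double_coset_shift[OF sub fgc] carr(1)[OF a] by simp
    qed
    ultimately have "double_coset G B h C \<in> (\<lambda>E. (\<lambda>z. f \<otimes> z \<otimes> inv g) ` E) `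
       {double_coset G (conj_subgroup G B f) a (conj_subgroup G C g) | a. a \<in> A \<and>
        \<not> conj_subgroup G (conj_subgroup G B f) a \<inter> conj_subgroup G C g \<subseteq> A}"
      using a by blast
    then show ?thesis by (intro UnI2 UN_I[OF fg(1)] UN_I[OF fg(2)])
  qed simp
  note key = this
  show ?thesis
  proof (rule finite_subset[OF subsetI finite_UnI[OF 1 2]])
    fix D
    assume "D \<in> {double_coset G B h C | h. h \<in> carrier G \<and>
      (\<exists>x y. x \<in> U \<inter> (h <# V) \<and> y \<in> U \<inter> (h <# V) \<and> inv x \<otimes> y \<notin> A)}"
    then obtain h x y where "D = double_coset G B h C" "h \<in> carrier G"
      "x \<in> U \<inter> (h <# V)" "y \<in> U \<inter> (h <# V)" "inv x \<otimes> y \<notin> A"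
      unfolding mem_Collect_eq by (elim exE conjE)
    with key show "D \<in> ?S1 \<union> ?S2" by (simp only:)
  qed
qed

end

section \<open>Groups acting on graphs\<close>

locale group_acting = group G for G (structure) +
  fixes X :: "'x set" and act :: "'a \<Rightarrow> 'x \<Rightarrow> 'x"
  assumes act_closed: "g \<in> carrier G \<Longrightarrow> x \<in> X \<Longrightarrow> act g x \<in> X"
    and act_one: "x \<in> X \<Longrightarrow> act \<one> x = x"
    and act_mult: "g \<in> carrier G \<Longrightarrow> h \<in> carrier G \<Longrightarrow> x \<in> X \<Longrightarrow> act (g \<otimes> h) x = act g (act h x)"
begin

definition stab :: "'a set \<Rightarrow> 'x \<Rightarrow> 'a set" where
  "stab H x = {h \<in> H. act h x = x}"

definition invariant :: "'a set \<Rightarrow> ('x \<times> 'x) set \<Rightarrow> bool" where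
  "invariant H E \<longleftrightarrow> (\<forall>h\<in>H. \<forall>x y. (x, y) \<in> E \<longrightarrow> (act h x, act h y) \<in> E)"

lemma invariantD: "invariant H E \<Longrightarrow> h \<in> H \<Longrightarrow> (x, y) \<in> E \<Longrightarrow> (act h x, act h y) \<in> E"
  by (auto simp: invariant_def)

lemma act_inv_cancel:
  assumes "g \<in> carrier G" "x \<in> X"
  shows "act (inv g) (act g x) = x" "act g (act (inv g) x) = x"
  using assms act_mult[of "inv g" g x] act_mult[of g "inv g" x] act_one by auto

lemma act_eqD:
  assumes "g \<in> carrier G" "x \<in> X" "y \<in> X" "act g x = act g y" shows "x = y"
  using assms act_inv_cancel by metis

lemma act_rtrancl:
  assumes "invariant H E" "h \<in> H" "(x, y) \<in> E\<^sup>*"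
  shows "(act h x, act h y) \<in> E\<^sup>*"
  using assms(3) by (induction) (auto intro: rtrancl_into_rtrancl invariantD[OF assms(1,2)])

lemma rtrancl_in_X: "(x, y) \<in> E\<^sup>* \<Longrightarrow> E \<subseteq> X \<times> X \<Longrightarrow> x \<in> X \<Longrightarrow> y \<in> X"
  by (induction rule: rtrancl_induct) auto

lemma subgroup_stab:
  assumes "subgroup H G" "x \<in> X" shows "subgroup (stab H x) G"
proof -
  note mem = subgroup.mem_carrier[OF assms(1)]
  show ?thesis
  proof (rule subgroup.intro)
    show "stab H x \<subseteq> carrier G" using mem by (auto simp: stab_def)
    show "\<one> \<in> stab H x" using assms act_one subgroup.one_closed by (auto simp: stab_def)
    show "a \<otimes> b \<in> stab H x" if "a \<in> stab H x" "b \<in> stab H x" for a b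
      using that mem assms act_mult subgroup.m_closed[OF assms(1)] by (auto simp: stab_def)
    show "inv a \<in> stab H x" if "a \<in> stab H x" for a
      using that mem assms act_inv_cancel(1)[of a x] subgroup.m_inv_closed[OF assms(1)] by (auto simp: stab_def)
  qed
qed

text \<open>
  A graph is a relation on \<open>X\<close>. The condition below says that the edges at \<open>x\<close> fall into finitely many
  orbits under the stabiliser of \<open>x\<close>.
\<close>

definition finite_nbrs :: "'a set \<Rightarrow> ('x \<times> 'x) set \<Rightarrow> 'x \<Rightarrow> bool" where
  "finite_nbrs H E x \<longleftrightarrow>
     (\<exists>N. finite N \<and> N \<subseteq> E `` {x} \<and> (\<forall>y. (x, y) \<in> E \<longrightarrow> (\<exists>s\<in>stab H x. \<exists>n\<in>N. y = act s n)))"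

lemma finite_nbrsI:
  assumes H: "subgroup H G" and inv: "invariant H E" and x: "x \<in> X" and N: "finite N" "N \<subseteq> X"
    and cover: "\<And>y. (x, y) \<in> E \<Longrightarrow> \<exists>s\<in>stab H x. \<exists>n\<in>N. y = act s n"
  shows "finite_nbrs H E x"
  unfolding finite_nbrs_def
proof (intro exI[of _ "N \<inter> E `` {x}"] conjI allI impI)
  fix y assume y: "(x, y) \<in> E"
  then obtain s n where s: "s \<in> stab H x" "n \<in> N" "y = act s n" using cover by blast
  have s': "inv s \<in> stab H x" using subgroup.m_inv_closed[OF subgroup_stab[OF H x]] s by auto
  have "(act (inv s) x, act (inv s) y) \<in> E"
    using s' by (intro invariantD[OF inv _ y]) (simp add: stab_def)
  moreover have "act (inv s) x = x" using s' by (auto simp: stab_def)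
  moreover have "act (inv s) y = n"
    using s N subgroup.mem_carrier[OF H] act_inv_cancel by (auto simp: stab_def)
  ultimately have "n \<in> N \<inter> E `` {x}" using s by simp
  with s show "\<exists>s\<in>stab H x. \<exists>n\<in>N \<inter> E `` {x}. y = act s n" by blast
qed (use N in auto)

text \<open>
  The standard generating set of a group acting cofinitely on a connected graph: generators of the
  stabilisers of the representatives, and elements that carry representatives to the ends of the
  representative edges. The subgroup \<open>D\<close> that they generate reaches every vertex, by induction along
  a walk. As two representatives may lie in one orbit, elements \<open>\<tau> r\<close> carrying \<open>v\<close> to \<open>r\<close> are added to
  compare the two ways of reaching a translate of \<open>v\<close>.
\<close>

lemma fg_of_cofinite_connected_graph:
  assumes H: "subgroup H G" and E: "E \<subseteq> X \<times> X" and inv: "invariant H E"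
    and R: "finite R" "R \<subseteq> X" "v \<in> R" "\<And>r. r \<in> R \<Longrightarrow> (v, r) \<in> E\<^sup>*"
    and stabs: "\<And>r. r \<in> R \<Longrightarrow> fg_subgroup (stab H r) G"
    and verts: "\<And>x. (v, x) \<in> E\<^sup>* \<Longrightarrow> \<exists>h\<in>H. \<exists>r\<in>R. x = act h r"
    and nbrs: "\<And>r. r \<in> R \<Longrightarrow> finite_nbrs H E r"
    and conn: "\<And>h. h \<in> H \<Longrightarrow> (v, act h v) \<in> E\<^sup>*"
  shows "fg_subgroup H G"
proof -
  note mem = subgroup.mem_carrier[OF H]
  have "\<forall>r\<in>R. \<exists>N. finite N \<and> N \<subseteq> E `` {r} \<and> (\<forall>y. (r, y) \<in> E \<longrightarrow> (\<exists>s\<in>stab H r. \<exists>n\<in>N. y = act s n))"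
    using nbrs unfolding finite_nbrs_def by (rule ballI)
  then obtain N where N: "\<forall>r\<in>R. finite (N r) \<and> N r \<subseteq> E `` {r} \<and> (\<forall>y. (r, y) \<in> E \<longrightarrow> (\<exists>s\<in>stab H r. \<exists>n\<in>N r. y = act s n))"
    by (rule bchoice[THEN exE])
  have "\<forall>r\<in>R. \<exists>S. finite S \<and> stab H r = generate G S" using stabs unfolding fg_subgroup_def by blast
  then obtain S where S: "\<forall>r\<in>R. finite (S r) \<and> stab H r = generate G (S r)"
    by (rule bchoice[THEN exE])
  let ?P = "SIGMA r:R. N r"
  have "\<forall>p\<in>?P. \<exists>h. h \<in> H \<and> (\<exists>r'\<in>R. snd p = act h r')"
  proof
    fix p assume "p \<in> ?P"
    then have "fst p \<in> R" "(fst p, snd p) \<in> E" using N by auto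
    then have "(v, snd p) \<in> E\<^sup>*" using R(4) by (blast intro: rtrancl_into_rtrancl)
    then show "\<exists>h. h \<in> H \<and> (\<exists>r'\<in>R. snd p = act h r')" using verts by blast
  qed
  then obtain \<gamma> where \<gamma>: "\<forall>p\<in>?P. \<gamma> p \<in> H \<and> (\<exists>r'\<in>R. snd p = act (\<gamma> p) r')"
    by (rule bchoice[THEN exE])
  let ?R = "{r \<in> R. \<exists>h\<in>H. r = act h v}"
  have "\<forall>r\<in>?R. \<exists>h. h \<in> H \<and> r = act h v" by blast
  then obtain \<tau> where \<tau>: "\<forall>r\<in>?R. \<tau> r \<in> H \<and> r = act (\<tau> r) v"
    by (rule bchoice[THEN exE])
  define Z where "Z = (\<Union>r\<in>R. S r) \<union> \<gamma> ` ?P \<union> \<tau> ` ?R"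
  have finZ: "finite Z" unfolding Z_def using R(1) N S by auto
  have ZH: "Z \<subseteq> H"
  proof -
    have "S r \<subseteq> H" if "r \<in> R" for r
    proof -
      have "S r \<subseteq> stab H r" using S that by (auto intro: generate.incl)
      then show ?thesis by (auto simp: stab_def)
    qed
    then show ?thesis unfolding Z_def using \<gamma> \<tau> by blast
  qed
  define D where "D = generate G Z"
  have D: "subgroup D G" unfolding D_def using ZH subgroup.subset[OF H] by (intro generate_is_subgroup) auto
  have DH: "D \<subseteq> H" unfolding D_def using ZH H by (rule generate_subgroup_incl)
  have Dc: "d \<in> carrier G" if "d \<in> D" for d using that DH mem by blast
  have stabD: "stab H r \<subseteq> D" if "r \<in> R" for r
  proof -
    have "S r \<subseteq> Z" using that by (auto simp: Z_def)
    then show ?thesis using S that unfolding D_def by (simp add: mono_generate)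
  qed
  have \<gamma>D: "\<gamma> p \<in> D" if "p \<in> ?P" for p
    unfolding D_def by (rule generate.incl) (use that in \<open>auto simp: Z_def\<close>)
  have \<tau>D: "\<tau> r \<in> D" if "r \<in> ?R" for r
    unfolding D_def by (rule generate.incl) (use that in \<open>auto simp: Z_def\<close>)
  have cover: "\<exists>d\<in>D. \<exists>r\<in>R. x = act d r" if "(v, x) \<in> E\<^sup>*" for x
    using that
  proof (induction rule: rtrancl_induct)
    case base
    have "v = act \<one> v" using act_one R by auto
    then show ?case using subgroup.one_closed[OF D] R(3) by blast
  next
    case (step x y)
    then obtain d r where d: "d \<in> D" "r \<in> R" "x = act d r" by blast
    have dH: "d \<in> H" "d \<in> carrier G" using d DH mem by auto
    have rX: "r \<in> X" and yX: "y \<in> X" using d R step(2) E by auto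
    have "inv d \<in> H" using dH subgroup.m_inv_closed[OF H] by simp
    from invariantD[OF inv this step(2)]
    have ry: "(r, act (inv d) y) \<in> E" using d dH rX act_inv_cancel by simp
    then obtain s n where s: "s \<in> stab H r" "n \<in> N r" "act (inv d) y = act s n" using N d(2) by blast
    have p: "(r, n) \<in> ?P" using s d by simp
    then obtain r' where r': "r' \<in> R" "n = act (\<gamma> (r, n)) r'" using \<gamma> by fastforce
    have gD: "\<gamma> (r, n) \<in> D" using p by (rule \<gamma>D)
    have sD: "s \<in> D" using s stabD d(2) by blast
    have r'X: "r' \<in> X" using r' R by auto
    have "y = act d (act (inv d) y)" using act_inv_cancel dH yX by simp
    also have "\<dots> = act d (act s (act (\<gamma> (r, n)) r'))" using s(3) r'(2) by simp
    also have "\<dots> = act (d \<otimes> s \<otimes> \<gamma> (r, n)) r'"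
      using Dc gD sD d(1) r'X by (simp add: act_mult act_closed)
    finally show ?case
      using subgroup.m_closed[OF D] d(1) sD gD r'(1) by blast
  qed
  have "H \<subseteq> D"
  proof
    fix h assume h: "h \<in> H"
    have vX: "v \<in> X" using R by auto
    obtain d r where d: "d \<in> D" "r \<in> R" "act h v = act d r" using cover[OF conn[OF h]] by blast
    have rX: "r \<in> X" using d R by auto
    have dH: "d \<in> H" using d DH by auto
    have r: "r = act (inv d \<otimes> h) v"
      using d(3) rX vX mem[OF dH] mem[OF h] act_inv_cancel(1)[of d r] by (simp add: act_mult)
    have "inv d \<otimes> h \<in> H" using subgroup.m_closed[OF H] subgroup.m_inv_closed[OF H] dH h by simp
    then have rR: "r \<in> ?R" using r d(2) by blast
    then have t: "\<tau> r \<in> D" "r = act (\<tau> r) v" using \<tau>D \<tau> by auto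
    have tH: "\<tau> r \<in> H" "\<tau> r \<in> carrier G" using t DH mem by auto
    have "act (inv (\<tau> r)) r = v"
      using t(2) act_inv_cancel(1)[OF tH(2) vX] by simp
    then have "act (inv (\<tau> r) \<otimes> (inv d \<otimes> h)) v = v"
      using r tH mem[OF dH] mem[OF h] vX by (simp add: act_mult act_closed)
    then have "inv (\<tau> r) \<otimes> (inv d \<otimes> h) \<in> stab H v"
      using subgroup.m_closed[OF H] subgroup.m_inv_closed[OF H] dH h tH by (simp add: stab_def)
    then have "inv (\<tau> r) \<otimes> (inv d \<otimes> h) \<in> D" using stabD R(3) by blast
    then have "d \<otimes> (\<tau> r \<otimes> (inv (\<tau> r) \<otimes> (inv d \<otimes> h))) \<in> D"
      using subgroup.m_closed[OF D] d t by simp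
    then show "h \<in> D" using mem[OF dH] mem[OF h] tH by (simp add: inv_cancel)
  qed
  then show ?thesis using fg_subgroup_of_generators[OF H finZ ZH] by (simp add: D_def)
qed

end

lemma finite_support_of_walk:
  assumes "(x, y) \<in> T\<^sup>*"
  shows "\<exists>P. finite P \<and> P \<subseteq> T \<and> (x, y) \<in> P\<^sup>*"
  using assms
proof (induction rule: rtrancl_induct)
  case (step y z)
  then obtain P where "finite P" "P \<subseteq> T" "(x, y) \<in> P\<^sup>*" by blast
  moreover from this have "(x, z) \<in> (insert (y, z) P)\<^sup>*"
    by (meson insertI1 rtrancl.rtrancl_into_rtrancl rtrancl_mono subsetD subset_insertI)
  ultimately show ?case using step(2) by (intro exI[of _ "insert (y, z) P"]) auto
qed auto

definition avoiding :: "'x \<Rightarrow> ('x \<times> 'x) set \<Rightarrow> ('x \<times> 'x) set" where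
  "avoiding v T = {(x, y) \<in> T. x \<noteq> v \<and> y \<noteq> v}"

text \<open>
  Cutting a forest at a vertex \<open>v\<close> separates the branches at \<open>v\<close>: two neighbours of \<open>v\<close> that are still
  connected coincide. Acyclicity is thus expressed through connectedness alone.
\<close>

definition forest :: "('x \<times> 'x) set \<Rightarrow> bool" where
  "forest T \<longleftrightarrow> sym T \<and> irrefl T \<and>
     (\<forall>v x y. (v, x) \<in> T \<longrightarrow> (v, y) \<in> T \<longrightarrow> (x, y) \<in> (avoiding v T)\<^sup>* \<longrightarrow> x = y)"

lemma relpow_subset:
  fixes E F :: "('x \<times> 'x) set"
  shows "E \<subseteq> F \<Longrightarrow> E ^^ n \<subseteq> F ^^ n"
  by (induction n) (simp_all add: relcomp_mono)

lemma last_exit: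
  assumes "(x, y) \<in> E ^^ n" "x \<noteq> y"
  shows "\<exists>z m. m < n \<and> (x, z) \<in> E \<and> (z, y) \<in> avoiding x E ^^ m"
  using assms
proof (induction n arbitrary: y)
  case (Suc n)
  then obtain u where u: "(x, u) \<in> E ^^ n" "(u, y) \<in> E" by auto
  show ?case
  proof (cases "u = x")
    case True
    then show ?thesis using u by (intro exI[of _ y] exI[of _ 0]) auto
  next
    case False
    then obtain z m where z: "m < n" "(x, z) \<in> E" "(z, u) \<in> avoiding x E ^^ m" using Suc.IH u by blast
    have "(u, y) \<in> avoiding x E" using u False Suc.prems by (simp add: avoiding_def)
    then have "(z, y) \<in> avoiding x E ^^ Suc m" using z by auto
    then show ?thesis using z by (intro exI[of _ z] exI[of _ "Suc m"]) simp
  qed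
qed simp

text \<open>
  After its last visit of \<open>x\<close> a walk from \<open>x\<close> to \<open>y\<close> stays in one branch at \<open>x\<close>. Hence walks in \<open>E1\<close> and in
  \<open>E2\<close> leave \<open>x\<close> for the last time through the same edge, which therefore lies in both. In
  particular subtrees intersect in a subtree.
\<close>

lemma forest_walks_meet:
  assumes T: "forest T" and E: "E1 \<subseteq> T" "E2 \<subseteq> T"
    and "(x, y) \<in> E1\<^sup>*" "(x, y) \<in> E2\<^sup>*"
  shows "(x, y) \<in> (E1 \<inter> E2)\<^sup>*"
proof -
  obtain n where "(x, y) \<in> E1 ^^ n" using assms(4) rtrancl_imp_relpow by blast
  then show ?thesis using assms(5)
  proof (induction n arbitrary: x rule: less_induct)
    case (less n)
    show ?case
    proof (cases "x = y")
      case False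
      obtain z m where z: "m < n" "(x, z) \<in> E1" "(z, y) \<in> avoiding x E1 ^^ m"
        using last_exit[OF less.prems(1) False] by blast
      obtain k where k: "(x, y) \<in> E2 ^^ k" using less.prems(2) rtrancl_imp_relpow by blast
      obtain z' m' where z': "(x, z') \<in> E2" "(z', y) \<in> avoiding x E2 ^^ m'"
        using last_exit[OF k False] by blast
      have mono: "avoiding x E1 \<subseteq> avoiding x T" "avoiding x E2 \<subseteq> avoiding x T"
        using E by (auto simp: avoiding_def)
      have sub: "avoiding x E1 \<subseteq> E1" "avoiding x E2 \<subseteq> E2" by (auto simp: avoiding_def)
      have "(z, y) \<in> (avoiding x T)\<^sup>*" "(z', y) \<in> (avoiding x T)\<^sup>*"
        using rtrancl_mono[OF mono(1)] rtrancl_mono[OF mono(2)] z(3) z'(2) by (auto dest!: relpow_imp_rtrancl)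
      moreover have "sym ((avoiding x T)\<^sup>*)"
        using T by (intro sym_rtrancl) (auto simp: forest_def avoiding_def sym_def)
      ultimately have "(z, z') \<in> (avoiding x T)\<^sup>*" by (meson rtrancl_trans symE)
      then have eq: "z' = z" using T z z' E unfolding forest_def by blast
      have "(z, y) \<in> E2\<^sup>*" using z'(2) rtrancl_mono[OF sub(2)] eq by (auto dest!: relpow_imp_rtrancl)
      moreover have "(z, y) \<in> E1 ^^ m" using z(3) relpow_subset[OF sub(1)] by blast
      ultimately have "(z, y) \<in> (E1 \<inter> E2)\<^sup>*" using less.IH z(1) by blast
      then show ?thesis using z z' eq by (intro converse_rtrancl_into_rtrancl[of x z]) auto
    qed simp
  qed
qed

section \<open>Vertex stabilisers of finitely generated groups\<close>

context group_acting
begin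

text \<open>
  In terms of graphs of groups: a finitely generated fundamental group of a finite graph of groups
  with finitely generated edge groups has finitely generated vertex groups.
  
  Let \<open>W\<close> represent the edges at \<open>v\<close>. For a subgroup \<open>Q\<close> of the stabiliser of \<open>v\<close> that contains the
  stabilisers of these edges, split the vertices \<open>h v\<close> into copies, one for each coset \<open>h Q\<close>, and attach
  the edge from \<open>h v\<close> to \<open>h w\<close> to the copy \<open>h Q\<close>. The predicate \<open>good Q\<close> holds for the vertices in
  branches at \<open>v\<close> that start with an edge in \<open>Q W\<close>, and \<open>RQ Q\<close> consists of the \<open>h\<close> whose copy \<open>h Q\<close> is \<open>Q\<close>
  itself or lies in such a branch. As the graph is a forest, a walk that starts at the copy \<open>Q\<close> in the
  split graph never leaves this set. Each generator of \<open>H\<close> corresponds to a walk, which lifts to the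
  split graph as soon as \<open>Q\<close> contains finitely many elements depending on the walk. For \<open>Q\<close> generated
  by these elements and the edge stabilisers this gives \<open>H = RQ Q\<close>, and an element of \<open>RQ Q\<close> that fixes \<open>v\<close>
  lies in \<open>Q\<close>.
\<close>

lemma fg_vertex_stabilizer:
  assumes H: "fg_subgroup H G" and T: "forest T" and E: "E \<subseteq> T" "E \<subseteq> X \<times> X" "sym E" "invariant H E"
    and v: "v \<in> X" and conn: "\<And>h. h \<in> H \<Longrightarrow> (v, act h v) \<in> E\<^sup>*"
    and nb: "finite_nbrs H E v"
    and edges: "\<And>y. (v, y) \<in> E \<Longrightarrow> fg_subgroup (stab H v \<inter> stab H y) G"
  shows "fg_subgroup (stab H v) G"
proof -
  have HG: "subgroup H G" using H by (rule fg_subgroup_subgroup)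
  note mem = subgroup.mem_carrier[OF HG]
  note Hm = subgroup.m_closed[OF HG] and Hi = subgroup.m_inv_closed[OF HG]
  let ?V = "stab H v"
  have V: "subgroup ?V G" using HG v by (rule subgroup_stab)
  have VH: "?V \<subseteq> H" by (auto simp: stab_def)
  have Vv: "act s v = v" if "s \<in> ?V" for s using that by (simp add: stab_def)
  have Vc: "s \<in> carrier G" if "s \<in> ?V" for s using that VH mem by blast
  obtain N where N: "finite N" "N \<subseteq> E `` {v}" "\<And>y. (v, y) \<in> E \<Longrightarrow> \<exists>s\<in>?V. \<exists>n\<in>N. y = act s n"
    using nb unfolding finite_nbrs_def by blast
  define orb where "orb = (\<lambda>n. (\<lambda>s. act s n) ` ?V)"
  have orb: "orb x = orb y" if "x \<in> X" "y \<in> X" "s \<in> ?V" "x = act s y" for x y s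
  proof -
    have "act u x \<in> orb y" if "u \<in> ?V" for u
    proof -
      have "act u x = act (u \<otimes> s) y" using \<open>x = act s y\<close> \<open>y \<in> X\<close> Vc[OF that] Vc[OF \<open>s \<in> ?V\<close>] by (simp add: act_mult)
      then show ?thesis using subgroup.m_closed[OF V that \<open>s \<in> ?V\<close>] by (simp add: orb_def)
    qed
    moreover have "act u y \<in> orb x" if "u \<in> ?V" for u
    proof -
      have "act u y = act (u \<otimes> inv s) x" using \<open>x = act s y\<close> \<open>y \<in> X\<close> \<open>x \<in> X\<close> Vc[OF that] Vc[OF \<open>s \<in> ?V\<close>]
        by (simp add: act_mult act_inv_cancel)
      then show ?thesis using subgroup.m_closed[OF V that subgroup.m_inv_closed[OF V \<open>s \<in> ?V\<close>]] by (simp add: orb_def)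
    qed
    ultimately show ?thesis unfolding orb_def by blast
  qed
  obtain W where W: "W \<subseteq> N" "finite W" "inj_on orb W" "orb ` W = orb ` N"
    using inj_representatives[OF N(1), of orb] .
  have WE: "(v, w) \<in> E" if "w \<in> W" for w using that W N by blast
  have WX: "w \<in> X" if "w \<in> W" for w using WE[OF that] E by blast
  have cover: "\<exists>s\<in>?V. \<exists>w\<in>W. y = act s w" if y: "(v, y) \<in> E" for y
  proof -
    obtain s n where s: "s \<in> ?V" "n \<in> N" "y = act s n" using N(3)[OF y] by blast
    have nX: "n \<in> X" using s N E by blast
    have "orb n \<in> orb ` W" using W(4) s(2) by simp
    then obtain w where w: "w \<in> W" "orb n = orb w" by blast
    have "act \<one> n \<in> orb n" using subgroup.one_closed[OF V] by (auto simp: orb_def)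
    then obtain u where u: "u \<in> ?V" "n = act u w" using w act_one[OF nX] by (auto simp: orb_def)
    have "y = act (s \<otimes> u) w" using s u Vc WX[OF w(1)] by (simp add: act_mult)
    then show ?thesis using subgroup.m_closed[OF V s(1) u(1)] w by blast
  qed
  \<comment> \<open>\<open>W\<close> contains one edge per orbit, so an edge determines its representative.\<close>
  have distinct: "w = w'" if "w \<in> W" "w' \<in> W" "s \<in> ?V" "s' \<in> ?V" "act s w = act s' w'" for w w' s s'
  proof -
    have X: "act s w \<in> X" using that Vc WX act_closed by auto
    have "orb (act s w) = orb w" using orb[OF X _ that(3) HOL.refl] WX that by simp
    moreover have "orb (act s w) = orb w'" using orb[OF X _ that(4,5)] WX that by simp
    ultimately show ?thesis using W(3) that by (simp add: inj_on_def)
  qed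
  let ?br = "(avoiding v T)\<^sup>*"
  have irr: "x \<noteq> y" if "(x, y) \<in> E" for x y using that E T by (auto simp: forest_def irrefl_def)
  define good where "good = (\<lambda>Q x. x \<noteq> v \<and> (\<exists>q\<in>Q. \<exists>w\<in>W. (act q w, x) \<in> ?br))"
  define RQ where "RQ = (\<lambda>Q. {h \<in> H. h \<in> Q \<or> good Q (act h v)})"
  define adm where "adm = (\<lambda>Q. subgroup Q G \<and> Q \<subseteq> ?V \<and> (\<forall>w\<in>W. ?V \<inter> stab H w \<subseteq> Q))"
  have g1: "good Q y" if "good Q x" "(x, y) \<in> E" "y \<noteq> v" for Q x y
  proof -
    have "(x, y) \<in> avoiding v T" using that E by (auto simp: avoiding_def good_def)
    then show ?thesis using that unfolding good_def by (blast intro: rtrancl_into_rtrancl)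
  qed
  have QE: "(v, act q w) \<in> E" if "q \<in> ?V" "w \<in> W" for q w
    using invariantD[OF E(4) _ WE[OF that(2)], of q] that VH Vv by auto
  have g2: "good Q (act q w)" if "adm Q" "q \<in> Q" "w \<in> W" for Q q w
  proof -
    have "q \<in> ?V" using that by (auto simp: adm_def)
    then show ?thesis using irr[OF QE[OF _ that(3)]] that unfolding good_def by blast
  qed
  have g3: "\<exists>q\<in>Q. \<exists>w\<in>W. x = act q w" if "adm Q" and gd: "good Q x" and "(v, x) \<in> E" for Q x
  proof -
    obtain q w where q: "q \<in> Q" "w \<in> W" "(act q w, x) \<in> ?br" using gd by (auto simp: good_def)
    have "q \<in> ?V" using that q by (auto simp: adm_def)
    then have "(v, act q w) \<in> T" "(v, x) \<in> T" using QE q(2) that E by blast+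
    then have "act q w = x" using T q(3) unfolding forest_def by blast
    then show ?thesis using q by blast
  qed
  \<comment> \<open>A property that holds once \<open>Q\<close> contains a suitable finite set.\<close>
  define ev where "ev = (\<lambda>P. \<exists>F. finite F \<and> F \<subseteq> ?V \<and>
    (\<forall>Q. adm Q \<longrightarrow> F \<subseteq> Q \<longrightarrow> (\<forall>h\<in>RQ Q. P Q h)))"
  have evI: "ev P" if "finite F" "F \<subseteq> ?V" "\<And>Q h. adm Q \<Longrightarrow> F \<subseteq> Q \<Longrightarrow> h \<in> RQ Q \<Longrightarrow> P Q h" for P F
    unfolding ev_def using that by (intro exI[of _ F]) simp
  have evD: "\<exists>F. finite F \<and> F \<subseteq> ?V \<and> (\<forall>Q. adm Q \<longrightarrow> F \<subseteq> Q \<longrightarrow> (\<forall>h\<in>RQ Q. P Q h))" if "ev P" for P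
    using that unfolding ev_def .
  let ?P1 = "\<lambda>x Q h. good Q (act h x)" and ?P2 = "\<lambda>k Q h. h \<otimes> k \<in> RQ Q"
  have RH: "h \<in> H" if "h \<in> RQ Q" for h Q using that by (simp add: RQ_def)
  \<comment> \<open>Outside the orbit of \<open>v\<close> the walk is tracked by its vertex, inside the orbit by an element \<open>k\<close> that carries \<open>v\<close> to it.\<close>
  have claim: "((\<forall>k\<in>H. act k v \<noteq> x) \<longrightarrow> ev (?P1 x)) \<and> (\<forall>k\<in>H. act k v = x \<longrightarrow> ev (?P2 k))"
    if "(v, x) \<in> E\<^sup>*" for x
    using that
  proof (induction rule: rtrancl_induct)
    case base
    have "act \<one> v = v" "\<one> \<in> H" using act_one v subgroup.one_closed[OF HG] by auto
    moreover have "ev (?P2 k)" if k: "k \<in> H" "act k v = v" for k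
    proof (rule evI)
      show "{k} \<subseteq> ?V" using k by (simp add: stab_def)
      fix Q h assume Q: "adm Q" "{k} \<subseteq> Q" and h: "h \<in> RQ Q"
      then show "h \<otimes> k \<in> RQ Q"
        using k v mem Hm subgroup.m_closed[of Q G h k] by (auto simp: RQ_def act_mult adm_def)
    qed simp
    ultimately show ?case by (intro conjI impI ballI) auto
  next
    case (step x y)
    have xX: "x \<in> X" and yX: "y \<in> X" using step(2) E by auto
    let ?M = "\<lambda>Q h. (act h x = v \<and> (\<exists>q\<in>Q. \<exists>w\<in>W. act h y = act q w)) \<or> good Q (act h x)"
    \<comment> \<open>Just after leaving \<open>x\<close> towards \<open>y\<close>: either \<open>h x = v\<close> and the edge belongs to \<open>Q\<close>, or \<open>h x\<close> is in a good branch.\<close>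
    have mid: "ev ?M"
    proof (cases "\<forall>k\<in>H. act k v \<noteq> x")
      case True
      then have "ev (?P1 x)" using step.IH by simp
      from evD[OF this] obtain F where F: "finite F" "F \<subseteq> ?V"
        "\<forall>Q. adm Q \<longrightarrow> F \<subseteq> Q \<longrightarrow> (\<forall>h\<in>RQ Q. good Q (act h x))" by (elim exE conjE)
      show ?thesis by (rule evI[OF F(1,2)]) (use F(3) in simp)
    next
      case False
      then obtain k0 where k0: "k0 \<in> H" "act k0 v = x" by blast
      have "(act (inv k0) x, act (inv k0) y) \<in> E" using invariantD[OF E(4) Hi[OF k0(1)] step(2)] .
      moreover have "act (inv k0) x = v" using k0 mem v act_inv_cancel by auto
      ultimately obtain m w where m: "m \<in> ?V" "w \<in> W" "act (inv k0) y = act m w" using cover by metis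
      have mH: "m \<in> H" using m VH by blast
      \<comment> \<open>The lift of \<open>x\<close> is adjusted so that the edge from \<open>x\<close> to \<open>y\<close> is \<open>k w\<close>.\<close>
      define k where "k = k0 \<otimes> m"
      have k: "k \<in> H" "act k v = x" using k0 mH Hm mem v Vv[OF m(1)] by (simp_all add: k_def act_mult)
      have y: "y = act k w"
      proof -
        have "y = act k0 (act m w)" using m(3) act_inv_cancel(2)[of k0 y] mem k0 yX by simp
        then show ?thesis using k0 mH mem WX m(2) by (simp add: k_def act_mult)
      qed
      have "ev (?P2 k)" using step.IH k by simp
      from evD[OF this] obtain F where F: "finite F" "F \<subseteq> ?V"
        "\<forall>Q. adm Q \<longrightarrow> F \<subseteq> Q \<longrightarrow> (\<forall>h\<in>RQ Q. h \<otimes> k \<in> RQ Q)" by (elim exE conjE)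
      show ?thesis
      proof (rule evI[OF F(1,2)])
        fix Q h assume Q: "adm Q" "F \<subseteq> Q" and h: "h \<in> RQ Q"
        then have hk: "h \<otimes> k \<in> RQ Q" using F(3) by simp
        have hx: "act h x = act (h \<otimes> k) v" "act h y = act (h \<otimes> k) w"
          using k y mem RH[OF h] v WX m(2) by (auto simp: act_mult)
        show "(act h x = v \<and> (\<exists>q\<in>Q. \<exists>w\<in>W. act h y = act q w)) \<or> good Q (act h x)"
        proof (cases "h \<otimes> k \<in> Q")
          case True
          then have "act (h \<otimes> k) v = v" using Q Vv by (auto simp: adm_def)
          then show ?thesis using hx True m(2) by auto
        next
          case False
          then show ?thesis using hk hx by (simp add: RQ_def)
        qed
      qed
    qed
    from evD[OF this] obtain F where F0: "finite F" "F \<subseteq> ?V"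
      "\<forall>Q. adm Q \<longrightarrow> F \<subseteq> Q \<longrightarrow> (\<forall>h\<in>RQ Q. ?M Q h)" by (elim exE conjE)
    then have F: "finite F" "F \<subseteq> ?V" "\<And>Q h. adm Q \<Longrightarrow> F \<subseteq> Q \<Longrightarrow> h \<in> RQ Q \<Longrightarrow> ?M Q h" by simp_all
    have away: "good Q (act h y)" if Q: "adm Q" "F \<subseteq> Q" "h \<in> RQ Q" "act h y \<noteq> v" for Q h
      using F(3)[OF Q(1-3)]
    proof
      assume "act h x = v \<and> (\<exists>q\<in>Q. \<exists>w\<in>W. act h y = act q w)"
      then show ?thesis using g2[OF Q(1)] by auto
    next
      assume "good Q (act h x)"
      then show ?thesis by (rule g1[OF _ invariantD[OF E(4) RH[OF Q(3)] step(2)] Q(4)])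
    qed
    have 1: "ev (?P1 y)" if "\<forall>k\<in>H. act k v \<noteq> y"
    proof (rule evI[OF F(1,2)])
      fix Q h assume Q: "adm Q" "F \<subseteq> Q" and h: "h \<in> RQ Q"
      have "act h y \<noteq> v"
      proof
        assume "act h y = v"
        then have "act (inv h) v = y" using act_inv_cancel(1) mem RH[OF h] yX by auto
        then show False using that Hi RH[OF h] by blast
      qed
      then show "good Q (act h y)" using away Q h by blast
    qed
    have 2: "ev (?P2 k)" if k: "k \<in> H" "act k v = y" for k
    proof -
      have "(act (inv k) y, act (inv k) x) \<in> E"
        using invariantD[OF E(4) Hi[OF k(1)]] step(2) E(3) by (meson symE)
      moreover have "act (inv k) y = v" using k mem v act_inv_cancel by auto
      ultimately obtain m w where m: "m \<in> ?V" "w \<in> W" "act (inv k) x = act m w" using cover by metis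
      have mH: "m \<in> H" using m VH by blast
      have x: "x = act (k \<otimes> m) w"
      proof -
        have "x = act k (act m w)" using m(3) act_inv_cancel(2)[of k x] mem k xX by simp
        then show ?thesis using k mH mem WX m(2) by (simp add: act_mult)
      qed
      show ?thesis
      \<comment> \<open>The walk enters the copy of \<open>y\<close> through the edge \<open>k m w\<close>, which is attached to it once \<open>m\<close> is in \<open>Q\<close>.\<close>
      proof (rule evI[of "insert m F"])
        fix Q h assume Q: "adm Q" "insert m F \<subseteq> Q" and h: "h \<in> RQ Q"
        have hH: "h \<in> H" using RH h .
        have hk: "h \<otimes> k \<in> H" using Hm hH k by blast
        have hy: "act h y = act (h \<otimes> k) v" using k mem hH v by (auto simp: act_mult)
        show "h \<otimes> k \<in> RQ Q"
        proof (cases "act h y = v")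
          case False
          then have "good Q (act h y)" using away Q h by blast
          then show ?thesis using hk hy by (simp add: RQ_def)
        next
          case True
          have vx: "(v, act h x) \<in> E" using invariantD[OF E(4) hH step(2)] True E(3) by (metis symE)
          have "act h x \<noteq> v" using irr[OF vx] by simp
          then have "good Q (act h x)" using F(3)[of Q h] Q h by blast
          then obtain q w' where q: "q \<in> Q" "w' \<in> W" "act h x = act q w'" using g3 Q vx by blast
          have qV: "q \<in> ?V" using q Q by (auto simp: adm_def)
          define z where "z = h \<otimes> k \<otimes> m"
          have zH: "z \<in> H" unfolding z_def using Hm hk mH by blast
          have zV: "z \<in> ?V"
            using zH hy True hk mH mem v Vv[OF m(1)] by (simp add: stab_def z_def act_mult)
          have hx: "act h x = act z w" using x hH k mH mem WX[OF m(2)] by (simp add: z_def act_mult act_closed m_assoc Hm)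
          then have ww: "w = w'" using distinct[OF m(2) q(2) zV qV] q(3) by simp
          have "act (inv q \<otimes> z) w = w"
            using hx q(3) ww Vc[OF qV] mem[OF zH] WX[OF m(2)] by (simp add: act_mult) (metis act_inv_cancel(1))
          moreover have "inv q \<otimes> z \<in> ?V" using V qV zV by (simp add: subgroup.m_closed subgroup.m_inv_closed)
          ultimately have "inv q \<otimes> z \<in> ?V \<inter> stab H w" using VH by (auto simp: stab_def)
          then have "inv q \<otimes> z \<in> Q" using Q m(2) by (auto simp: adm_def)
          moreover have QG: "subgroup Q G" using Q by (simp add: adm_def)
          ultimately have "q \<otimes> (inv q \<otimes> z) \<otimes> inv m \<in> Q" using q Q
            by (simp add: subgroup.m_closed subgroup.m_inv_closed)
          also have "q \<otimes> (inv q \<otimes> z) \<otimes> inv m = h \<otimes> k"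
            using Vc[OF qV] mem[OF hk] mem[OF mH] by (simp add: z_def inv_cancel m_assoc)
          finally show ?thesis using hk by (simp add: RQ_def)
        qed
      qed (use F m in auto)
    qed
    show ?case using 1 2 by simp
  qed
  obtain S where S: "finite S" "S \<subseteq> carrier G" "H = generate G S" using H by (auto simp: fg_subgroup_def)
  have SH: "S \<subseteq> H" using S by (auto intro: generate.incl)
  let ?S = "S \<union> m_inv G ` S"
  let ?big = "\<lambda>F s. finite F \<and> F \<subseteq> ?V \<and> (\<forall>Q. adm Q \<longrightarrow> F \<subseteq> Q \<longrightarrow> (\<forall>h\<in>RQ Q. h \<otimes> s \<in> RQ Q))"
  have "\<forall>s\<in>?S. \<exists>F. ?big F s"
  proof
    fix s assume "s \<in> ?S"
    then have s: "s \<in> H" using SH Hi by auto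
    have "ev (?P2 s)" using claim[OF conn[OF s]] s by simp
    then show "\<exists>F. ?big F s" by (rule evD)
  qed
  then obtain F where F: "\<forall>s\<in>?S. ?big (F s) s" by (rule bchoice[THEN exE])
  have "\<forall>w\<in>W. \<exists>S. finite S \<and> ?V \<inter> stab H w = generate G S"
    using edges WE unfolding fg_subgroup_def by blast
  then obtain D where D: "\<forall>w\<in>W. finite (D w) \<and> ?V \<inter> stab H w = generate G (D w)" by (rule bchoice[THEN exE])
  define Z where "Z = (\<Union>s\<in>?S. F s) \<union> (\<Union>w\<in>W. D w)"
  have finZ: "finite Z" unfolding Z_def using S(1) W(2) F D by auto
  have ZV: "Z \<subseteq> ?V"
  proof -
    have "D w \<subseteq> ?V" if "w \<in> W" for w
    proof -
      have "D w \<subseteq> generate G (D w)" by (auto intro: generate.incl)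
      then show ?thesis using D that by blast
    qed
    moreover have "F s \<subseteq> ?V" if "s \<in> ?S" for s using F that by blast
    ultimately show ?thesis unfolding Z_def by blast
  qed
  define Q where "Q = generate G Z"
  have QV: "Q \<subseteq> ?V" unfolding Q_def using ZV V by (rule generate_subgroup_incl)
  have QG: "subgroup Q G" unfolding Q_def using ZV Vc by (intro generate_is_subgroup) blast
  have adm: "adm Q"
  proof -
    have "?V \<inter> stab H w \<subseteq> Q" if "w \<in> W" for w
    proof -
      have "D w \<subseteq> Z" using that by (auto simp: Z_def)
      then show ?thesis using D that unfolding Q_def by (simp add: mono_generate)
    qed
    then show ?thesis using QV QG by (simp add: adm_def)
  qed
  have FQ: "F s \<subseteq> Q" if "s \<in> ?S" for s
    using that unfolding Q_def Z_def by (blast intro: generate.incl)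
  have gen: "h \<otimes> s \<in> RQ Q" if "s \<in> ?S" "h \<in> RQ Q" for h s
    using F adm FQ that by blast
  have "\<forall>r\<in>RQ Q. r \<otimes> h \<in> RQ Q" if "h \<in> generate G S" for h
    using that
  proof induction
    case one
    then show ?case using RH mem by auto
  next
    case (incl h) then show ?case using gen by blast
  next
    case (inv h) then show ?case using gen by blast
  next
    case (eng h1 h2)
    then have "h1 \<in> carrier G" "h2 \<in> carrier G" using S generate_in_carrier by auto
    then show ?case using eng.IH RH mem by (metis m_assoc)
  qed
  moreover have "\<one> \<in> RQ Q" using subgroup.one_closed[OF HG] subgroup.one_closed[OF QG] by (simp add: RQ_def)
  ultimately have HR: "h \<in> RQ Q" if "h \<in> H" for h using that S(3) mem by fastforce
  have "?V \<subseteq> Q"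
  proof
    fix h assume h: "h \<in> ?V"
    then show "h \<in> Q" using HR[of h] VH Vv[OF h] by (auto simp: RQ_def good_def)
  qed
  then show ?thesis using fg_subgroup_of_generators[OF V finZ ZV] by (simp add: Q_def)
qed

end

section \<open>Graphs with finitely many orbits of branching vertices\<close>

context group_acting
begin

text \<open>
  The edges have two directions \<open>s\<close>, mutually converse. Outside \<open>Bd\<close> a vertex has at most one edge in each
  direction, so a walk that leaves a vertex of \<open>Bd\<close> in direction \<open>s\<close> has no choice until it meets \<open>Bd\<close>
  again. The relation \<open>M s\<close> joins the two ends of such forced walks. It makes \<open>Bd\<close> a connected graph
  with finitely many orbits of vertices and of edges, even if the given graph has infinitely many: what
  is lost are infinite rays, which carry no further group elements.
\<close>

lemma fg_of_finitely_many_branchings: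
  fixes E :: "bool \<Rightarrow> ('x \<times> 'x) set"
  assumes H: "subgroup H G" and E: "\<And>s. E s \<subseteq> X \<times> X" and conv: "\<And>s. E (\<not> s) = (E s)\<inverse>"
    and inv: "\<And>s. invariant H (E s)" and v: "v \<in> X"
    and conn: "\<And>h. h \<in> H \<Longrightarrow> (v, act h v) \<in> (E True \<union> E False)\<^sup>*"
    and Bd: "Bd \<subseteq> X" "v \<in> Bd" "\<And>h b. h \<in> H \<Longrightarrow> b \<in> Bd \<Longrightarrow> act h b \<in> Bd"
    and reach: "\<And>b. b \<in> Bd \<Longrightarrow> (v, b) \<in> (E True \<union> E False)\<^sup>*"
    and R: "finite R" "R \<subseteq> Bd" "\<And>b. b \<in> Bd \<Longrightarrow> \<exists>h\<in>H. \<exists>r\<in>R. b = act h r"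
    and stabs: "\<And>b. b \<in> Bd \<Longrightarrow> fg_subgroup (stab H b) G"
    and nbrs: "\<And>b s. b \<in> Bd \<Longrightarrow> finite_nbrs H (E s) b"
    and line: "\<And>x y y' s. (v, x) \<in> (E True \<union> E False)\<^sup>* \<Longrightarrow> x \<notin> Bd \<Longrightarrow>
      (x, y) \<in> E s \<Longrightarrow> (x, y') \<in> E s \<Longrightarrow> y = y'"
  shows "fg_subgroup H G"
proof -
  note mem = subgroup.mem_carrier[OF H]
  note Hi = subgroup.m_inv_closed[OF H]
  let ?E = "E True \<union> E False"
  have Es: "E s \<subseteq> ?E" for s by (cases s) auto
  have EX: "?E \<subseteq> X \<times> X" using E by auto
  have invE: "invariant H ?E" using inv by (auto simp: invariant_def)
  have convD: "(y, x) \<in> E (\<not> s) \<longleftrightarrow> (x, y) \<in> E s" for x y s using conv by auto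
  have vreach: "(v, act h x) \<in> ?E\<^sup>*" if "h \<in> H" "(v, x) \<in> ?E\<^sup>*" for h x
    using conn[OF that(1)] act_rtrancl[OF invE that] by (rule rtrancl_trans)
  have BdH: "b \<in> Bd" if "h \<in> H" "act h b \<in> Bd" "b \<in> X" for h b
    using Bd(3)[OF Hi[OF that(1)] that(2)] act_inv_cancel(1)[OF mem[OF that(1)] that(3)] by simp
  \<comment> \<open>One forced step from a vertex outside \<open>Bd\<close>; elements of \<open>Bd\<close> are final.\<close>
  define D where "D = (\<lambda>s. {(x, y) \<in> E s. x \<notin> Bd \<and> (v, x) \<in> ?E\<^sup>*})"
  have DX: "D s \<subseteq> X \<times> X" for s using E by (auto simp: D_def)
  have invD: "invariant H (D s)" for s
    unfolding invariant_def
  proof (intro ballI allI impI)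
    fix h x y assume h: "h \<in> H" and xy: "(x, y) \<in> D s"
    then have "x \<in> X" using DX by auto
    then show "(act h x, act h y) \<in> D s"
      using xy h invariantD[OF inv h] BdH[OF h] vreach[OF h] by (auto simp: D_def)
  qed
  have sv: "single_valued (D s)" for s
    unfolding single_valued_def D_def using line by blast
  define M where "M = (\<lambda>s. {(b, y). b \<in> Bd \<and> y \<in> Bd \<and> (\<exists>x. (b, x) \<in> E s \<and> (x, y) \<in> (D s)\<^sup>*)})"
  have invM: "invariant H (M s)" for s
    unfolding invariant_def
  proof (intro ballI allI impI)
    fix h b y assume h: "h \<in> H" and xy: "(b, y) \<in> M s"
    then obtain x where x: "b \<in> Bd" "y \<in> Bd" "(b, x) \<in> E s" "(x, y) \<in> (D s)\<^sup>*" by (auto simp: M_def)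
    then show "(act h b, act h y) \<in> M s"
      using Bd(3)[OF h] invariantD[OF inv h x(3)] act_rtrancl[OF invD h x(4)] by (auto simp: M_def)
  qed
  let ?M = "M True \<union> M False"
  have Ms: "M s \<subseteq> ?M" for s by (cases s) auto
  have invM': "invariant H ?M" using invM by (auto simp: invariant_def)
  have MX: "?M \<subseteq> X \<times> X" using Bd by (auto simp: M_def)
  have uniq: "y = y'" if "y \<in> Bd" "y' \<in> Bd" "(n, y) \<in> (D s)\<^sup>*" "(n, y') \<in> (D s)\<^sup>*" for n y y' s
  proof -
    have final: "z = u" if "(u, z) \<in> (D s)\<^sup>*" "u \<in> Bd" for u z
      using that by (cases rule: converse_rtranclE) (auto simp: D_def)
    have "(y, y') \<in> (D s)\<^sup>* \<or> (y', y) \<in> (D s)\<^sup>*"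
      using single_valued_confluent[OF sv that(3,4)] .
    then show ?thesis using final that(1,2) by blast
  qed
  have Mnbrs: "finite_nbrs H ?M b" if b: "b \<in> Bd" for b
  proof -
    have bX: "b \<in> X" using b Bd by auto
    have "\<exists>N. finite N \<and> N \<subseteq> X \<and> (\<forall>y. (b, y) \<in> M s \<longrightarrow> (\<exists>g\<in>stab H b. \<exists>n\<in>N. y = act g n))" for s
    proof -
      obtain N where N: "finite N" "N \<subseteq> E s `` {b}" "\<forall>y. (b, y) \<in> E s \<longrightarrow> (\<exists>g\<in>stab H b. \<exists>n\<in>N. y = act g n)"
        using nbrs[OF b, of s] unfolding finite_nbrs_def by (elim exE conjE)
      define Y where "Y = {y \<in> Bd. \<exists>n\<in>N. (n, y) \<in> (D s)\<^sup>*}"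
      have "Y \<subseteq> (\<lambda>n. THE y. y \<in> Bd \<and> (n, y) \<in> (D s)\<^sup>*) ` N"
      proof
        fix y assume "y \<in> Y"
        then obtain n where n: "n \<in> N" "y \<in> Bd" "(n, y) \<in> (D s)\<^sup>*" by (auto simp: Y_def)
        then have "(THE y. y \<in> Bd \<and> (n, y) \<in> (D s)\<^sup>*) = y" by (intro the_equality) (auto intro: uniq)
        then show "y \<in> (\<lambda>n. THE y. y \<in> Bd \<and> (n, y) \<in> (D s)\<^sup>*) ` N" using n(1) by force
      qed
      then have "finite Y" using N(1) by (rule finite_subset[OF _ finite_imageI])
      moreover have "\<exists>g\<in>stab H b. \<exists>n\<in>Y. y = act g n" if y: "(b, y) \<in> M s" for y
      proof -
        obtain x where x: "y \<in> Bd" "(b, x) \<in> E s" "(x, y) \<in> (D s)\<^sup>*" using y by (auto simp: M_def)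
        obtain g n where g: "g \<in> stab H b" "n \<in> N" "x = act g n" using N(3) x(2) by blast
        have gH: "g \<in> H" using g by (simp add: stab_def)
        have nX: "n \<in> X" and yX: "y \<in> X" using g N(2) E x Bd by auto
        have "act (inv g) x = n" using g nX mem[OF gH] act_inv_cancel by simp
        then have "(n, act (inv g) y) \<in> (D s)\<^sup>*" using act_rtrancl[OF invD Hi[OF gH] x(3)] by simp
        then have "act (inv g) y \<in> Y" using g(2) Bd(3)[OF Hi[OF gH] x(1)] by (auto simp: Y_def)
        moreover have "y = act g (act (inv g) y)" using act_inv_cancel mem[OF gH] yX by simp
        ultimately show ?thesis using g(1) by blast
      qed
      moreover have "Y \<subseteq> X" using Bd by (auto simp: Y_def)
      ultimately show ?thesis by (intro exI[of _ Y]) simp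
    qed
    then obtain N where N: "\<And>s. finite (N s) \<and> N s \<subseteq> X \<and>
        (\<forall>y. (b, y) \<in> M s \<longrightarrow> (\<exists>g\<in>stab H b. \<exists>n\<in>N s. y = act g n))" by metis
    show ?thesis
    proof (rule finite_nbrsI[OF H invM' bX])
      show "finite (N True \<union> N False)" "N True \<union> N False \<subseteq> X" using N by auto
      show "\<exists>g\<in>stab H b. \<exists>n\<in>N True \<union> N False. y = act g n" if "(b, y) \<in> ?M" for y
        using N that by blast
    qed
  qed
  \<comment> \<open>A walk that turns around inside a forced walk just moves back along it.\<close>
  have walk: "(u \<in> Bd \<and> (v, u) \<in> ?M\<^sup>*) \<or>
      (u \<notin> Bd \<and> (\<exists>s b x. b \<in> Bd \<and> (v, b) \<in> ?M\<^sup>* \<and> (b, x) \<in> E s \<and> (x, u) \<in> (D s)\<^sup>*))"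
    if "(v, u) \<in> ?E\<^sup>*" for u
    using that
  proof (induction rule: rtrancl_induct)
    case base
    then show ?case using Bd by simp
  next
    case (step u w)
    obtain s' where s': "(u, w) \<in> E s'" using step(2) by blast
    have extend: ?case if b: "b \<in> Bd" "(v, b) \<in> ?M\<^sup>*" "(b, x) \<in> E s" "(x, w) \<in> (D s)\<^sup>*" for b x s
    proof (cases "w \<in> Bd")
      case True
      then have "(b, w) \<in> ?M" using b Ms[of s] by (auto simp: M_def)
      then show ?thesis using True b(2) by (meson rtrancl.rtrancl_into_rtrancl)
    next
      case False
      then show ?thesis using b by blast
    qed
    show ?case
    proof (cases "u \<in> Bd")
      case True
      then show ?thesis using extend[of u w s'] step.IH s' by auto
    next
      case False
      then obtain s b x where b: "b \<in> Bd" "(v, b) \<in> ?M\<^sup>*" "(b, x) \<in> E s" "(x, u) \<in> (D s)\<^sup>*"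
        using step.IH by blast
      show ?thesis
      proof (cases "s' = s")
        case True
        then have "(u, w) \<in> D s" using False step(1) s' by (simp add: D_def)
        then have "(x, w) \<in> (D s)\<^sup>*" using b(4) by (meson rtrancl.rtrancl_into_rtrancl)
        then show ?thesis by (rule extend[OF b(1-3)])
      next
        case ne: False
        then have uw: "(u, w) \<in> E (\<not> s)" using s' by (cases s; cases s') auto
        from b(4) show ?thesis
        proof (cases rule: rtranclE)
          case base
          then have "(u, b) \<in> E (\<not> s)" using b(3) convD by simp
          then have "w = b" using line[OF step(1) False uw] by simp
          then show ?thesis using b by simp
        next
          case (step z)
          then have "(u, z) \<in> E (\<not> s)" "z \<notin> Bd" using convD[of u z s] by (auto simp: D_def)
          then have "w = z" using line[OF \<open>(v, u) \<in> ?E\<^sup>*\<close> False uw] by simp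
          then show ?thesis using extend[OF b(1-3)] step(1) by simp
        qed
      qed
    qed
  qed
  have connM: "(v, b) \<in> ?M\<^sup>*" if "b \<in> Bd" for b using walk[OF reach[OF that]] that by blast
  have Bdreach: "x \<in> Bd" if "(v, x) \<in> ?M\<^sup>*" for x
    using that Bd(2) by (cases rule: rtranclE) (auto simp: M_def)
  show ?thesis
  proof (rule fg_of_cofinite_connected_graph[OF H MX invM', where R = "insert v R" and v = v])
    show "finite (insert v R)" "insert v R \<subseteq> X" "v \<in> insert v R" using R Bd by auto
    show "(v, r) \<in> ?M\<^sup>*" if "r \<in> insert v R" for r using connM that R Bd by blast
    show "fg_subgroup (stab H r) G" "finite_nbrs H ?M r" if "r \<in> insert v R" for r
      using stabs Mnbrs that R Bd by blast+
    show "\<exists>h\<in>H. \<exists>r\<in>insert v R. x = act h r" if "(v, x) \<in> ?M\<^sup>*" for x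
      using R(3)[OF Bdreach[OF that]] by blast
    show "(v, act h v) \<in> ?M\<^sup>*" if "h \<in> H" for h using connM Bd(2,3) that by blast
  qed
qed

end

section \<open>Normal forms in HNN extensions\<close>

text \<open>
  A normal form \<open>x\<^sub>1 t\<^sup>\<epsilon>\<^sub>1 \<dots> x\<^sub>n t\<^sup>\<epsilon>\<^sub>n a\<close> is stored as the stack of the pairs \<open>(x\<^sub>i, \<epsilon>\<^sub>i)\<close>, last syllable on
  top, and the trailing element \<open>a\<close>; the \<open>x\<^sub>i\<close> are representatives of cosets of the associated
  subgroups, and \<open>x\<^sub>i = \<one>\<close> is excluded between opposite powers of \<open>t\<close>. Words act on these states from
  the right. In this direction each letter changes only the top of the stack, which makes it easy to
  verify the defining relations. The bottom of the stack is the first syllable; it tells in which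
  branch at the base vertex of the Bass-Serre tree an element lies.
\<close>

context hnn_data
begin

text \<open>
  The index \<open>True\<close> belongs to the stable letter and \<open>C1\<close>, the index \<open>False\<close> to its inverse and \<open>C2\<close>.
\<close>

definition assoc_sub :: "bool \<Rightarrow> 'a set" where
  "assoc_sub s = (if s then C1 else C2)"

definition transport :: "bool \<Rightarrow> 'a \<Rightarrow> 'a" where
  "transport s = (if s then \<phi> else inv_into C1 \<phi>)"

text \<open>
  The coset \<open>C\<close> itself is represented by \<open>\<one>\<close>, so that cancellation can be read off the representative.
\<close>

definition rep :: "bool \<Rightarrow> 'a \<Rightarrow> 'a" where
  "rep s a = (if a \<in> assoc_sub s then \<one> else SOME x. x \<in> a <# assoc_sub s)"

text \<open>
  Right multiplication by a stable letter: write \<open>a = x c\<close> with \<open>x\<close> a representative and move \<open>c\<close> to the right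
  of the letter. If \<open>x = \<one>\<close> and the top letter is the opposite one, the two letters cancel.
\<close>

fun push :: "bool \<Rightarrow> ('a \<times> bool) list \<times> 'a \<Rightarrow> ('a \<times> bool) list \<times> 'a" where
  "push s ([], a) = ([(rep s a, s)], transport s (inv (rep s a) \<otimes> a))"
| "push s ((y, s') # st, a) =
     (if rep s a = \<one> \<and> s' = (\<not> s) then (st, y \<otimes> transport s (inv (rep s a) \<otimes> a))
      else ((rep s a, s) # (y, s') # st, transport s (inv (rep s a) \<otimes> a)))"

fun read_letter :: "'a hnn_letter \<Rightarrow> ('a \<times> bool) list \<times> 'a \<Rightarrow> ('a \<times> bool) list \<times> 'a" where
  "read_letter (Base b) \<sigma> = (fst \<sigma>, snd \<sigma> \<otimes> b)"
| "read_letter Stable \<sigma> = push True \<sigma>"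
| "read_letter StableInv \<sigma> = push False \<sigma>"

definition read_word :: "'a hnn_letter list \<Rightarrow> ('a \<times> bool) list \<times> 'a \<Rightarrow> ('a \<times> bool) list \<times> 'a" where
  "read_word w = fold read_letter w"

fun reduced :: "('a \<times> bool) list \<Rightarrow> bool" where
  "reduced [] \<longleftrightarrow> True"
| "reduced ((x, s) # st) \<longleftrightarrow> x \<in> carrier A \<and> rep s x = x \<and> reduced st \<and>
     (st \<noteq> [] \<longrightarrow> \<not> (x = \<one> \<and> snd (hd st) = (\<not> s)))"

definition normal :: "('a \<times> bool) list \<times> 'a \<Rightarrow> bool" where
  "normal \<sigma> \<longleftrightarrow> reduced (fst \<sigma>) \<and> snd \<sigma> \<in> carrier A"

lemma subgroup_assoc_sub: "subgroup (assoc_sub s) A"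
  using C1 C2 by (simp add: assoc_sub_def)

lemma assoc_sub_carrier: "c \<in> assoc_sub s \<Longrightarrow> c \<in> carrier A"
  by (rule subgroup.mem_carrier[OF subgroup_assoc_sub])

lemma bij_phi: "bij_betw \<phi> C1 C2"
  using iso by (simp add: iso_def)

lemma transport_in: "c \<in> assoc_sub s \<Longrightarrow> transport s c \<in> assoc_sub (\<not> s)"
  using bij_phi bij_betw_inv_into[OF bij_phi] by (cases s) (auto simp: assoc_sub_def transport_def bij_betw_def)

lemma transport_transport: "c \<in> assoc_sub s \<Longrightarrow> transport (\<not> s) (transport s c) = c"
  using bij_betw_inv_into_left[OF bij_phi] bij_betw_inv_into_right[OF bij_phi]
  by (cases s) (auto simp: assoc_sub_def transport_def)

lemma phi_mult: "c \<in> C1 \<Longrightarrow> d \<in> C1 \<Longrightarrow> \<phi> (c \<otimes> d) = \<phi> c \<otimes> \<phi> d"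
  using iso by (simp add: iso_def hom_def)

lemma transport_mult:
  assumes "c \<in> assoc_sub s" "d \<in> assoc_sub s"
  shows "transport s (c \<otimes> d) = transport s c \<otimes> transport s d"
proof (cases s)
  case True
  then show ?thesis using assms phi_mult by (simp add: assoc_sub_def transport_def)
next
  case False
  let ?p = "transport False c" and ?q = "transport False d"
  have pq: "?p \<in> C1" "?q \<in> C1" using transport_in[of _ False] assms False by (auto simp: assoc_sub_def)
  have "\<phi> ?p = c" "\<phi> ?q = d" using transport_transport[of _ False] assms False by (auto simp: transport_def)
  then have "\<phi> (?p \<otimes> ?q) = c \<otimes> d" using phi_mult[OF pq] by simp
  moreover have "?p \<otimes> ?q \<in> C1" using pq subgroup.m_closed[OF C1] by simp
  ultimately show ?thesis using False bij_betw_inv_into_left[OF bij_phi] by (metis transport_def)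
qed

lemma l_coset_mult:
  assumes "a \<in> carrier A" "c \<in> assoc_sub s" shows "a \<otimes> c <# assoc_sub s = a <# assoc_sub s"
proof -
  note [simp] = assoc_sub_carrier
  have "a \<otimes> c <# assoc_sub s = a <# (c <# assoc_sub s)"
    using assms subgroup.subset[OF subgroup_assoc_sub] by (simp add: lcos_m_assoc)
  also have "c <# assoc_sub s = assoc_sub s"
  proof (intro subset_antisym subsetI)
    fix x assume "x \<in> assoc_sub s"
    then have "inv c \<otimes> x \<in> assoc_sub s" "x = c \<otimes> (inv c \<otimes> x)"
      using assms(2) subgroup.m_closed[OF subgroup_assoc_sub] subgroup.m_inv_closed[OF subgroup_assoc_sub]
      by (simp_all add: inv_cancel)
    then show "x \<in> c <# assoc_sub s" unfolding l_coset_def by blast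
  qed (use assms(2) subgroup.m_closed[OF subgroup_assoc_sub] in \<open>auto simp: l_coset_def\<close>)
  finally show ?thesis .
qed

lemma mem_assoc_mult_iff:
  assumes "a \<in> carrier A" "c \<in> assoc_sub s" shows "a \<otimes> c \<in> assoc_sub s \<longleftrightarrow> a \<in> assoc_sub s"
proof
  assume "a \<otimes> c \<in> assoc_sub s"
  then have "a \<otimes> c \<otimes> inv c \<in> assoc_sub s"
    using assms subgroup.m_closed[OF subgroup_assoc_sub] subgroup.m_inv_closed[OF subgroup_assoc_sub] by blast
  then show "a \<in> assoc_sub s" using assms assoc_sub_carrier by (simp add: m_assoc)
qed (use assms subgroup.m_closed[OF subgroup_assoc_sub] in blast)

lemma rep_in: "a \<in> carrier A \<Longrightarrow> rep s a \<in> carrier A \<and> inv (rep s a) \<otimes> a \<in> assoc_sub s"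
proof (cases "a \<in> assoc_sub s")
  case True
  then show ?thesis using assoc_sub_carrier by (simp add: rep_def)
next
  case False
  assume a: "a \<in> carrier A"
  have "a \<in> a <# assoc_sub s"
    using a subgroup.one_closed[OF subgroup_assoc_sub] by (force simp: l_coset_def)
  then have "rep s a \<in> a <# assoc_sub s" using False by (auto simp: rep_def intro: someI)
  then obtain c where c: "c \<in> assoc_sub s" "rep s a = a \<otimes> c" by (auto simp: l_coset_def)
  then have "inv (rep s a) \<otimes> a = inv c"
    using a assoc_sub_carrier[OF c(1)] by (simp add: inv_mult_group m_assoc)
  then show ?thesis using c a assoc_sub_carrier subgroup.m_inv_closed[OF subgroup_assoc_sub] by simp
qed

lemma rep_mult: "a \<in> carrier A \<Longrightarrow> c \<in> assoc_sub s \<Longrightarrow> rep s (a \<otimes> c) = rep s a"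
  by (simp add: rep_def l_coset_mult mem_assoc_mult_iff)

lemma rep_assoc: "c \<in> assoc_sub s \<Longrightarrow> rep s c = \<one>"
  by (simp add: rep_def)

lemma rep_split:
  assumes "a \<in> carrier A"
  obtains c where "c \<in> assoc_sub s" "a = rep s a \<otimes> c" "inv (rep s a) \<otimes> a = c"
proof (rule that)
  show "inv (rep s a) \<otimes> a \<in> assoc_sub s" using rep_in[OF assms] by simp
  show "a = rep s a \<otimes> (inv (rep s a) \<otimes> a)" using rep_in[OF assms] assms by (simp add: inv_cancel)
qed simp

lemma rep_rep:
  assumes "a \<in> carrier A" shows "rep s (rep s a) = rep s a"
proof -
  obtain c where c: "c \<in> assoc_sub s" "a = rep s a \<otimes> c" "inv (rep s a) \<otimes> a = c"
    using rep_split[OF assms, of s] .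
  show ?thesis using rep_mult[of "rep s a" c s] c(1,2) rep_in[OF assms, of s] by simp
qed

lemma rep_eqD:
  assumes "a \<in> carrier A" "b \<in> carrier A" "rep s a = rep s b" shows "inv a \<otimes> b \<in> assoc_sub s"
proof -
  obtain c where c: "c \<in> assoc_sub s" "a = rep s a \<otimes> c" "inv (rep s a) \<otimes> a = c"
    using rep_split[OF assms(1), of s] .
  obtain d where d: "d \<in> assoc_sub s" "b = rep s b \<otimes> d" "inv (rep s b) \<otimes> b = d"
    using rep_split[OF assms(2), of s] .
  have "inv a \<otimes> b = inv (rep s a \<otimes> c) \<otimes> (rep s a \<otimes> d)" using c(2) d(2) assms(3) by simp
  also have "\<dots> = inv c \<otimes> d"
    using rep_in[OF assms(1), of s] assoc_sub_carrier[OF c(1)] assoc_sub_carrier[OF d(1)]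
    by (simp add: inv_mult_group m_assoc inv_cancel)
  finally show ?thesis
    using c(1) d(1) subgroup.m_closed[OF subgroup_assoc_sub] subgroup.m_inv_closed[OF subgroup_assoc_sub] by simp
qed

lemma normal_push: "normal \<sigma> \<Longrightarrow> normal (push s \<sigma>)"
proof (induction s \<sigma> rule: push.induct)
  case (1 s a)
  then have a: "a \<in> carrier A" by (simp add: normal_def)
  have "transport s (inv (rep s a) \<otimes> a) \<in> carrier A" using rep_in[OF a] transport_in assoc_sub_carrier by blast
  then show ?case using rep_in[OF a] rep_rep[OF a] by (auto simp: normal_def)
next
  case (2 s y s' st a)
  then have a: "a \<in> carrier A" by (simp add: normal_def)
  have "transport s (inv (rep s a) \<otimes> a) \<in> carrier A" using rep_in[OF a] transport_in assoc_sub_carrier by blast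
  then show ?case using 2 rep_in[OF a] rep_rep[OF a] by (auto simp: normal_def)
qed

text \<open>
  A push that cancels is undone by a push that does not, and conversely. The former relies on the top of
  a reduced stack: after the cancellation no further one is possible.
\<close>

lemma push_push_inverse:
  assumes "normal \<sigma>" shows "push (\<not> s) (push s \<sigma>) = \<sigma>"
proof -
  obtain st a where \<sigma>: "\<sigma> = (st, a)" by (cases \<sigma>)
  have a: "a \<in> carrier A" and st: "reduced st" using assms by (auto simp: normal_def \<sigma>)
  obtain c where c: "c \<in> assoc_sub s" "a = rep s a \<otimes> c" "inv (rep s a) \<otimes> a = c"
    using rep_split[OF a, of s] .
  let ?c = "transport s c"
  have tc: "?c \<in> assoc_sub (\<not> s)" "transport (\<not> s) ?c = c" using transport_in transport_transport c by auto
  have tcc: "?c \<in> carrier A" using tc assoc_sub_carrier by blast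
  show ?thesis
  proof (cases "rep s a = \<one> \<and> st \<noteq> [] \<and> snd (hd st) = (\<not> s)")
    case False
    then have "push s \<sigma> = ((rep s a, s) # st, ?c)"
      using c(3) unfolding \<sigma> by (cases st) auto
    then show ?thesis using rep_assoc[OF tc(1)] tc tcc c(2) \<sigma> by simp
  next
    case True
    then obtain y st' where y: "st = (y, \<not> s) # st'" by (cases st) auto
    then have yA: "y \<in> carrier A" "rep (\<not> s) y = y" using st by auto
    have p: "push s \<sigma> = (st', y \<otimes> ?c)" using True c(3) unfolding \<sigma> y by simp
    have r: "rep (\<not> s) (y \<otimes> ?c) = y" using rep_mult[OF yA(1) tc(1)] yA by simp
    have ac: "a = c" using True c assoc_sub_carrier[OF c(1)] by simp
    have "inv y \<otimes> (y \<otimes> ?c) = ?c" using yA tcc by (simp add: inv_cancel)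
    then show ?thesis unfolding p using r tc(2) ac st y \<sigma> by (cases st') auto
  qed
qed

text \<open>
  This is the relation \<open>c t = t \<phi>(c)\<close> on states.
\<close>

lemma push_mult:
  assumes "normal (st, a)" "c \<in> assoc_sub s"
  shows "push s (st, a \<otimes> c) = (fst (push s (st, a)), snd (push s (st, a)) \<otimes> transport s c)"
proof -
  have a: "a \<in> carrier A" and st: "reduced st" using assms by (auto simp: normal_def)
  have cc: "c \<in> carrier A" using assms assoc_sub_carrier by blast
  let ?d = "inv (rep s a) \<otimes> a"
  have d: "?d \<in> assoc_sub s" "rep s a \<in> carrier A" using rep_in[OF a] by auto
  have "inv (rep s a) \<otimes> (a \<otimes> c) = ?d \<otimes> c" using d a cc by (simp add: m_assoc)
  then have t: "transport s (inv (rep s (a \<otimes> c)) \<otimes> (a \<otimes> c)) = transport s ?d \<otimes> transport s c"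
    using transport_mult[OF d(1) assms(2)] rep_mult[OF a assms(2)] by simp
  have tc: "transport s ?d \<in> carrier A" "transport s c \<in> carrier A"
    using transport_in assoc_sub_carrier d(1) assms(2) by blast+
  show ?thesis
    using t rep_mult[OF a assms(2)] tc st by (cases st) (auto simp: m_assoc)
qed

lemma read_word_append: "read_word (u @ v) \<sigma> = read_word v (read_word u \<sigma>)"
  by (simp add: read_word_def)

lemma normal_read_letter: "normal \<sigma> \<Longrightarrow> [l] \<in> hnn_words A \<Longrightarrow> normal (read_letter l \<sigma>)"
  by (cases l) (auto simp: normal_push hnn_words_def, auto simp: normal_def)

lemma normal_read_word: "w \<in> hnn_words A \<Longrightarrow> normal \<sigma> \<Longrightarrow> normal (read_word w \<sigma>)"
proof (induction w arbitrary: \<sigma>)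
  case (Cons l w)
  then have "[l] \<in> hnn_words A" "w \<in> hnn_words A" by (auto simp: hnn_words_def)
  then show ?case using Cons normal_read_letter by (simp add: read_word_def)
qed (simp add: read_word_def)

lemma read_word_rel: "(u, v) \<in> R \<Longrightarrow> normal \<sigma> \<Longrightarrow> read_word u \<sigma> = read_word v \<sigma>"
proof (induction arbitrary: \<sigma> rule: hnn_rel.induct)
  case (append u u' v v')
  have "normal (read_word u \<sigma>)" using normal_read_word hnn_rel_words append by blast
  then show ?case using append by (simp add: read_word_append)
next
  case base_one
  then show ?case by (cases \<sigma>) (simp add: read_word_def normal_def)
next
  case (base_mult a b)
  then show ?case by (cases \<sigma>) (simp add: read_word_def normal_def m_assoc)
next
  case stable_right
  then show ?case using push_push_inverse[of \<sigma> True] by (simp add: read_word_def)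
next
  case stable_left
  then show ?case using push_push_inverse[of \<sigma> False] by (simp add: read_word_def)
next
  case (hnn c)
  obtain st a where p: "push False \<sigma> = (st, a)" by (cases "push False \<sigma>")
  have n: "normal (st, a)" using normal_push[OF hnn(2), of False] p by simp
  have "push True (st, a) = \<sigma>" using push_push_inverse[OF hnn(2), of False] p by simp
  then show ?case using push_mult[OF n, of c True] hnn(1) p
    by (simp add: read_word_def assoc_sub_def transport_def)
qed auto

definition stable :: "bool \<Rightarrow> 'a hnn_letter list set" where
  "stable s = cls [if s then Stable else StableInv]"

abbreviation "base \<equiv> hnn_base A C1 \<phi>"

lemma hnn_words_single [simp]: "[Stable] \<in> hnn_words A" "[StableInv] \<in> hnn_words A"
  "[Base a] \<in> hnn_words A \<longleftrightarrow> a \<in> carrier A"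
  by (auto simp: hnn_words_def)

lemma cls_in_carrier: "w \<in> hnn_words A \<Longrightarrow> cls w \<in> carrier HNN"
  by (simp add: hnn_carrier)

lemma stable_in_carrier [simp]: "stable s \<in> carrier HNN"
  by (simp add: stable_def cls_in_carrier)

lemma base_in_carrier [simp]: "a \<in> carrier A \<Longrightarrow> base a \<in> carrier HNN"
  using hnn_base_hom by (auto simp: hom_def)

lemma base_mult: "a \<in> carrier A \<Longrightarrow> b \<in> carrier A \<Longrightarrow> base (a \<otimes> b) = base a \<otimes>\<^bsub>HNN\<^esub> base b"
  using hnn_base_hom by (auto simp: hom_def)

lemma stable_inverse: "stable (\<not> s) = inv\<^bsub>HNN\<^esub> (stable s)"
proof -
  interpret H: group HNN by (rule group_hnn_extension)
  have "cls [StableInv] \<otimes>\<^bsub>HNN\<^esub> cls [Stable] = \<one>\<^bsub>HNN\<^esub>"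
    using hnn_rel.stable_left hnn_rel_words[OF hnn_rel.stable_left]
    by (simp add: hnn_mult hnn_one hnn_class_eq_iff)
  then have "inv\<^bsub>HNN\<^esub> (stable True) = stable False"
    by (intro H.inv_equality) (auto simp: stable_def cls_in_carrier)
  then show ?thesis using H.inv_inv[of "stable True"] by (cases s) simp_all
qed

lemma stable_conj:
  assumes "c \<in> assoc_sub s"
  shows "base c \<otimes>\<^bsub>HNN\<^esub> stable s = stable s \<otimes>\<^bsub>HNN\<^esub> base (transport s c)"
proof -
  interpret H: group HNN by (rule group_hnn_extension)
  have phi_conj: "base c \<otimes>\<^bsub>HNN\<^esub> stable True = stable True \<otimes>\<^bsub>HNN\<^esub> base (\<phi> c)" if "c \<in> C1" for c
  proof -
    have c: "c \<in> carrier A" using that subgroup.mem_carrier[OF C1] by blast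
    have "inv\<^bsub>HNN\<^esub> (stable True) \<otimes>\<^bsub>HNN\<^esub> base c \<otimes>\<^bsub>HNN\<^esub> stable True = base (\<phi> c)"
      using hnn_relation[OF that] by (simp add: stable_def)
    then show ?thesis using c by (simp add: H.m_assoc flip: \<open>_ = base (\<phi> c)\<close>) (simp add: H.inv_cancel)
  qed
  show ?thesis
  proof (cases s)
    case True
    then show ?thesis using phi_conj assms by (simp add: assoc_sub_def transport_def)
  next
    case False
    let ?d = "transport False c"
    have d: "?d \<in> C1" "\<phi> ?d = c" using transport_in[of c False] transport_transport[of c False] assms False
      by (auto simp: assoc_sub_def transport_def)
    have cr: "c \<in> carrier A" "?d \<in> carrier A" using assms assoc_sub_carrier subgroup.mem_carrier[OF C1] d by auto
    have e: "base ?d \<otimes>\<^bsub>HNN\<^esub> stable True = stable True \<otimes>\<^bsub>HNN\<^esub> base c" using phi_conj[OF d(1)] d(2) by simp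
    have "base c \<otimes>\<^bsub>HNN\<^esub> inv\<^bsub>HNN\<^esub> (stable True) = inv\<^bsub>HNN\<^esub> (stable True) \<otimes>\<^bsub>HNN\<^esub> (stable True \<otimes>\<^bsub>HNN\<^esub> base c) \<otimes>\<^bsub>HNN\<^esub> inv\<^bsub>HNN\<^esub> (stable True)"
      using cr by (simp add: H.m_assoc H.inv_cancel)
    also have "\<dots> = inv\<^bsub>HNN\<^esub> (stable True) \<otimes>\<^bsub>HNN\<^esub> base ?d"
      using cr by (simp add: H.m_assoc flip: e)
    finally show ?thesis using stable_inverse[of True] False by simp
  qed
qed

fun stack_value :: "('a \<times> bool) list \<Rightarrow> 'a hnn_letter list set" where
  "stack_value [] = \<one>\<^bsub>HNN\<^esub>"
| "stack_value ((x, s) # st) = stack_value st \<otimes>\<^bsub>HNN\<^esub> base x \<otimes>\<^bsub>HNN\<^esub> stable s"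

definition state_value :: "('a \<times> bool) list \<times> 'a \<Rightarrow> 'a hnn_letter list set" where
  "state_value \<sigma> = stack_value (fst \<sigma>) \<otimes>\<^bsub>HNN\<^esub> base (snd \<sigma>)"

lemma stack_value_in_carrier: "reduced st \<Longrightarrow> stack_value st \<in> carrier HNN"
proof (induction st)
  case Nil
  interpret H: group HNN by (rule group_hnn_extension)
  show ?case by simp
next
  case (Cons p st)
  interpret H: group HNN by (rule group_hnn_extension)
  show ?case using Cons by (cases p) auto
qed

lemma state_value_push:
  assumes "normal \<sigma>" shows "state_value (push s \<sigma>) = state_value \<sigma> \<otimes>\<^bsub>HNN\<^esub> stable s"
proof -
  interpret H: group HNN by (rule group_hnn_extension)
  obtain st a where \<sigma>: "\<sigma> = (st, a)" by (cases \<sigma>)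
  have a: "a \<in> carrier A" and st: "reduced st" using assms by (auto simp: normal_def \<sigma>)
  obtain c where c: "c \<in> assoc_sub s" "a = rep s a \<otimes> c" "inv (rep s a) \<otimes> a = c"
    using rep_split[OF a, of s] .
  let ?c = "transport s c"
  have mem: "c \<in> carrier A" "?c \<in> carrier A" "rep s a \<in> carrier A" "stack_value st \<in> carrier HNN"
    using assoc_sub_carrier c(1) transport_in rep_in[OF a] stack_value_in_carrier[OF st] by blast+
  have ba: "base a = base (rep s a) \<otimes>\<^bsub>HNN\<^esub> base c" using c(2) base_mult mem by metis
  show ?thesis
  proof (cases "rep s a = \<one> \<and> st \<noteq> [] \<and> snd (hd st) = (\<not> s)")
    case False
    then have "push s \<sigma> = ((rep s a, s) # st, ?c)"
      using c(3) unfolding \<sigma> by (cases st) auto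
    then show ?thesis using mem ba stable_conj[OF c(1)] by (simp add: state_value_def \<sigma> H.m_assoc)
  next
    case True
    then obtain y st' where y: "st = (y, \<not> s) # st'" by (cases st) auto
    then have yA: "y \<in> carrier A" "stack_value st' \<in> carrier HNN" using st stack_value_in_carrier by auto
    have p: "push s \<sigma> = (st', y \<otimes> ?c)" using True c(3) unfolding \<sigma> y by simp
    have ac: "a = c" using True c mem by simp
    have "stable (\<not> s) \<otimes>\<^bsub>HNN\<^esub> (base c \<otimes>\<^bsub>HNN\<^esub> stable s) = base ?c"
      using mem by (simp add: stable_conj[OF c(1)] stable_inverse H.inv_cancel)
    then show ?thesis unfolding p unfolding \<sigma> y ac
      using mem yA by (simp add: state_value_def base_mult H.m_assoc)
  qed
qed

lemma state_value_read_word: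
  "w \<in> hnn_words A \<Longrightarrow> normal \<sigma> \<Longrightarrow> state_value (read_word w \<sigma>) = state_value \<sigma> \<otimes>\<^bsub>HNN\<^esub> cls w"
proof (induction w arbitrary: \<sigma>)
  case Nil
  interpret H: group HNN by (rule group_hnn_extension)
  have "state_value \<sigma> \<in> carrier HNN"
    using Nil stack_value_in_carrier by (auto simp: state_value_def normal_def)
  then show ?case by (simp add: read_word_def flip: hnn_one)
next
  case (Cons l w)
  interpret H: group HNN by (rule group_hnn_extension)
  have lw: "[l] \<in> hnn_words A" "w \<in> hnn_words A" using Cons.prems by (auto simp: hnn_words_def)
  have sc: "stack_value (fst \<sigma>) \<in> carrier HNN" "snd \<sigma> \<in> carrier A"
    using Cons.prems stack_value_in_carrier by (auto simp: normal_def)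
  have "state_value (read_letter l \<sigma>) = state_value \<sigma> \<otimes>\<^bsub>HNN\<^esub> cls [l]"
  proof (cases l)
    case (Base b)
    then have "cls [l] = base b" "b \<in> carrier A" using lw by (simp_all add: hnn_base_def)
    then show ?thesis using Base sc by (simp add: state_value_def base_mult H.m_assoc)
  next
    case Stable
    then show ?thesis using state_value_push[OF Cons.prems(2), of True] by (simp add: stable_def)
  next
    case StableInv
    then show ?thesis using state_value_push[OF Cons.prems(2), of False] by (simp add: stable_def)
  qed
  moreover have "state_value (read_word w (read_letter l \<sigma>)) = state_value (read_letter l \<sigma>) \<otimes>\<^bsub>HNN\<^esub> cls w"
    using Cons.IH lw normal_read_letter Cons.prems by blast
  moreover have "state_value \<sigma> \<in> carrier HNN" using sc by (simp add: state_value_def)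
  ultimately show ?case
    using lw hnn_mult[OF lw] by (simp add: read_word_def H.m_assoc cls_in_carrier)
qed

definition normal_form :: "'a hnn_letter list set \<Rightarrow> ('a \<times> bool) list \<times> 'a" where
  "normal_form g = read_word (SOME w. w \<in> hnn_words A \<and> cls w = g) ([], \<one>)"

lemma normal_start: "normal ([], \<one>)"
  by (simp add: normal_def)

lemma normal_form_cls:
  assumes "w \<in> hnn_words A" shows "normal_form (cls w) = read_word w ([], \<one>)"
proof -
  let ?w = "SOME v. v \<in> hnn_words A \<and> cls v = cls w"
  have "?w \<in> hnn_words A \<and> cls ?w = cls w" by (rule someI[of _ w]) (simp add: assms)
  then have "(?w, w) \<in> R" using assms hnn_class_eq_iff by blast
  then show ?thesis unfolding normal_form_def using normal_start by (rule read_word_rel)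
qed

lemma carrier_cases:
  assumes "g \<in> carrier HNN" obtains w where "w \<in> hnn_words A" "g = cls w"
  using assms by (auto simp: hnn_carrier)

lemma normal_normal_form: "g \<in> carrier HNN \<Longrightarrow> normal (normal_form g)"
  by (erule carrier_cases) (simp add: normal_form_cls normal_read_word normal_start)

lemma state_value_normal_form:
  assumes "g \<in> carrier HNN" shows "state_value (normal_form g) = g"
proof -
  interpret H: group HNN by (rule group_hnn_extension)
  obtain w where w: "w \<in> hnn_words A" "g = cls w" using assms by (rule carrier_cases)
  have "base \<one> = \<one>\<^bsub>HNN\<^esub>"
    using hnn_base_hom hom_one[OF _ group_axioms group_hnn_extension] by blast
  then have "state_value ([], \<one>) = \<one>\<^bsub>HNN\<^esub>" by (simp add: state_value_def)
  then show ?thesis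
    using w assms state_value_read_word[OF w(1) normal_start] by (simp add: normal_form_cls)
qed

lemma normal_form_base_mult:
  assumes "g \<in> carrier HNN" "a \<in> carrier A"
  shows "normal_form (g \<otimes>\<^bsub>HNN\<^esub> base a) = (fst (normal_form g), snd (normal_form g) \<otimes> a)"
proof -
  obtain w where w: "w \<in> hnn_words A" "g = cls w" using assms(1) by (rule carrier_cases)
  have "normal_form (g \<otimes>\<^bsub>HNN\<^esub> base a) = read_word (w @ [Base a]) ([], \<one>)"
    using w assms by (simp add: hnn_base_def hnn_mult normal_form_cls)
  then show ?thesis using w by (simp add: read_word_append normal_form_cls) (simp add: read_word_def)
qed

lemma normal_form_stable_mult:
  assumes "g \<in> carrier HNN" shows "normal_form (g \<otimes>\<^bsub>HNN\<^esub> stable s) = push s (normal_form g)"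
proof -
  obtain w where w: "w \<in> hnn_words A" "g = cls w" using assms(1) by (rule carrier_cases)
  let ?l = "if s then Stable else StableInv"
  have l: "[?l] \<in> hnn_words A" by simp
  have "normal_form (g \<otimes>\<^bsub>HNN\<^esub> stable s) = read_word (w @ [?l]) ([], \<one>)"
    unfolding w(2) stable_def hnn_mult[OF w(1) l] using w l by (intro normal_form_cls) simp
  then show ?thesis using w by (simp add: read_word_append normal_form_cls) (simp add: read_word_def)
qed

lemma normal_form_base:
  assumes "a \<in> carrier A" shows "normal_form (base a) = ([], a)"
  using assms by (simp add: hnn_base_def normal_form_cls read_word_def)

text \<open>
  \<open>None\<close> stands for the base group itself.
\<close>

definition branch :: "'a hnn_letter list set \<Rightarrow> ('a \<times> bool) option" where
  "branch g = (if fst (normal_form g) = [] then None else Some (last (fst (normal_form g))))"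

lemma branch_None_iff:
  assumes "g \<in> carrier HNN" shows "branch g = None \<longleftrightarrow> g \<in> base ` carrier A"
proof
  interpret H: group HNN by (rule group_hnn_extension)
  assume "branch g = None"
  then have e: "fst (normal_form g) = []" by (simp add: branch_def split: if_splits)
  have s: "snd (normal_form g) \<in> carrier A" using normal_normal_form[OF assms] by (simp add: normal_def)
  have "g = base (snd (normal_form g))"
    using state_value_normal_form[OF assms] e s by (simp add: state_value_def)
  then show "g \<in> base ` carrier A" using s by blast
qed (auto simp: branch_def normal_form_base)

lemma branch_base_mult: "g \<in> carrier HNN \<Longrightarrow> a \<in> carrier A \<Longrightarrow> branch (g \<otimes>\<^bsub>HNN\<^esub> base a) = branch g"
  by (simp add: branch_def normal_form_base_mult)

lemma last_push:
  "fst \<sigma> \<noteq> [] \<Longrightarrow> fst (push s \<sigma>) \<noteq> [] \<Longrightarrow> last (fst (push s \<sigma>)) = last (fst \<sigma>)"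
  by (induction s \<sigma> rule: push.induct) auto

lemma branch_stable_mult:
  assumes "g \<in> carrier HNN" "branch g \<noteq> None" "branch (g \<otimes>\<^bsub>HNN\<^esub> stable s) \<noteq> None"
  shows "branch (g \<otimes>\<^bsub>HNN\<^esub> stable s) = branch g"
  using assms last_push by (auto simp: branch_def normal_form_stable_mult split: if_splits)

lemma branch_base_stable:
  assumes "a \<in> carrier A" shows "branch (base a \<otimes>\<^bsub>HNN\<^esub> stable s) = Some (rep s a, s)"
  using assms by (simp add: branch_def normal_form_stable_mult normal_form_base)

lemma inj_base: "inj_on base (carrier A)"
  by (rule inj_onI) (metis normal_form_base snd_conv)

lemma hnn_induct:
  assumes g: "g \<in> carrier HNN" and one: "P \<one>\<^bsub>HNN\<^esub>"
    and base: "\<And>g a. g \<in> carrier HNN \<Longrightarrow> P g \<Longrightarrow> a \<in> carrier A \<Longrightarrow> P (g \<otimes>\<^bsub>HNN\<^esub> base a)"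
    and stable: "\<And>g s. g \<in> carrier HNN \<Longrightarrow> P g \<Longrightarrow> P (g \<otimes>\<^bsub>HNN\<^esub> stable s)"
  shows "P g"
proof -
  have "P (cls w)" if "w \<in> hnn_words A" for w
    using that
  proof (induction w rule: rev_induct)
    case Nil
    then show ?case using one by (simp add: hnn_one)
  next
    case (snoc l w)
    then have lw: "w \<in> hnn_words A" "[l] \<in> hnn_words A" by simp_all
    have "P (cls w \<otimes>\<^bsub>HNN\<^esub> cls [l])"
    proof (cases l)
      case (Base a)
      then show ?thesis using base[OF cls_in_carrier[OF lw(1)] snoc.IH[OF lw(1)], of a] lw by (simp add: hnn_base_def)
    next
      case Stable
      then show ?thesis using stable[OF cls_in_carrier[OF lw(1)] snoc.IH[OF lw(1)], of True] by (simp add: stable_def)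
    next
      case StableInv
      then show ?thesis using stable[OF cls_in_carrier[OF lw(1)] snoc.IH[OF lw(1)], of False] by (simp add: stable_def)
    qed
    then show ?case using lw by (simp add: hnn_mult)
  qed
  then show ?thesis using g by (auto simp: hnn_carrier)
qed

end

section \<open>The Bass-Serre tree\<close>

text \<open>
  The translates of finitely many walks, from \<open>v\<close> to its images under the generators, form a subgraph with
  finitely many orbits of edges in which \<open>v\<close> is connected to its whole orbit.
\<close>

lemma (in group_acting) cofinite_invariant_subgraph:
  assumes H: "fg_subgroup H G" and T: "T \<subseteq> X \<times> X" "sym T" "invariant H T" and v: "v \<in> X"
    and conn: "\<And>h. h \<in> H \<Longrightarrow> (v, act h v) \<in> T\<^sup>*"
  obtains E where "E \<subseteq> T" "sym E" "invariant H E" "\<forall>h\<in>H. (v, act h v) \<in> E\<^sup>*"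
    "\<forall>x\<in>X. finite_nbrs H E x"
    "\<exists>R. finite R \<and> R \<subseteq> X \<and> (\<forall>x. (v, x) \<in> E\<^sup>* \<longrightarrow> (\<exists>h\<in>H. \<exists>r\<in>R. x = act h r))"
proof -
  have HG: "subgroup H G" using H by (rule fg_subgroup_subgroup)
  note mem = subgroup.mem_carrier[OF HG]
  note Hm = subgroup.m_closed[OF HG] and Hi = subgroup.m_inv_closed[OF HG] and Ho = subgroup.one_closed[OF HG]
  obtain S where S: "finite S" "S \<subseteq> carrier G" "H = generate G S" using H by (auto simp: fg_subgroup_def)
  have SH: "S \<subseteq> H" using S by (auto intro: generate.incl)
  have "\<forall>s\<in>S. \<exists>P. finite P \<and> P \<subseteq> T \<and> (v, act s v) \<in> P\<^sup>*"
    using finite_support_of_walk[OF conn[OF subsetD[OF SH]]] by (rule ballI)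
  then obtain P0 where P0: "\<forall>s\<in>S. finite (P0 s) \<and> P0 s \<subseteq> T \<and> (v, act s v) \<in> (P0 s)\<^sup>*"
    by (rule bchoice[THEN exE])
  define P where "P = (\<Union>s\<in>S. P0 s) \<union> (\<Union>s\<in>S. P0 s)\<inverse>"
  have finP: "finite P" using S(1) P0 by (simp add: P_def)
  have PT: "P \<subseteq> T" using P0 T(2) by (auto simp: P_def dest: symD)
  have PX: "P \<subseteq> X \<times> X" using PT T(1) by blast
  define E where "E = {(act h x, act h y) | h x y. h \<in> H \<and> (x, y) \<in> P}"
  have EI: "(act h x, act h y) \<in> E" if "h \<in> H" "(x, y) \<in> P" for h x y using that by (auto simp: E_def)
  have ET: "E \<subseteq> T" using PT invariantD[OF T(3)] by (auto simp: E_def)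
  have Esym: "sym E"
  proof (rule symI)
    fix x y assume "(x, y) \<in> E"
    then obtain h p q where h: "h \<in> H" "(p, q) \<in> P" "x = act h p" "y = act h q" by (auto simp: E_def)
    have "(q, p) \<in> P" using h(2) by (auto simp: P_def)
    then show "(y, x) \<in> E" using EI h by simp
  qed
  have invE: "invariant H E"
    unfolding invariant_def
  proof (intro ballI allI impI)
    fix k x y assume k: "k \<in> H" and "(x, y) \<in> E"
    then obtain h p q where h: "h \<in> H" "(p, q) \<in> P" "x = act h p" "y = act h q" by (auto simp: E_def)
    then have "act k x = act (k \<otimes> h) p" "act k y = act (k \<otimes> h) q" using PX k mem by (auto simp: act_mult)
    then show "(act k x, act k y) \<in> E" using EI Hm k h by simp
  qed
  have PE: "P \<subseteq> E"
  proof
    fix e assume "e \<in> P"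
    then obtain x y where e: "e = (x, y)" "(x, y) \<in> P" "x \<in> X" "y \<in> X" using PX by auto
    then show "e \<in> E" using EI[OF Ho e(2)] act_one by simp
  qed
  have Sconn: "(v, act s v) \<in> E\<^sup>*" if "s \<in> S" for s
  proof -
    have "P0 s \<subseteq> E" using that PE by (auto simp: P_def)
    then show ?thesis using P0 that rtrancl_mono by blast
  qed
  have "h \<in> H \<and> (v, act h v) \<in> E\<^sup>*" if "h \<in> generate G S" for h
    using that
  proof induction
    case one
    then show ?case using Ho act_one v by simp
  next
    case (incl h)
    then show ?case using SH Sconn by blast
  next
    case (inv h)
    then have h: "h \<in> H" "inv h \<in> H" using SH Hi by auto
    have "(act (inv h) v, act (inv h) (act h v)) \<in> E\<^sup>*"
      using act_rtrancl[OF invE h(2) Sconn[OF inv]] .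
    then have "(act (inv h) v, v) \<in> E\<^sup>*" using act_inv_cancel(1)[OF mem[OF h(1)] v] by simp
    then show ?case using h symD[OF sym_rtrancl[OF Esym]] by blast
  next
    case (eng h k)
    have "(act h v, act h (act k v)) \<in> E\<^sup>*" using act_rtrancl[OF invE] eng by blast
    then show ?case using eng Hm mem v by (simp add: act_mult) (meson rtrancl_trans)
  qed
  then have conE: "\<forall>h\<in>H. (v, act h v) \<in> E\<^sup>*" using S(3) by simp
  have nbrs: "finite_nbrs H E x" if x: "x \<in> X" for x
  proof -
    define c where "c = (\<lambda>p. SOME h. h \<in> H \<and> act h p = x)"
    have c: "c p \<in> H \<and> act (c p) p = x" if "h \<in> H" "act h p = x" for h p
      unfolding c_def by (rule someI[of _ h]) (simp add: that)
    let ?N = "(\<lambda>(p, q). act (c p) q) ` {(p, q) \<in> P. \<exists>h\<in>H. act h p = x}"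
    show ?thesis
    proof (rule finite_nbrsI[OF HG invE x])
      show "finite ?N" by (rule finite_imageI, rule finite_subset[OF _ finP]) auto
      show "?N \<subseteq> X"
      proof
        fix n assume "n \<in> ?N"
        then obtain p q h where *: "(p, q) \<in> P" "h \<in> H" "act h p = x" "n = act (c p) q" by auto
        have "c p \<in> H" using c[OF *(2,3)] by simp
        then show "n \<in> X" unfolding *(4) using *(1) PX mem act_closed by blast
      qed
      fix y assume "(x, y) \<in> E"
      then obtain h p q where h: "h \<in> H" "(p, q) \<in> P" "x = act h p" "y = act h q" by (auto simp: E_def)
      have cp: "c p \<in> H" "act (c p) p = x" using c h by auto
      have pq: "p \<in> X" "q \<in> X" using h PX by auto
      let ?s = "h \<otimes> inv (c p)"
      have s: "?s \<in> H" using h cp Hm Hi by simp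
      have "act (inv (c p)) x = p" using cp pq mem act_inv_cancel(1) by metis
      then have "act ?s x = x" using h cp mem x by (simp add: act_mult)
      then have "?s \<in> stab H x" using s by (simp add: stab_def)
      moreover have "y = act ?s (act (c p) q)"
        using h cp pq mem by (simp add: act_mult act_closed act_inv_cancel)
      moreover have "act (c p) q \<in> ?N" using h by force
      ultimately show "\<exists>s\<in>stab H x. \<exists>n\<in>?N. y = act s n" by blast
    qed
  qed
  let ?R = "insert v (fst ` P)"
  have "\<exists>h\<in>H. \<exists>r\<in>?R. x = act h r" if "(v, x) \<in> E\<^sup>*" for x
    using that
  proof (cases rule: rtranclE)
    case base
    then show ?thesis using Ho act_one v by (intro bexI[of _ \<one>] bexI[of _ v]) auto
  next
    case (step y)
    then have "(x, y) \<in> E" using symD[OF Esym] by blast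
    then obtain h p q where h: "h \<in> H" "(p, q) \<in> P" "x = act h p" by (auto simp: E_def)
    then show ?thesis by (intro bexI[of _ h] bexI[of _ p]) force+
  qed
  moreover have "?R \<subseteq> X" using v PX by auto
  moreover have "finite ?R" using finP by simp
  ultimately have "\<exists>R. finite R \<and> R \<subseteq> X \<and> (\<forall>x. (v, x) \<in> E\<^sup>* \<longrightarrow> (\<exists>h\<in>H. \<exists>r\<in>R. x = act h r))"
    by (intro exI[of _ ?R]) simp
  from that[OF ET Esym invE conE _ this] nbrs show thesis by simp
qed

text \<open>
  The properties of an HNN extension from which the tree is built: \<open>j\<close> embeds the base group, and \<open>branch\<close>
  is the first syllable of an element, constant along right multiplication by generators as long as the
  base group is avoided. The two directions \<open>s\<close> treat the stable letter and its inverse alike.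
\<close>

locale hnn_splitting = A: group A + group G
  for A :: "('a, 'c) monoid_scheme" and G :: "('g, 'd) monoid_scheme" (structure) +
  fixes j :: "'a \<Rightarrow> 'g" and C :: "bool \<Rightarrow> 'a set" and t :: "bool \<Rightarrow> 'g" and branch :: "'g \<Rightarrow> 'k option"
  assumes j_hom: "j \<in> hom A G" and j_inj: "inj_on j (carrier A)"
    and C_subgroup: "subgroup (C s) A"
    and t_closed [simp]: "t s \<in> carrier G" and t_inv: "t (\<not> s) = inv (t s)"
    and C_conj: "c \<in> C s \<Longrightarrow> \<exists>d\<in>C (\<not> s). j c \<otimes> t s = t s \<otimes> j d"
    and branch_None: "g \<in> carrier G \<Longrightarrow> branch g = None \<longleftrightarrow> g \<in> j ` carrier A"
    and branch_base: "g \<in> carrier G \<Longrightarrow> a \<in> carrier A \<Longrightarrow> branch (g \<otimes> j a) = branch g"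
    and branch_stable: "g \<in> carrier G \<Longrightarrow> branch g \<noteq> None \<Longrightarrow> branch (g \<otimes> t s) \<noteq> None \<Longrightarrow>
      branch (g \<otimes> t s) = branch g"
    and branch_start: "a \<in> carrier A \<Longrightarrow> branch (j a \<otimes> t s) \<noteq> None"
    and branch_eqD: "a \<in> carrier A \<Longrightarrow> b \<in> carrier A \<Longrightarrow> branch (j a \<otimes> t s) = branch (j b \<otimes> t s') \<Longrightarrow>
      s = s' \<and> inv\<^bsub>A\<^esub> a \<otimes>\<^bsub>A\<^esub> b \<in> C s"
    and generated: "\<one> \<in> S \<Longrightarrow> (\<And>g a. g \<in> S \<Longrightarrow> a \<in> carrier A \<Longrightarrow> g \<otimes> j a \<in> S) \<Longrightarrow>
      (\<And>g s. g \<in> S \<Longrightarrow> g \<otimes> t s \<in> S) \<Longrightarrow> carrier G \<subseteq> S"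
begin

lemma j_closed [simp]: "a \<in> carrier A \<Longrightarrow> j a \<in> carrier G"
  using j_hom by (auto simp: hom_def)

lemma j_mult: "a \<in> carrier A \<Longrightarrow> b \<in> carrier A \<Longrightarrow> j (a \<otimes>\<^bsub>A\<^esub> b) = j a \<otimes> j b"
  using j_hom by (auto simp: hom_def)

sublocale J: group_hom A G j
  by unfold_locales (rule j_hom)

lemma C_carrier: "c \<in> C s \<Longrightarrow> c \<in> carrier A"
  by (rule subgroup.mem_carrier[OF C_subgroup])

definition vtx :: "'g \<Rightarrow> 'g set" where
  "vtx g = g <# (j ` carrier A)"

definition vertices :: "'g set set" where
  "vertices = vtx ` carrier G"

lemma mem_vtx: "x \<in> vtx g \<longleftrightarrow> (\<exists>a\<in>carrier A. x = g \<otimes> j a)"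
  by (auto simp: vtx_def l_coset_def)

lemma base_subset: "j ` carrier A \<subseteq> carrier G"
  by auto

lemma act_vtx: "h \<in> carrier G \<Longrightarrow> g \<in> carrier G \<Longrightarrow> h <# vtx g = vtx (h \<otimes> g)"
  unfolding vtx_def by (rule lcos_m_assoc[OF base_subset])

lemma vtx_mult_base:
  assumes "g \<in> carrier G" "a \<in> carrier A" shows "vtx (g \<otimes> j a) = vtx g"
proof (intro subset_antisym subsetI)
  fix x assume "x \<in> vtx (g \<otimes> j a)"
  then obtain b where "b \<in> carrier A" "x = g \<otimes> j a \<otimes> j b" by (auto simp: mem_vtx)
  then show "x \<in> vtx g" using assms unfolding mem_vtx
    by (intro bexI[of _ "a \<otimes>\<^bsub>A\<^esub> b"]) (simp_all add: j_mult m_assoc)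
next
  fix x assume "x \<in> vtx g"
  then obtain b where "b \<in> carrier A" "x = g \<otimes> j b" by (auto simp: mem_vtx)
  then show "x \<in> vtx (g \<otimes> j a)" using assms unfolding mem_vtx
    by (intro bexI[of _ "inv\<^bsub>A\<^esub> a \<otimes>\<^bsub>A\<^esub> b"]) (simp_all add: j_mult m_assoc inv_cancel)
qed

lemma vtx_eqD:
  assumes "g \<in> carrier G" "h \<in> carrier G" "vtx g = vtx h"
  shows "\<exists>a\<in>carrier A. h = g \<otimes> j a"
proof -
  have "h \<otimes> j \<one>\<^bsub>A\<^esub> \<in> vtx h" unfolding mem_vtx by blast
  then have "h \<in> vtx g" using assms(2) unfolding assms(3) by simp
  then show ?thesis unfolding mem_vtx .
qed

sublocale act: group_acting G vertices "l_coset G"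
proof
  fix g x assume "g \<in> carrier G" "x \<in> vertices"
  then show "g <# x \<in> vertices" by (auto simp: vertices_def act_vtx)
next
  fix x assume "x \<in> vertices"
  then show "\<one> <# x = x" by (auto simp: vertices_def act_vtx)
next
  fix g h x assume "g \<in> carrier G" "h \<in> carrier G" "x \<in> vertices"
  then show "g \<otimes> h <# x = g <# (h <# x)" by (auto simp: vertices_def act_vtx m_assoc)
qed

text \<open>
  The edges of direction \<open>s\<close>; the opposite direction consists of the reversed edges.
\<close>

definition T :: "bool \<Rightarrow> ('g set \<times> 'g set) set" where
  "T s = (\<lambda>g. (vtx g, vtx (g \<otimes> t s))) ` carrier G"

definition tree :: "('g set \<times> 'g set) set" where
  "tree = T True \<union> T False"

lemma tree_cases: "(x, y) \<in> tree \<longleftrightarrow> (\<exists>s. (x, y) \<in> T s)"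
  unfolding tree_def by (metis (full_types) Un_iff)

lemma TI: "g \<in> carrier G \<Longrightarrow> (vtx g, vtx (g \<otimes> t s)) \<in> T s"
  by (auto simp: T_def)

lemma vtx_in [simp]: "g \<in> carrier G \<Longrightarrow> vtx g \<in> vertices"
  by (simp add: vertices_def)

lemma T_vertices: "T s \<subseteq> vertices \<times> vertices"
  by (auto simp: T_def)

lemma t_cancel [simp]: "g \<in> carrier G \<Longrightarrow> g \<otimes> t s \<otimes> t (\<not> s) = g" "g \<in> carrier G \<Longrightarrow> g \<otimes> t (\<not> s) \<otimes> t s = g"
  by (simp_all add: t_inv m_assoc)

lemma T_converse: "T (\<not> s) = (T s)\<inverse>"
proof -
  have "(y, x) \<in> T (\<not> s)" if xy: "(x, y) \<in> T s" for x y s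
  proof -
    obtain g where g: "g \<in> carrier G" "x = vtx g" "y = vtx (g \<otimes> t s)" using xy by (auto simp: T_def)
    then show ?thesis using TI[of "g \<otimes> t s" "\<not> s"] by simp
  qed
  from this[of _ _ s] this[of _ _ "\<not> s"] show ?thesis by auto
qed

lemma T_invariant: "act.invariant (carrier G) (T s)"
  unfolding act.invariant_def T_def by (auto simp: act_vtx m_assoc image_iff)

lemma T_nbr:
  assumes "g \<in> carrier G" "(vtx g, y) \<in> T s"
  shows "\<exists>a\<in>carrier A. y = vtx (g \<otimes> j a \<otimes> t s)"
proof -
  obtain h where h: "h \<in> carrier G" "vtx g = vtx h" "y = vtx (h \<otimes> t s)" using assms by (auto simp: T_def)
  then show ?thesis using vtx_eqD[OF assms(1) h(1,2)] by auto
qed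

lemma branch_vtx: "g \<in> carrier G \<Longrightarrow> h \<in> carrier G \<Longrightarrow> vtx g = vtx h \<Longrightarrow> branch g = branch h"
  using vtx_eqD branch_base by metis

text \<open>
  The edges of direction \<open>s\<close> at the vertex of \<open>g\<close> correspond to the cosets \<open>a C s\<close> in the base group.
\<close>

lemma nbr_eqD:
  assumes g: "g \<in> carrier G" and ab: "a \<in> carrier A" "b \<in> carrier A"
    and eq: "vtx (g \<otimes> j a \<otimes> t s) = vtx (g \<otimes> j b \<otimes> t s')"
  shows "s = s' \<and> inv\<^bsub>A\<^esub> a \<otimes>\<^bsub>A\<^esub> b \<in> C s"
proof (rule branch_eqD[OF ab branch_vtx])
  have "inv g <# vtx (g \<otimes> j a \<otimes> t s) = inv g <# vtx (g \<otimes> j b \<otimes> t s')" using eq by simp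
  then show "vtx (j a \<otimes> t s) = vtx (j b \<otimes> t s')"
    using g ab by (simp add: act_vtx m_assoc inv_cancel)
qed (use ab in auto)

lemma nbr_eqI:
  assumes g: "g \<in> carrier G" and a: "a \<in> carrier A" and c: "c \<in> C s"
  shows "vtx (g \<otimes> j (a \<otimes>\<^bsub>A\<^esub> c) \<otimes> t s) = vtx (g \<otimes> j a \<otimes> t s)"
proof -
  obtain d where d: "d \<in> C (\<not> s)" "j c \<otimes> t s = t s \<otimes> j d" using C_conj[OF c] by blast
  have cd: "c \<in> carrier A" "d \<in> carrier A" using c d C_carrier by auto
  have "g \<otimes> j (a \<otimes>\<^bsub>A\<^esub> c) \<otimes> t s = (g \<otimes> j a \<otimes> t s) \<otimes> j d"
    using g a cd d(2) by (simp add: j_mult m_assoc)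
  then show ?thesis using vtx_mult_base[of "g \<otimes> j a \<otimes> t s" d] g a cd by simp
qed

lemma stable_not_base: "t s \<notin> j ` carrier A"
proof -
  have eq: "j \<one>\<^bsub>A\<^esub> \<otimes> t s = t s" by simp
  have "branch (t s) \<noteq> None" using branch_start[OF A.one_closed, of s] unfolding eq .
  then show ?thesis unfolding branch_None[OF t_closed, of s] .
qed

lemma branch_walk:
  assumes "(x, y) \<in> (avoiding (vtx \<one>) tree)\<^sup>*"
  shows "g \<in> carrier G \<Longrightarrow> h \<in> carrier G \<Longrightarrow> x = vtx g \<Longrightarrow> y = vtx h \<Longrightarrow> branch g = branch h"
  using assms
proof (induction arbitrary: h rule: rtrancl_induct)
  case base
  then show ?case using branch_vtx[of g h] by simp
next
  case (step y z)
  then have yz: "(y, z) \<in> tree" "y \<noteq> vtx \<one>" "z \<noteq> vtx \<one>" by (auto simp: avoiding_def)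
  then obtain k s where k: "k \<in> carrier G" "y = vtx k" "z = vtx (k \<otimes> t s)"
    unfolding tree_cases T_def by auto
  have nb: "branch u \<noteq> None" if u: "u \<in> carrier G" and ne: "vtx u \<noteq> vtx \<one>" for u
  proof
    assume "branch u = None"
    then obtain a where "a \<in> carrier A" "u = \<one> \<otimes> j a" using branch_None[OF u] by auto
    then show False using ne vtx_mult_base[OF one_closed] by simp
  qed
  have "branch g = branch k" using step.IH step.prems k by simp
  also have "\<dots> = branch (k \<otimes> t s)"
    using branch_stable[OF k(1) nb[OF k(1)] nb[of "k \<otimes> t s"]] k yz by simp
  also have "\<dots> = branch h" using branch_vtx[of "k \<otimes> t s" h] k step.prems by simp
  finally show ?case .
qed

lemma avoiding_act:
  assumes h: "h \<in> carrier G" and v: "v \<in> vertices" and xy: "(x, y) \<in> (avoiding v tree)\<^sup>*"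
  shows "(h <# x, h <# y) \<in> (avoiding (h <# v) tree)\<^sup>*"
  using xy
proof (induction rule: rtrancl_induct)
  case (step y z)
  then have yz: "(y, z) \<in> tree" "y \<noteq> v" "z \<noteq> v" by (auto simp: avoiding_def)
  then obtain s where s: "(y, z) \<in> T s" by (auto simp: tree_cases)
  then have X: "y \<in> vertices" "z \<in> vertices" using T_vertices by auto
  have "(h <# y, h <# z) \<in> avoiding (h <# v) tree"
    using act.invariantD[OF T_invariant h s] yz act.act_eqD[OF h _ v] X
    by (auto simp: avoiding_def tree_cases)
  then show ?case using step.IH by (rule rtrancl_into_rtrancl[rotated])
qed simp

text \<open>
  By homogeneity it suffices to cut the tree at the base vertex. There the first syllable is constant along
  walks that avoid the base vertex, and it determines the neighbour of the base vertex.
\<close>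

lemma forest_tree: "forest tree"
  unfolding forest_def
proof (intro conjI allI impI)
  show "sym tree" using T_converse[of True] by (auto simp: tree_def sym_def)
  show "irrefl tree"
  proof (rule irreflI, rule notI)
    fix x assume "(x, x) \<in> tree"
    then obtain g s where g: "g \<in> carrier G" "vtx g = vtx (g \<otimes> t s)" by (auto simp: tree_cases T_def)
    then obtain a where a: "a \<in> carrier A" "g \<otimes> t s = g \<otimes> j a" using vtx_eqD[of g "g \<otimes> t s"] by auto
    then have "t s = j a" using g by simp
    then show False using stable_not_base[of s] a by blast
  qed
  fix v x y
  assume vx: "(v, x) \<in> tree" and vy: "(v, y) \<in> tree" and w: "(x, y) \<in> (avoiding v tree)\<^sup>*"
  obtain s where s: "(v, x) \<in> T s" using vx tree_cases by blast
  obtain s' where s': "(v, y) \<in> T s'" using vy tree_cases by blast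
  obtain g where g: "g \<in> carrier G" "v = vtx g" using s by (auto simp: T_def)
  obtain a where a: "a \<in> carrier A" "x = vtx (g \<otimes> j a \<otimes> t s)" using T_nbr[OF g(1)] s g(2) by blast
  obtain b where b: "b \<in> carrier A" "y = vtx (g \<otimes> j b \<otimes> t s')" using T_nbr[OF g(1)] s' g(2) by blast
  have "(inv g <# x, inv g <# y) \<in> (avoiding (inv g <# v) tree)\<^sup>*"
    using avoiding_act[OF _ _ w] g by simp
  moreover have "inv g <# v = vtx \<one>" "inv g <# x = vtx (j a \<otimes> t s)" "inv g <# y = vtx (j b \<otimes> t s')"
    using g a b by (simp_all add: act_vtx m_assoc inv_cancel)
  ultimately have "branch (j a \<otimes> t s) = branch (j b \<otimes> t s')" using branch_walk a b by auto
  then have "s = s'" and c: "inv\<^bsub>A\<^esub> a \<otimes>\<^bsub>A\<^esub> b \<in> C s" using branch_eqD[OF a(1) b(1)] by auto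
  moreover have "a \<otimes>\<^bsub>A\<^esub> (inv\<^bsub>A\<^esub> a \<otimes>\<^bsub>A\<^esub> b) = b" using a b by (simp add: A.inv_cancel)
  ultimately show "x = y" using nbr_eqI[OF g(1) a(1) c] a b by simp
qed

lemma tree_connected: "g \<in> carrier G \<Longrightarrow> (vtx \<one>, vtx g) \<in> tree\<^sup>*"
proof -
  let ?S = "{g \<in> carrier G. (vtx \<one>, vtx g) \<in> tree\<^sup>*}"
  have "carrier G \<subseteq> ?S"
  proof (rule generated)
    show "g \<otimes> t s \<in> ?S" if "g \<in> ?S" for g s
    proof -
      have "(vtx g, vtx (g \<otimes> t s)) \<in> tree" using that TI by (auto simp: tree_cases)
      then show ?thesis using that by (auto intro: rtrancl_into_rtrancl)
    qed
  qed (auto simp: vtx_mult_base)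
  then show "(vtx \<one>, vtx g) \<in> tree\<^sup>*" if "g \<in> carrier G" using that by blast
qed

text \<open>
  The stabiliser in \<open>H\<close> of the vertex of \<open>g\<close>, moved into the base group by conjugation with \<open>g\<close>. The
  hypotheses on the base group are applied to these subgroups.
\<close>

definition local_group :: "'g set \<Rightarrow> 'g \<Rightarrow> 'a set" where
  "local_group H g = {a \<in> carrier A. g \<otimes> j a \<otimes> inv g \<in> H}"

lemma conj_base_hom: "g \<in> carrier G \<Longrightarrow> group_hom A G (\<lambda>a. g \<otimes> j a \<otimes> inv g)"
  by unfold_locales (auto intro!: homI simp: m_assoc inv_cancel j_mult)

lemma conj_base_inj: "g \<in> carrier G \<Longrightarrow> inj_on (\<lambda>a. g \<otimes> j a \<otimes> inv g) (carrier A)"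
  using j_inj by (auto simp: inj_on_def)

lemma local_group_carrier: "a \<in> local_group H g \<Longrightarrow> a \<in> carrier A"
  by (simp add: local_group_def)

lemma subgroup_local_group:
  assumes "subgroup H G" "g \<in> carrier G" shows "subgroup (local_group H g) A"
proof -
  interpret K: group_hom A G "\<lambda>a. g \<otimes> j a \<otimes> inv g" by (rule conj_base_hom[OF assms(2)])
  show ?thesis
  proof (rule subgroup.intro)
    show "\<one>\<^bsub>A\<^esub> \<in> local_group H g"
      using K.hom_one subgroup.one_closed[OF assms(1)] by (simp add: local_group_def)
    show "a \<otimes>\<^bsub>A\<^esub> b \<in> local_group H g" if "a \<in> local_group H g" "b \<in> local_group H g" for a b
      using that K.hom_mult[of a b] subgroup.m_closed[OF assms(1)] by (simp add: local_group_def)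
    show "inv\<^bsub>A\<^esub> a \<in> local_group H g" if "a \<in> local_group H g" for a
      using that K.hom_inv[of a] subgroup.m_inv_closed[OF assms(1)] by (simp add: local_group_def)
  qed (auto simp: local_group_def)
qed

lemma stab_vtx:
  assumes H: "subgroup H G" and g: "g \<in> carrier G"
  shows "act.stab H (vtx g) = (\<lambda>a. g \<otimes> j a \<otimes> inv g) ` local_group H g"
proof (intro subset_antisym subsetI)
  fix h assume "h \<in> act.stab H (vtx g)"
  then have h: "h \<in> H" "h \<in> carrier G" "vtx (h \<otimes> g) = vtx g"
    using subgroup.mem_carrier[OF H] g by (auto simp: act.stab_def act_vtx)
  then obtain a where a: "a \<in> carrier A" "h \<otimes> g = g \<otimes> j a"
    using vtx_eqD[of g "h \<otimes> g"] g by auto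
  have "h = h \<otimes> g \<otimes> inv g" using h g by (simp add: m_assoc)
  then have "h = g \<otimes> j a \<otimes> inv g" using a by simp
  then show "h \<in> (\<lambda>a. g \<otimes> j a \<otimes> inv g) ` local_group H g" using a h(1) by (auto simp: local_group_def)
next
  fix h assume "h \<in> (\<lambda>a. g \<otimes> j a \<otimes> inv g) ` local_group H g"
  then obtain a where a: "a \<in> carrier A" "h = g \<otimes> j a \<otimes> inv g" "h \<in> H" by (auto simp: local_group_def)
  then have "h \<otimes> g = g \<otimes> j a" "h \<in> carrier G" using g by (simp_all add: m_assoc)
  then show "h \<in> act.stab H (vtx g)" using a g vtx_mult_base by (simp add: act.stab_def act_vtx)
qed

lemma fg_local_group:
  assumes "subgroup H G" "g \<in> carrier G" "fg_subgroup (act.stab H (vtx g)) G"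
  shows "fg_subgroup (local_group H g) A"
  using assms stab_vtx[OF assms(1,2)]
  by (intro group_hom.fg_subgroup_inj_img[OF conj_base_hom[OF assms(2)] conj_base_inj[OF assms(2)] subgroup_local_group]) simp_all

text \<open>
  An edge stabiliser in \<open>H\<close> is conjugate to the intersection of a conjugate of \<open>H\<close> with \<open>C True\<close>, for either
  direction of the edge. Here the f.g.i.p. of \<open>G\<close> relative to the associated subgroup enters.
\<close>

lemma fg_edge_stabilizer:
  assumes rel: "fgip_rel G (j ` C True)" and H: "fg_subgroup H G" and xy: "(x, y) \<in> tree"
  shows "fg_subgroup (act.stab H x \<inter> act.stab H y) G"
proof -
  have HG: "subgroup H G" using H by (rule fg_subgroup_subgroup)
  note mem = subgroup.mem_carrier[OF HG]
  have 1: "fg_subgroup (act.stab H (vtx g) \<inter> act.stab H (vtx (g \<otimes> t True))) G" if g: "g \<in> carrier G" for g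
  proof -
    let ?k = "\<lambda>x. g \<otimes> x \<otimes> inv g"
    have "act.stab H (vtx g) \<inter> act.stab H (vtx (g \<otimes> t True)) = ?k ` (conj_subgroup G H g \<inter> j ` C True)"
    proof (intro subset_antisym subsetI)
      fix h assume h: "h \<in> act.stab H (vtx g) \<inter> act.stab H (vtx (g \<otimes> t True))"
      then obtain a where a: "a \<in> carrier A" "h = g \<otimes> j a \<otimes> inv g" "h \<in> H"
        using stab_vtx[OF HG g] by (auto simp: local_group_def)
      have "vtx (g \<otimes> t True) = h <# vtx (g \<otimes> t True)" using h by (simp add: act.stab_def)
      also have "\<dots> = vtx (g \<otimes> j a \<otimes> t True)" using g a by (simp add: act_vtx m_assoc inv_cancel)
      finally have "inv\<^bsub>A\<^esub> \<one>\<^bsub>A\<^esub> \<otimes>\<^bsub>A\<^esub> a \<in> C True" using nbr_eqD[OF g _ a(1), of "\<one>\<^bsub>A\<^esub>" True True] g by simp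
      then have "j a \<in> j ` C True" using a(1) by simp
      moreover have "j a \<in> conj_subgroup G H g"
        unfolding mem_conj_subgroup using a g by (intro bexI[of _ h]) (simp_all add: m_assoc inv_cancel)
      ultimately show "h \<in> ?k ` (conj_subgroup G H g \<inter> j ` C True)" using a(2) by blast
    next
      fix h assume "h \<in> ?k ` (conj_subgroup G H g \<inter> j ` C True)"
      then obtain c h' where c: "c \<in> C True" "h = g \<otimes> j c \<otimes> inv g" "h' \<in> H" "j c = inv g \<otimes> h' \<otimes> g"
        by (auto simp: mem_conj_subgroup)
      have cA: "c \<in> carrier A" using c C_carrier by blast
      have "h = h'" unfolding c(2,4) using g mem[OF c(3)] by (simp add: m_assoc inv_cancel)
      then have hH: "h \<in> H" using c by simp
      have "h <# vtx g = vtx g"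
        using g cA vtx_mult_base[OF g cA] unfolding c(2) by (simp add: act_vtx m_assoc)
      moreover have "h <# vtx (g \<otimes> t True) = vtx (g \<otimes> t True)"
        using g cA nbr_eqI[OF g _ c(1), of "\<one>\<^bsub>A\<^esub>"] unfolding c(2) by (simp add: act_vtx m_assoc inv_cancel)
      ultimately show "h \<in> act.stab H (vtx g) \<inter> act.stab H (vtx (g \<otimes> t True))"
        using hH by (simp add: act.stab_def)
    qed
    moreover have "fg_subgroup (conj_subgroup G H g \<inter> j ` C True) G"
      using rel fg_conj_subgroup[OF H g] by (simp add: fgip_rel_def)
    ultimately show ?thesis using fg_subgroup_conj g by simp
  qed
  obtain s where s: "(x, y) \<in> T s" using xy tree_cases by blast
  show ?thesis
  proof (cases s)
    case True
    then show ?thesis using s 1 by (auto simp: T_def)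
  next
    case False
    then have "(y, x) \<in> T True" using s T_converse[of True] by auto
    then show ?thesis using 1 by (auto simp: T_def Int_commute)
  qed
qed

text \<open>
  The edges of direction \<open>s\<close> at the vertex of \<open>g\<close> that belong to \<open>E\<close>; a union of cosets of \<open>C s\<close>.
\<close>

definition edge_labels :: "('g set \<times> 'g set) set \<Rightarrow> 'g \<Rightarrow> bool \<Rightarrow> 'a set" where
  "edge_labels E g s = {a \<in> carrier A. (vtx g, vtx (g \<otimes> j a \<otimes> t s)) \<in> E}"

lemma edge_labels_finite_union:
  assumes H: "subgroup H G" and g: "g \<in> carrier G" and E: "E \<subseteq> vertices \<times> vertices"
    and nb: "act.finite_nbrs H E (vtx g)"
  shows "\<exists>F. finite F \<and> F \<subseteq> carrier A \<and> edge_labels E g s \<subseteq> (\<Union>f\<in>F. double_coset A (local_group H g) f (C s))"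
proof -
  obtain N where N: "finite N" "\<And>y. (vtx g, y) \<in> E \<Longrightarrow> \<exists>h\<in>act.stab H (vtx g). \<exists>n\<in>N. y = h <# n" 
    "N \<subseteq> E `` {vtx g}"
    using nb unfolding act.finite_nbrs_def by blast
  let ?P = "\<lambda>n a. a \<in> carrier A \<and> n = vtx (g \<otimes> j a \<otimes> t s)"
  let ?N = "{n \<in> N. \<exists>a. ?P n a}"
  have "\<forall>n\<in>?N. \<exists>a. ?P n a" by simp
  then obtain c where c: "\<forall>n\<in>?N. ?P n (c n)" by (rule bchoice[THEN exE])
  have "a \<in> (\<Union>f\<in>c ` ?N. double_coset A (local_group H g) f (C s))" if "a \<in> edge_labels E g s" for a
  proof -
    have a: "a \<in> carrier A" "(vtx g, vtx (g \<otimes> j a \<otimes> t s)) \<in> E"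
      using \<open>a \<in> edge_labels E g s\<close> by (auto simp: edge_labels_def)
    obtain h n where hn: "h \<in> act.stab H (vtx g)" "n \<in> N" "vtx (g \<otimes> j a \<otimes> t s) = h <# n" using N(2)[OF a(2)] by blast
    obtain b where b: "b \<in> local_group H g" "h = g \<otimes> j b \<otimes> inv g" using hn(1) stab_vtx[OF H g] by auto
    have bA: "b \<in> carrier A" using b by (simp add: local_group_def)
    have hc: "h \<in> carrier G" using b g bA by simp
    have hi: "inv h = g \<otimes> j (inv\<^bsub>A\<^esub> b) \<otimes> inv g" using b g bA by (simp add: inv_mult_group m_assoc)
    have hstab: "h \<in> H" "h <# vtx g = vtx g" using hn(1) by (auto simp: act.stab_def)
    show ?thesis
    proof -
      have True: "n \<in> vertices" using hn(2) N(3) E by blast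
      have "n = inv h <# (h <# n)" using act.act_inv_cancel(1)[OF hc True] by simp
      also have "\<dots> = vtx (g \<otimes> j (inv\<^bsub>A\<^esub> b \<otimes>\<^bsub>A\<^esub> a) \<otimes> t s)"
        using hn(3)[symmetric] hi g a bA by (simp add: act_vtx m_assoc inv_cancel j_mult)
      finally have "?P n (inv\<^bsub>A\<^esub> b \<otimes>\<^bsub>A\<^esub> a)" using a bA by simp
      then have nN: "n \<in> ?N" using hn(2) by blast
      define f where "f = c n"
      have f: "f \<in> carrier A" "n = vtx (g \<otimes> j f \<otimes> t s)" using bspec[OF c nN] by (auto simp: f_def)
      have "h <# vtx (g \<otimes> j f \<otimes> t s) = vtx (g \<otimes> j (b \<otimes>\<^bsub>A\<^esub> f) \<otimes> t s)"
        unfolding b(2) using f(1) g bA by (simp add: act_vtx m_assoc inv_cancel j_mult)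
      then have "vtx (g \<otimes> j (b \<otimes>\<^bsub>A\<^esub> f) \<otimes> t s) = vtx (g \<otimes> j a \<otimes> t s)"
        unfolding hn(3) f(2)[symmetric] by (rule HOL.sym)
      then have "inv\<^bsub>A\<^esub> (b \<otimes>\<^bsub>A\<^esub> f) \<otimes>\<^bsub>A\<^esub> a \<in> C s"
        using nbr_eqD[OF g A.m_closed[OF bA f(1)] a(1)] by blast
      moreover have "a = b \<otimes>\<^bsub>A\<^esub> f \<otimes>\<^bsub>A\<^esub> (inv\<^bsub>A\<^esub> (b \<otimes>\<^bsub>A\<^esub> f) \<otimes>\<^bsub>A\<^esub> a)"
        using f(1) bA a by (simp add: A.inv_cancel)
      ultimately have "a \<in> double_coset A (local_group H g) f (C s)"
        unfolding A.mem_double_coset using b(1) by blast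
      moreover have "f \<in> c ` ?N" unfolding f_def using nN by (rule imageI)
      ultimately show ?thesis by (rule UN_I[rotated])
    qed
  qed
  moreover have "c ` ?N \<subseteq> carrier A" using c by blast
  ultimately show ?thesis using N(1) by (intro exI[of _ "c ` ?N"]) (simp add: subsetI)
qed

end

section \<open>Intersections of finitely generated subgroups\<close>

context hnn_splitting
begin

lemma fg_vertex_groups:
  assumes rel: "fgip_rel G (j ` C True)" and H: "fg_subgroup H G"
    and E: "E \<subseteq> tree" "sym E" "act.invariant H E" "\<forall>h\<in>H. (vtx \<one>, h <# vtx \<one>) \<in> E\<^sup>*"
      "\<forall>x\<in>vertices. act.finite_nbrs H E x"
    and g: "g \<in> carrier G" "(vtx \<one>, vtx g) \<in> E\<^sup>*"
  shows "fg_subgroup (local_group H g) A"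
proof -
  have HG: "subgroup H G" using H by (rule fg_subgroup_subgroup)
  have EX: "E \<subseteq> vertices \<times> vertices" using E(1) T_vertices by (auto simp: tree_def)
  have "fg_subgroup (act.stab H (vtx g)) G"
  proof (rule act.fg_vertex_stabilizer[OF H forest_tree E(1) EX E(2,3) vtx_in[OF g(1)]])
    fix h assume h: "h \<in> H"
    have 1: "(vtx g, vtx \<one>) \<in> E\<^sup>*" using g(2) symD[OF sym_rtrancl[OF E(2)]] by blast
    have 2: "(vtx \<one>, h <# vtx \<one>) \<in> E\<^sup>*" using E(4) h by blast
    have 3: "(h <# vtx \<one>, h <# vtx g) \<in> E\<^sup>*" using act.act_rtrancl[OF E(3) h g(2)] .
    show "(vtx g, h <# vtx g) \<in> E\<^sup>*" using rtrancl_trans[OF 1 rtrancl_trans[OF 2 3]] .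
  next
    show "act.finite_nbrs H E (vtx g)" using E(5) vtx_in[OF g(1)] by blast
    show "fg_subgroup (act.stab H (vtx g) \<inter> act.stab H y) G" if "(vtx g, y) \<in> E" for y
      using fg_edge_stabilizer[OF rel H] E(1) that by blast
  qed
  then show ?thesis by (rule fg_local_group[OF HG g(1)])
qed

text \<open>
  Let \<open>g1\<close>, \<open>g2\<close> represent an \<open>H\<close>-orbit and a \<open>K\<close>-orbit of vertices, with local groups \<open>B\<close>, \<open>C\<close>. A vertex in
  both orbits is that of \<open>h g1\<close> and of \<open>k g2 = h g1 a\<close> with \<open>a\<close> in the base group, and the double coset
  \<open>B a C\<close> determines its orbit under \<open>H \<inter> K\<close>. Its edges in both subgraphs correspond to the cosets in
  \<open>U \<inter> a V\<close>, where \<open>U\<close> and \<open>V\<close> are the sets of edge labels at \<open>g1\<close> and \<open>g2\<close>. Thus by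
  \<open>fcip_pair_almost_all_unique\<close> only finitely many orbits contain a vertex with two edges in one
  direction, and \<open>fg_of_finitely_many_branchings\<close> applies.
\<close>

lemma fg_intersection:
  assumes fgA: "fgip A" and fcip: "\<And>s. fcip_rel A (C s)" and pair: "\<And>s. fgip_pair A (C s)"
    and rel: "fgip_rel G (j ` C True)" and H: "fg_subgroup H G" and K: "fg_subgroup K G"
  shows "fg_subgroup (H \<inter> K) G"
proof -
  have HG: "subgroup H G" and KG: "subgroup K G" using H K by (simp_all add: fg_subgroup_subgroup)
  let ?L = "H \<inter> K"
  have LG: "subgroup ?L G" using HG KG by (rule subgroups_Inter_pair)
  note Hc = subgroup.mem_carrier[OF HG] and Kc = subgroup.mem_carrier[OF KG]
  let ?v = "vtx \<one>"
  have v: "?v \<in> vertices" by simp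
  have treeX: "tree \<subseteq> vertices \<times> vertices" using T_vertices by (auto simp: tree_def)
  have symT: "sym tree" using forest_tree by (simp add: forest_def)
  have invT: "act.invariant M tree" if "M \<subseteq> carrier G" for M
    using T_invariant that by (auto simp: act.invariant_def tree_cases) (metis subsetD)
  have conT: "(?v, h <# ?v) \<in> tree\<^sup>*" if "h \<in> carrier G" for h
    using tree_connected[OF that] act_vtx[OF that one_closed] that by simp
  obtain E1 where E1: "E1 \<subseteq> tree" "sym E1" "act.invariant H E1" "\<forall>h\<in>H. (?v, h <# ?v) \<in> E1\<^sup>*"
    "\<forall>x\<in>vertices. act.finite_nbrs H E1 x"
    "\<exists>R. finite R \<and> R \<subseteq> vertices \<and> (\<forall>x. (?v, x) \<in> E1\<^sup>* \<longrightarrow> (\<exists>h\<in>H. \<exists>r\<in>R. x = h <# r))"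
    using act.cofinite_invariant_subgraph[OF H treeX symT invT[OF subgroup.subset[OF HG]] v conT[OF Hc]] .
  obtain E2 where E2: "E2 \<subseteq> tree" "sym E2" "act.invariant K E2" "\<forall>h\<in>K. (?v, h <# ?v) \<in> E2\<^sup>*"
    "\<forall>x\<in>vertices. act.finite_nbrs K E2 x"
    "\<exists>R. finite R \<and> R \<subseteq> vertices \<and> (\<forall>x. (?v, x) \<in> E2\<^sup>* \<longrightarrow> (\<exists>h\<in>K. \<exists>r\<in>R. x = h <# r))"
    using act.cofinite_invariant_subgraph[OF K treeX symT invT[OF subgroup.subset[OF KG]] v conT[OF Kc]] .
  have EX: "E1 \<subseteq> vertices \<times> vertices" "E2 \<subseteq> vertices \<times> vertices" using E1(1) E2(1) treeX by auto
  define E where "E = (\<lambda>s. E1 \<inter> E2 \<inter> T s)"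
  let ?E = "E True \<union> E False"
  have E_eq: "?E = E1 \<inter> E2" using E1(1) by (auto simp: E_def tree_def)
  have reach1: "(?v, x) \<in> E1\<^sup>*" and reach2: "(?v, x) \<in> E2\<^sup>*" if "(?v, x) \<in> ?E\<^sup>*" for x
    using that rtrancl_mono[of ?E E1] rtrancl_mono[of ?E E2] E_eq by auto
  have fg1: "fg_subgroup (local_group H g) A" if "g \<in> carrier G" "(?v, vtx g) \<in> E1\<^sup>*" for g
    by (rule fg_vertex_groups[OF rel H E1(1-5) that])
  have fg2: "fg_subgroup (local_group K g) A" if "g \<in> carrier G" "(?v, vtx g) \<in> E2\<^sup>*" for g
    by (rule fg_vertex_groups[OF rel K E2(1-5) that])
  have labels1: "\<exists>F. finite F \<and> F \<subseteq> carrier A \<and> edge_labels E1 g s \<subseteq> (\<Union>f\<in>F. double_coset A (local_group H g) f (C s))"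
    if g: "g \<in> carrier G" for g s
    by (rule edge_labels_finite_union[OF HG g EX(1)]) (use E1(5) g in simp)
  have labels2: "\<exists>F. finite F \<and> F \<subseteq> carrier A \<and> edge_labels E2 g s \<subseteq> (\<Union>f\<in>F. double_coset A (local_group K g) f (C s))"
    if g: "g \<in> carrier G" for g s
    by (rule edge_labels_finite_union[OF KG g EX(2)]) (use E2(5) g in simp)
  have EsX: "E s \<subseteq> vertices \<times> vertices" for s using EX by (auto simp: E_def)
  have Econv: "E (\<not> s) = (E s)\<inverse>" for s
    using E1(2) E2(2) T_converse[of s] by (auto simp: E_def dest: symD)
  have Einv: "act.invariant ?L (E s)" for s
    using E1(3) E2(3) T_invariant[of s] Hc by (auto simp: act.invariant_def E_def)
  have Econn: "(?v, h <# ?v) \<in> ?E\<^sup>*" if "h \<in> ?L" for h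
    unfolding E_eq using forest_walks_meet[OF forest_tree E1(1) E2(1)] E1(4) E2(4) that by blast
  have Einv': "act.invariant ?L ?E" using Einv by (auto simp: act.invariant_def)
  \<comment> \<open>Besides the branching vertices, the orbit of the base vertex is included, so that \<open>Bd\<close> is never empty.\<close>
  define B0 where "B0 = {x. (?v, x) \<in> ?E\<^sup>* \<and> (\<exists>s y y'. (x, y) \<in> E s \<and> (x, y') \<in> E s \<and> y \<noteq> y')}"
  define Bd where "Bd = B0 \<union> (\<lambda>h. h <# ?v) ` ?L"
  have reachX: "x \<in> vertices" if "(?v, x) \<in> ?E\<^sup>*" for x
    by (rule act.rtrancl_in_X[OF that _ v]) (use EsX in blast)
  have reachL: "(?v, h <# x) \<in> ?E\<^sup>*" if "h \<in> ?L" "(?v, x) \<in> ?E\<^sup>*" for h x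
    using rtrancl_trans[OF Econn[OF that(1)] act.act_rtrancl[OF Einv' that]] .
  have Bdreach: "(?v, b) \<in> ?E\<^sup>*" if "b \<in> Bd" for b
    using that Econn by (auto simp: Bd_def B0_def)
  have BdX: "b \<in> vertices" if "b \<in> Bd" for b using reachX[OF Bdreach[OF that]] .
  have Lc: "h \<in> carrier G" if "h \<in> ?L" for h using that Hc by blast
  have stabs: "fg_subgroup (act.stab ?L b) G" if b: "b \<in> Bd" for b
  proof -
    obtain g where g: "g \<in> carrier G" "b = vtx g" using BdX[OF b] by (auto simp: vertices_def)
    have "fg_subgroup (local_group H g) A" "fg_subgroup (local_group K g) A"
      using fg1 fg2 g reach1 reach2 Bdreach[OF b] by auto
    then have "fg_subgroup (local_group H g \<inter> local_group K g) A" using fgA by (simp add: fgip_def)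
    moreover have "local_group H g \<inter> local_group K g = local_group ?L g" by (auto simp: local_group_def)
    ultimately show ?thesis
      unfolding g(2) stab_vtx[OF LG g(1)] using group_hom.fg_subgroup_img[OF conj_base_hom[OF g(1)]] by simp
  qed
  have nbrs: "act.finite_nbrs ?L (E s) b" if b: "b \<in> Bd" for b s
  proof -
    obtain g where g: "g \<in> carrier G" "b = vtx g" using BdX[OF b] by (auto simp: vertices_def)
    have fg: "fg_subgroup (local_group H g) A" "fg_subgroup (local_group K g) A"
      using fg1 fg2 g reach1 reach2 Bdreach[OF b] by auto
    obtain F1 where F1: "finite F1" "F1 \<subseteq> carrier A"
      "edge_labels E1 g s \<subseteq> (\<Union>f\<in>F1. double_coset A (local_group H g) f (C s))"
      using labels1[OF g(1), of s] by (elim exE conjE)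
    obtain F2 where F2: "finite F2" "F2 \<subseteq> carrier A"
      "edge_labels E2 g s \<subseteq> (\<Union>f\<in>F2. double_coset A (local_group K g) f (C s))"
      using labels2[OF g(1), of s] by (elim exE conjE)
    obtain N where N: "finite N" "N \<subseteq> edge_labels E1 g s \<inter> edge_labels E2 g s"
      "\<forall>x\<in>edge_labels E1 g s \<inter> edge_labels E2 g s.
         \<exists>n\<in>N. \<exists>u\<in>local_group H g \<inter> local_group K g. \<exists>e\<in>C s. x = u \<otimes>\<^bsub>A\<^esub> n \<otimes>\<^bsub>A\<^esub> e"
      using A.fcip_finite_orbits[OF fcip fg F1(1,2) F2(1,2) F1(3) F2(3)] by (elim exE conjE)
    show ?thesis unfolding g(2)
    proof (rule act.finite_nbrsI[OF LG Einv vtx_in[OF g(1)]])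
      let ?N = "(\<lambda>n. vtx (g \<otimes> j n \<otimes> t s)) ` N"
      have NA: "n \<in> carrier A" if "n \<in> N" for n using N(2) that by (auto simp: edge_labels_def)
      show "finite ?N" using N(1) by simp
      show "?N \<subseteq> vertices" using NA g by auto
      fix y assume y: "(vtx g, y) \<in> E s"
      then obtain a where a: "a \<in> carrier A" "y = vtx (g \<otimes> j a \<otimes> t s)"
        using T_nbr[OF g(1), of y s] by (auto simp: E_def)
      then have "a \<in> edge_labels E1 g s \<inter> edge_labels E2 g s" using y by (auto simp: edge_labels_def E_def)
      then obtain n u e where n: "n \<in> N" "u \<in> local_group H g \<inter> local_group K g" "e \<in> C s" "a = u \<otimes>\<^bsub>A\<^esub> n \<otimes>\<^bsub>A\<^esub> e"
        using N(3) by blast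
      have uA: "u \<in> carrier A" using n by (simp add: local_group_def)
      let ?h = "g \<otimes> j u \<otimes> inv g"
      have "u \<in> local_group ?L g" using n(2) by (auto simp: local_group_def)
      then have "?h \<in> act.stab ?L (vtx g)" unfolding stab_vtx[OF LG g(1)] by (rule imageI)
      moreover have "y = ?h <# vtx (g \<otimes> j n \<otimes> t s)"
        unfolding a(2) n(4) using nbr_eqI[OF g(1) _ n(3), of "u \<otimes>\<^bsub>A\<^esub> n"] uA NA[OF n(1)] g(1)
        by (simp add: act_vtx m_assoc inv_cancel j_mult)
      ultimately show "\<exists>h\<in>act.stab ?L (vtx g). \<exists>n\<in>?N. y = h <# n" using n(1) by blast
    qed
  qed
  obtain R1 where R1: "finite R1" "R1 \<subseteq> vertices" "\<forall>x. (?v, x) \<in> E1\<^sup>* \<longrightarrow> (\<exists>h\<in>H. \<exists>r\<in>R1. x = h <# r)"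
    using E1(6) by (elim exE conjE)
  obtain R2 where R2: "finite R2" "R2 \<subseteq> vertices" "\<forall>x. (?v, x) \<in> E2\<^sup>* \<longrightarrow> (\<exists>h\<in>K. \<exists>r\<in>R2. x = h <# r)"
    using E2(6) by (elim exE conjE)
  define \<rho> where "\<rho> = (\<lambda>r. SOME g. g \<in> carrier G \<and> r = vtx g)"
  have \<rho>: "\<rho> r \<in> carrier G \<and> r = vtx (\<rho> r)" if r: "r \<in> vertices" for r
  proof -
    obtain g where "g \<in> carrier G \<and> r = vtx g" using r by (auto simp: vertices_def)
    then show ?thesis unfolding \<rho>_def by (rule someI)
  qed
  \<comment> \<open>The double cosets of vertices over \<open>r1\<close> and \<open>r2\<close> with two edges in direction \<open>s\<close>.\<close>
  define bad where "bad = (\<lambda>r1 r2 s. {double_coset A (local_group H (\<rho> r1)) a (local_group K (\<rho> r2)) | a.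
      a \<in> carrier A \<and> (\<exists>x y. x \<in> edge_labels E1 (\<rho> r1) s \<inter> (a <#\<^bsub>A\<^esub> edge_labels E2 (\<rho> r2) s) \<and>
        y \<in> edge_labels E1 (\<rho> r1) s \<inter> (a <#\<^bsub>A\<^esub> edge_labels E2 (\<rho> r2) s) \<and> inv\<^bsub>A\<^esub> x \<otimes>\<^bsub>A\<^esub> y \<notin> C s)})"
  let ?R1 = "{r \<in> R1. (?v, r) \<in> E1\<^sup>*}" and ?R2 = "{r \<in> R2. (?v, r) \<in> E2\<^sup>*}"
  have finbad: "finite (bad r1 r2 s)" if "r1 \<in> ?R1" "r2 \<in> ?R2" for r1 r2 s
  proof -
    have g: "\<rho> r1 \<in> carrier G" "\<rho> r2 \<in> carrier G" "(?v, vtx (\<rho> r1)) \<in> E1\<^sup>*" "(?v, vtx (\<rho> r2)) \<in> E2\<^sup>*"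
      using that \<rho> R1(2) R2(2) by auto
    obtain F1 where F1: "finite F1" "F1 \<subseteq> carrier A"
      "edge_labels E1 (\<rho> r1) s \<subseteq> (\<Union>f\<in>F1. double_coset A (local_group H (\<rho> r1)) f (C s))"
      using labels1[OF g(1), of s] by (elim exE conjE)
    obtain F2 where F2: "finite F2" "F2 \<subseteq> carrier A"
      "edge_labels E2 (\<rho> r2) s \<subseteq> (\<Union>f\<in>F2. double_coset A (local_group K (\<rho> r2)) f (C s))"
      using labels2[OF g(2), of s] by (elim exE conjE)
    show ?thesis unfolding bad_def
      by (rule A.fcip_pair_almost_all_unique[OF fcip pair fg1[OF g(1,3)] fg2[OF g(2,4)] F1(1,2) F2(1,2) F1(3) F2(3)])
  qed
  \<comment> \<open>The label of a vertex: its orbits under \<open>H\<close> and \<open>K\<close>, a direction, and its double coset.\<close>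
  define Q where "Q = (\<lambda>(r1, r2, s :: bool, D) x. \<exists>h\<in>H. \<exists>k\<in>K. \<exists>a\<in>carrier A. x = vtx (h \<otimes> \<rho> r1) \<and>
     k \<otimes> \<rho> r2 = h \<otimes> \<rho> r1 \<otimes> j a \<and> D = double_coset A (local_group H (\<rho> r1)) a (local_group K (\<rho> r2)))"
  let ?I = "SIGMA r1:?R1. SIGMA r2:?R2. SIGMA s:(UNIV :: bool set). bad r1 r2 s"
  have finI: "finite ?I" using R1(1) R2(1) finbad by (intro finite_SigmaI) auto
  have exI: "\<exists>l\<in>?I. Q l x" if x: "x \<in> B0" for x
  proof -
    obtain s y y' where x': "(?v, x) \<in> ?E\<^sup>*" "(x, y) \<in> E s" "(x, y') \<in> E s" "y \<noteq> y'"
      using x by (auto simp: B0_def)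
    have x1: "(?v, x) \<in> E1\<^sup>*" and x2: "(?v, x) \<in> E2\<^sup>*" using reach1 reach2 x'(1) by auto
    obtain h r1 where h: "h \<in> H" "r1 \<in> R1" "x = h <# r1" using R1(3) x1 by blast
    obtain k r2 where k: "k \<in> K" "r2 \<in> R2" "x = k <# r2" using R2(3) x2 by blast
    have hk: "h \<in> carrier G" "k \<in> carrier G" using h k Hc Kc by auto
    have r: "r1 \<in> vertices" "r2 \<in> vertices" using h k R1 R2 by auto
    have hi: "inv h \<in> H" "inv k \<in> K" using h k subgroup.m_inv_closed HG KG by auto
    have "(inv h <# ?v, inv h <# x) \<in> E1\<^sup>*" "(inv k <# ?v, inv k <# x) \<in> E2\<^sup>*"
      using act.act_rtrancl[OF E1(3) hi(1) x1] act.act_rtrancl[OF E2(3) hi(2) x2] .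
    moreover have "inv h <# x = r1" unfolding h(3) by (rule act.act_inv_cancel(1)[OF hk(1) r(1)])
    moreover have "inv k <# x = r2" unfolding k(3) by (rule act.act_inv_cancel(1)[OF hk(2) r(2)])
    moreover have "(?v, inv h <# ?v) \<in> E1\<^sup>*" "(?v, inv k <# ?v) \<in> E2\<^sup>*" using E1(4) E2(4) hi by auto
    ultimately have R: "r1 \<in> ?R1" "r2 \<in> ?R2" using h(2) k(2) by (auto intro: rtrancl_trans)
    let ?g1 = "\<rho> r1" and ?g2 = "\<rho> r2"
    have g: "?g1 \<in> carrier G" "?g2 \<in> carrier G" "r1 = vtx ?g1" "r2 = vtx ?g2" using \<rho> r by auto
    have xh: "x = vtx (h \<otimes> ?g1)" using h(3) g act_vtx[OF hk(1) g(1)] by simp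
    have xk: "x = vtx (k \<otimes> ?g2)" using k(3) g act_vtx[OF hk(2) g(2)] by simp
    obtain a where a: "a \<in> carrier A" "k \<otimes> ?g2 = h \<otimes> ?g1 \<otimes> j a"
      using vtx_eqD[of "h \<otimes> ?g1" "k \<otimes> ?g2"] xh xk hk g by auto
    have hg: "h \<otimes> ?g1 \<in> carrier G" using hk g by simp
    have lab: "\<exists>b\<in>edge_labels E1 ?g1 s \<inter> (a <#\<^bsub>A\<^esub> edge_labels E2 ?g2 s). z = vtx (h \<otimes> ?g1 \<otimes> j b \<otimes> t s)"
      if z: "(x, z) \<in> E s" for z
    proof -
      have zs: "(x, z) \<in> E1" "(x, z) \<in> E2" "(x, z) \<in> T s" using z by (auto simp: E_def)
      obtain b where b: "b \<in> carrier A" "z = vtx (h \<otimes> ?g1 \<otimes> j b \<otimes> t s)"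
        using T_nbr[OF hg, of z s] zs(3) xh by auto
      have "(inv h <# x, inv h <# z) \<in> E1" using act.invariantD[OF E1(3) hi(1) zs(1)] .
      then have 1: "b \<in> edge_labels E1 ?g1 s"
        using b g hk unfolding xh b(2) by (simp add: edge_labels_def act_vtx m_assoc inv_cancel)
      let ?c = "inv\<^bsub>A\<^esub> a \<otimes>\<^bsub>A\<^esub> b"
      have "h \<otimes> ?g1 = k \<otimes> ?g2 \<otimes> j (inv\<^bsub>A\<^esub> a)" unfolding a(2) using hg a(1) by (simp add: m_assoc)
      then have z2: "z = vtx (k \<otimes> ?g2 \<otimes> j ?c \<otimes> t s)" using b a hk g(1,2) by (simp add: j_mult m_assoc inv_cancel)
      have c: "?c \<in> carrier A" using a b by simp
      have "(inv k <# vtx (k \<otimes> ?g2), inv k <# vtx (k \<otimes> ?g2 \<otimes> j ?c \<otimes> t s)) \<in> E2"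
        using act.invariantD[OF E2(3) hi(2) zs(2)] unfolding xk z2 .
      moreover have "inv k <# vtx (k \<otimes> ?g2) = vtx ?g2"
        "inv k <# vtx (k \<otimes> ?g2 \<otimes> j ?c \<otimes> t s) = vtx (?g2 \<otimes> j ?c \<otimes> t s)"
        using c hk g(1,2) by (simp_all add: act_vtx m_assoc inv_cancel del: j_mult J.hom_mult)
      ultimately have "?c \<in> edge_labels E2 ?g2 s" using c by (simp add: edge_labels_def)
      moreover have "b = a \<otimes>\<^bsub>A\<^esub> ?c" using a b by (simp add: A.inv_cancel)
      ultimately have "b \<in> a <#\<^bsub>A\<^esub> edge_labels E2 ?g2 s" unfolding l_coset_def by blast
      with 1 b(2) show ?thesis by blast
    qed
    obtain b where b: "b \<in> edge_labels E1 ?g1 s \<inter> (a <#\<^bsub>A\<^esub> edge_labels E2 ?g2 s)" "y = vtx (h \<otimes> ?g1 \<otimes> j b \<otimes> t s)"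
      using lab[OF x'(2)] by blast
    obtain b' where b': "b' \<in> edge_labels E1 ?g1 s \<inter> (a <#\<^bsub>A\<^esub> edge_labels E2 ?g2 s)" "y' = vtx (h \<otimes> ?g1 \<otimes> j b' \<otimes> t s)"
      using lab[OF x'(3)] by blast
    have bA: "b \<in> carrier A" "b' \<in> carrier A" using b b' by (auto simp: edge_labels_def)
    have "inv\<^bsub>A\<^esub> b \<otimes>\<^bsub>A\<^esub> b' \<notin> C s"
    proof
      assume c: "inv\<^bsub>A\<^esub> b \<otimes>\<^bsub>A\<^esub> b' \<in> C s"
      have "b \<otimes>\<^bsub>A\<^esub> (inv\<^bsub>A\<^esub> b \<otimes>\<^bsub>A\<^esub> b') = b'" using bA by (simp add: A.inv_cancel)
      then show False using nbr_eqI[OF hg bA(1) c] b(2) b'(2) x'(4) by simp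
    qed
    then have D: "double_coset A (local_group H ?g1) a (local_group K ?g2) \<in> bad r1 r2 s"
      unfolding bad_def using a(1) b(1) b'(1) by blast
    have "Q (r1, r2, s, double_coset A (local_group H ?g1) a (local_group K ?g2)) x"
      unfolding Q_def prod.case using h(1) k(1) a xh by blast
    moreover have "(r1, r2, s, double_coset A (local_group H ?g1) a (local_group K ?g2)) \<in> ?I"
      using R D by (intro SigmaI UNIV_I)
    ultimately show ?thesis by (rule bexI)
  qed
  have same: "\<exists>u\<in>?L. x' = u <# x" if l: "l \<in> ?I" and x: "Q l x" and x': "Q l x'" for l x x'
  proof -
    obtain r1 r2 s D where ld: "l = (r1, r2, s, D)" by (cases l)
    have r: "r1 \<in> vertices" "r2 \<in> vertices" using l R1(2) R2(2) unfolding ld by auto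
    let ?g1 = "\<rho> r1" and ?g2 = "\<rho> r2"
    have g: "?g1 \<in> carrier G" "?g2 \<in> carrier G" using \<rho> r by auto
    obtain h k a where h: "h \<in> H" "k \<in> K" "a \<in> carrier A" "x = vtx (h \<otimes> ?g1)" "k \<otimes> ?g2 = h \<otimes> ?g1 \<otimes> j a"
      "D = double_coset A (local_group H ?g1) a (local_group K ?g2)"
      using x unfolding ld Q_def prod.case by (elim bexE conjE)
    obtain h' k' a' where h': "h' \<in> H" "k' \<in> K" "a' \<in> carrier A" "x' = vtx (h' \<otimes> ?g1)" "k' \<otimes> ?g2 = h' \<otimes> ?g1 \<otimes> j a'"
      "D = double_coset A (local_group H ?g1) a' (local_group K ?g2)"
      using x' unfolding ld Q_def prod.case by (elim bexE conjE)
    have one: "\<one>\<^bsub>A\<^esub> \<in> local_group H ?g1" "\<one>\<^bsub>A\<^esub> \<in> local_group K ?g2"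
      using subgroup.one_closed[OF subgroup_local_group] HG KG g by blast+
    have "\<one>\<^bsub>A\<^esub> \<otimes>\<^bsub>A\<^esub> a' \<otimes>\<^bsub>A\<^esub> \<one>\<^bsub>A\<^esub> \<in> D"
      unfolding h'(6) A.mem_double_coset using one by blast
    then have "a' \<in> D" using h'(3) by simp
    then obtain b c where bc: "b \<in> local_group H ?g1" "c \<in> local_group K ?g2" "a' = b \<otimes>\<^bsub>A\<^esub> a \<otimes>\<^bsub>A\<^esub> c"
      unfolding h(6) A.mem_double_coset by blast
    have bcA: "b \<in> carrier A" "c \<in> carrier A" using bc local_group_carrier by auto
    let ?b = "?g1 \<otimes> j b \<otimes> inv ?g1" and ?c = "?g2 \<otimes> j c \<otimes> inv ?g2"
    have bH: "?b \<in> H" and cK: "?c \<in> K" using bc by (auto simp: local_group_def)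
    have mem: "h \<in> carrier G" "k \<in> carrier G" "h' \<in> carrier G" "k' \<in> carrier G" using h h' Hc Kc by auto
    let ?u = "h' \<otimes> ?b \<otimes> inv h"
    have uH: "?u \<in> H" using h h' bH subgroup.m_closed[OF HG] subgroup.m_inv_closed[OF HG] by simp
    have ja: "j a = inv ?g1 \<otimes> inv h \<otimes> (k \<otimes> ?g2)" unfolding h(5) using mem g h(3) by (simp add: m_assoc inv_cancel)
    have "j a' = inv ?g1 \<otimes> inv h' \<otimes> (k' \<otimes> ?g2)" unfolding h'(5) using mem g h'(3) by (simp add: m_assoc inv_cancel)
    then have "inv ?g1 \<otimes> inv h' \<otimes> (k' \<otimes> ?g2) = j b \<otimes> (inv ?g1 \<otimes> inv h \<otimes> (k \<otimes> ?g2)) \<otimes> j c"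
      using bc(3) bcA h(3) by (simp add: j_mult flip: ja)
    then have "h' \<otimes> ?g1 \<otimes> (inv ?g1 \<otimes> inv h' \<otimes> (k' \<otimes> ?g2)) \<otimes> (inv (j c) \<otimes> inv ?g2 \<otimes> inv k)
       = h' \<otimes> ?g1 \<otimes> (j b \<otimes> (inv ?g1 \<otimes> inv h \<otimes> (k \<otimes> ?g2)) \<otimes> j c) \<otimes> (inv (j c) \<otimes> inv ?g2 \<otimes> inv k)" by simp
    then have "k' \<otimes> (?g2 \<otimes> inv (j c) \<otimes> inv ?g2) \<otimes> inv k = ?u"
      using mem g bcA by (simp add: m_assoc inv_cancel)
    moreover have "?g2 \<otimes> inv (j c) \<otimes> inv ?g2 = inv ?c" using g bcA by (simp add: m_assoc inv_mult_group)
    ultimately have "?u = k' \<otimes> inv ?c \<otimes> inv k" by simp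
    also have "\<dots> \<in> K" using h(2) h'(2) cK subgroup.m_closed[OF KG] subgroup.m_inv_closed[OF KG] by simp
    finally have "?u \<in> ?L" using uH by simp
    moreover have "?u <# x = x'"
      unfolding h(4) h'(4) using mem g bcA vtx_mult_base[of "h' \<otimes> ?g1" b]
      by (simp add: act_vtx m_assoc inv_cancel)
    ultimately show ?thesis by blast
  qed
  obtain N where N: "finite N" "N \<subseteq> B0" "\<forall>x\<in>B0. \<exists>n\<in>N. \<exists>l\<in>?I. Q l n \<and> Q l x"
    using finite_representatives[of ?I B0 Q, OF finI exI] .
  show ?thesis
  proof (rule act.fg_of_finitely_many_branchings[OF LG EsX Econv Einv v Econn, where Bd = Bd and R = "insert ?v N"])
    show "Bd \<subseteq> vertices" using BdX by blast
    have vBd: "?v \<in> Bd" unfolding Bd_def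
    proof (intro UnI2 image_eqI)
      show "?v = \<one> <# ?v" using act.act_one[OF v] by simp
      show "\<one> \<in> ?L" by (rule subgroup.one_closed[OF LG])
    qed
    then show "?v \<in> Bd" .
    show "h <# b \<in> Bd" if h: "h \<in> ?L" and b: "b \<in> Bd" for h b
    proof (cases "b \<in> B0")
      case True
      then obtain s y y' where b': "(?v, b) \<in> ?E\<^sup>*" "(b, y) \<in> E s" "(b, y') \<in> E s" "y \<noteq> y'"
        by (auto simp: B0_def)
      have "y \<in> vertices" "y' \<in> vertices" using b' EsX by blast+
      then have "h <# y \<noteq> h <# y'" using act.act_eqD[OF Lc[OF h]] b'(4) by blast
      then have "h <# b \<in> B0"
        using reachL[OF h b'(1)] act.invariantD[OF Einv h b'(2)] act.invariantD[OF Einv h b'(3)]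
        unfolding B0_def by blast
      then show ?thesis by (simp add: Bd_def)
    next
      case False
      then obtain k where k: "k \<in> ?L" "b = k <# ?v" using b by (auto simp: Bd_def)
      then have "h <# b = h \<otimes> k <# ?v" using act.act_mult[OF Lc[OF h] Lc[OF k(1)] v] by simp
      then show ?thesis using subgroup.m_closed[OF LG h k(1)] by (auto simp: Bd_def)
    qed
    show "(?v, b) \<in> ?E\<^sup>*" if "b \<in> Bd" for b using Bdreach[OF that] .
    show "finite (insert ?v N)" using N by simp
    show "insert ?v N \<subseteq> Bd" using N vBd by (auto simp: Bd_def)
    show "\<exists>h\<in>?L. \<exists>r\<in>insert ?v N. b = h <# r" if "b \<in> Bd" for b
    proof (cases "b \<in> B0")
      case True
      then obtain n l where n: "n \<in> N" "l \<in> ?I" "Q l n" "Q l b" using bspec[OF N(3)] by blast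
      then show ?thesis using same[OF n(2-4)] by blast
    qed (use that in \<open>auto simp: Bd_def\<close>)
    show "fg_subgroup (act.stab ?L b) G" if "b \<in> Bd" for b using stabs[OF that] .
    show "act.finite_nbrs ?L (E s) b" if "b \<in> Bd" for b s using nbrs[OF that] .
    show "y = y'" if "(?v, x) \<in> ?E\<^sup>*" "x \<notin> Bd" "(x, y) \<in> E s" "(x, y') \<in> E s" for x y y' s
      using that by (auto simp: Bd_def B0_def)
  qed
qed

end

theorem theoremG:
  fixes A :: "('a, 'b) monoid_scheme" and C1 C2 :: "'a set" and \<phi> :: "'a \<Rightarrow> 'a"
  assumes "group A"
    and "subgroup C1 A" and "subgroup C2 A"
    and "\<phi> \<in> iso (A\<lparr>carrier := C1\<rparr>) (A\<lparr>carrier := C2\<rparr>)"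
    and "fgip A"
    and "fcip_rel A C1" and "fcip_rel A C2"
    and "fgip_pair A C1" and "fgip_pair A C2"
  shows "fgip (hnn_extension A C1 \<phi>) \<longleftrightarrow>
         fgip_rel (hnn_extension A C1 \<phi>) (hnn_base A C1 \<phi> ` C1)"
proof -
  interpret hnn_data A C1 C2 \<phi>
    using assms(1-4) by (simp add: hnn_data_def hnn_data_axioms_def)
  interpret split: hnn_splitting A HNN base assoc_sub stable branch
  proof -
    interpret H: group HNN by (rule group_hnn_extension)
    show "hnn_splitting A HNN base assoc_sub stable branch"
    proof (intro hnn_splitting.intro hnn_splitting_axioms.intro)
      show "group A" "group HNN" by unfold_locales
      show "base \<in> hom A HNN" by (rule hnn_base_hom)
      show "inj_on base (carrier A)" by (rule inj_base)
      show "subgroup (assoc_sub s) A" for s by (rule subgroup_assoc_sub)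
      show "stable s \<in> carrier HNN" for s by simp
      show "stable (\<not> s) = inv\<^bsub>HNN\<^esub> stable s" for s by (rule stable_inverse)
      show "\<exists>d\<in>assoc_sub (\<not> s). base c \<otimes>\<^bsub>HNN\<^esub> stable s = stable s \<otimes>\<^bsub>HNN\<^esub> base d" if "c \<in> assoc_sub s" for c s
        using stable_conj[OF that] transport_in[OF that] by blast
      show "branch g = None \<longleftrightarrow> g \<in> base ` carrier A" if "g \<in> carrier HNN" for g
        by (rule branch_None_iff[OF that])
      show "branch (g \<otimes>\<^bsub>HNN\<^esub> base a) = branch g" if "g \<in> carrier HNN" "a \<in> carrier A" for g a
        by (rule branch_base_mult[OF that])
      show "branch (g \<otimes>\<^bsub>HNN\<^esub> stable s) = branch g"
        if "g \<in> carrier HNN" "branch g \<noteq> None" "branch (g \<otimes>\<^bsub>HNN\<^esub> stable s) \<noteq> None" for g s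
        by (rule branch_stable_mult[OF that])
      show "branch (base a \<otimes>\<^bsub>HNN\<^esub> stable s) \<noteq> None" if "a \<in> carrier A" for a s
        by (simp add: branch_base_stable[OF that])
      show "s = s' \<and> inv\<^bsub>A\<^esub> a \<otimes>\<^bsub>A\<^esub> b \<in> assoc_sub s"
        if "a \<in> carrier A" "b \<in> carrier A" "branch (base a \<otimes>\<^bsub>HNN\<^esub> stable s) = branch (base b \<otimes>\<^bsub>HNN\<^esub> stable s')" for a b s s'
        using that rep_eqD[of a b s] by (auto simp: branch_base_stable)
      show "carrier HNN \<subseteq> S"
        if "\<one>\<^bsub>HNN\<^esub> \<in> S" "\<And>g a. g \<in> S \<Longrightarrow> a \<in> carrier A \<Longrightarrow> g \<otimes>\<^bsub>HNN\<^esub> base a \<in> S"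
          "\<And>g s. g \<in> S \<Longrightarrow> g \<otimes>\<^bsub>HNN\<^esub> stable s \<in> S" for S
        using hnn_induct[of _ "\<lambda>g. g \<in> S"] that by blast
    qed
  qed
  have C1_eq: "assoc_sub True = C1" by (simp add: assoc_sub_def)
  have fcip: "fcip_rel A (assoc_sub s)" and pair: "fgip_pair A (assoc_sub s)" for s
    using assms by (simp_all add: assoc_sub_def)
  show ?thesis
  proof
    assume "fgip HNN"
    moreover have "fg_subgroup (base ` C1) HNN"
      using assms(6) split.J.fg_subgroup_img by (simp add: fcip_rel_def)
    ultimately show "fgip_rel HNN (base ` C1)" by (simp add: fgip_def fgip_rel_def)
  next
    assume "fgip_rel HNN (base ` C1)"
    then show "fgip HNN"
      unfolding fgip_def using split.fg_intersection[OF assms(5) fcip pair] by (simp add: C1_eq)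
  qed
qed

end
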